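(* Let $p$ be a prime, $k$ a perfect field of characteristic $p$, and $R$ a finite-dimensional (commutative, unital) $k$-algebra. Then there is an isomorphism of Dieudonné modules, natural in $R$, $$\mathbb D^{\mathrm f}(\mathrm{Fr}(R))\cong CW(R),$$ where $\mathrm{Fr}(R)$ is the free formal group on $R$ and $\mathbb D^{\mathrm f}(G)=\mathrm{Hom}_{\mathrm{Fgps}_k}(G,CW)$.
   Context: $\mathrm{alg}_k$ is the category of finite-dimensional commutative unital $k$-algebras, $\mathrm{Pro}\text{-}\mathrm{alg}_k$ its category of pro-objects. A formal group over $k$ is an ind-representable functor $\mathrm{alg}_k\to\mathrm{Ab}$ to abelian groups; these form the category $\mathrm{Fgps}_k$. The forgetful functor $\mathrm{Fgps}_k\to(\mathrm{Pro}\text{-}\mathrm{alg}_k)^{\mathrm{op}}$, sending a formal group to its representing pro-algebra, has a left adjoint $\mathrm{Fr}$, the free formal group functor. A Dieudonné module is a $W(k)$-module $M$ ($W(k)$ the $p$-typical Witt vectors of $k$, with Frobenius $\mathrm{frob}$) with additive maps $F,V\colon M\to M$ such that $FV=VF=p$, $Fa=\mathrm{frob}(a)F$ and $aV=V\,\mathrm{frob}(a)$ for $a\in W(k)$. For a $k$-algebra $R$, $CW(R)$ is the set of sequences $(\dots,a_{-1},a_0)$ in $R$ such that for some $r\ge 0$ the ideal generated by $a_{-r},a_{-r-1},\dots$ is nilpotent. Addition is given by $(a+b)_{-n}=\lim_{m\to\infty}S_m(a_{-n-m},\dots,a_{-n},b_{-n-m},\dots,b_{-n})$ (these sequences are eventually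 constant), where $S_m$ is the polynomial giving the $m$th component of $p$-typical Witt vector addition; $F(\dots,a_{-1},a_0)=(\dots,a_{-1}^p,a_0^p)$ and $V(\dots,a_{-1},a_0)=(\dots,a_{-2},a_{-1})$; the $W(k)$-module structure is Fontaine's, for which the Teichmüller representative of $c\in k$ acts by $(\dots,a_{-1},a_0)\mapsto(\dots,c^{p^{-1}}a_{-1},c\,a_0)$. By a known result of Fontaine, the functor $CW$ restricted to $\mathrm{alg}_k$ is ind-representable, so it is a formal group, and it carries actions of $W(k)$, $F$, $V$. For a formal group $G$, $\mathbb D^{\mathrm f}(G)=\mathrm{Hom}_{\mathrm{Fgps}_k}(G,CW)$ is a Dieudonné module via these actions on $CW$. *)

theory Defs
  imports
    "HOL-Library.FuncSet"
    "HOL-Library.Poly_Mapping"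
    "HOL-Library.Equipollence"
    "HOL-Computational_Algebra.Primes"
    "HOL-Algebra.Module"
    "HOL-Algebra.Ideal_Product"
begin

section \<open>Categories, functors, adjunctions\<close>

text \<open>
  Hom-sets need not be disjoint, so composition and the action of a functor on morphisms take
  the objects as arguments: \<open>Comp C X Y Z g f\<close> is \<open>g \<circ> f\<close> for \<open>f : X \<rightarrow> Y\<close>, \<open>g : Y \<rightarrow> Z\<close>.
\<close>

record ('o, 'm) cat =
  Ob :: "'o set"
  Hom :: "'o \<Rightarrow> 'o \<Rightarrow> 'm set"
  Id :: "'o \<Rightarrow> 'm"
  Comp :: "'o \<Rightarrow> 'o \<Rightarrow> 'o \<Rightarrow> 'm \<Rightarrow> 'm \<Rightarrow> 'm"

definition is_category :: "('o, 'm) cat \<Rightarrow> bool" where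
  "is_category C \<longleftrightarrow>
     (\<forall>X\<in>Ob C. Id C X \<in> Hom C X X) \<and>
     (\<forall>X\<in>Ob C. \<forall>Y\<in>Ob C. \<forall>Z\<in>Ob C. \<forall>f\<in>Hom C X Y. \<forall>g\<in>Hom C Y Z.
        Comp C X Y Z g f \<in> Hom C X Z) \<and>
     (\<forall>X\<in>Ob C. \<forall>Y\<in>Ob C. \<forall>f\<in>Hom C X Y.
        Comp C X X Y f (Id C X) = f \<and> Comp C X Y Y (Id C Y) f = f) \<and>
     (\<forall>W\<in>Ob C. \<forall>X\<in>Ob C. \<forall>Y\<in>Ob C. \<forall>Z\<in>Ob C.
        \<forall>f\<in>Hom C W X. \<forall>g\<in>Hom C X Y. \<forall>h\<in>Hom C Y Z.
          Comp C W Y Z h (Comp C W X Y g f) = Comp C W X Z (Comp C X Y Z h g) f)"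

definition op_cat :: "('o, 'm) cat \<Rightarrow> ('o, 'm) cat" where
  "op_cat C = \<lparr>Ob = Ob C, Hom = (\<lambda>X Y. Hom C Y X), Id = Id C,
               Comp = (\<lambda>X Y Z g f. Comp C Z Y X f g)\<rparr>"

record ('o, 'm, 'o2, 'm2) cat_functor =
  on_ob :: "'o \<Rightarrow> 'o2"
  on_mor :: "'o \<Rightarrow> 'o \<Rightarrow> 'm \<Rightarrow> 'm2"

definition is_functor ::
  "('o, 'm) cat \<Rightarrow> ('o2, 'm2) cat \<Rightarrow> ('o, 'm, 'o2, 'm2) cat_functor \<Rightarrow> bool" where
  "is_functor C D F \<longleftrightarrow>
     (\<forall>X\<in>Ob C. on_ob F X \<in> Ob D) \<and>
     (\<forall>X\<in>Ob C. \<forall>Y\<in>Ob C. \<forall>f\<in>Hom C X Y. on_mor F X Y f \<in> Hom D (on_ob F X) (on_ob F Y)) \<and>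
     (\<forall>X\<in>Ob C. on_mor F X X (Id C X) = Id D (on_ob F X)) \<and>
     (\<forall>X\<in>Ob C. \<forall>Y\<in>Ob C. \<forall>Z\<in>Ob C. \<forall>f\<in>Hom C X Y. \<forall>g\<in>Hom C Y Z.
        on_mor F X Z (Comp C X Y Z g f) =
          Comp D (on_ob F X) (on_ob F Y) (on_ob F Z) (on_mor F Y Z g) (on_mor F X Y f))"

definition nat_trans ::
  "('o, 'm) cat \<Rightarrow> ('o2, 'm2) cat \<Rightarrow> ('o, 'm, 'o2, 'm2) cat_functor \<Rightarrow>
     ('o, 'm, 'o2, 'm2) cat_functor \<Rightarrow> ('o \<Rightarrow> 'm2) set" where
  "nat_trans C D F G =
     {\<tau> \<in> (\<Pi>\<^sub>E X\<in>Ob C. Hom D (on_ob F X) (on_ob G X)).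
        \<forall>X\<in>Ob C. \<forall>Y\<in>Ob C. \<forall>f\<in>Hom C X Y.
          Comp D (on_ob F X) (on_ob F Y) (on_ob G Y) (\<tau> Y) (on_mor F X Y f) =
          Comp D (on_ob F X) (on_ob G X) (on_ob G Y) (on_mor G X Y f) (\<tau> X)}"

definition functor_cat ::
  "('o, 'm) cat \<Rightarrow> ('o2, 'm2) cat \<Rightarrow> (('o, 'm, 'o2, 'm2) cat_functor, 'o \<Rightarrow> 'm2) cat" where
  "functor_cat C D =
     \<lparr>Ob = {F. is_functor C D F},
      Hom = nat_trans C D,
      Id = (\<lambda>F. \<lambda>X\<in>Ob C. Id D (on_ob F X)),
      Comp = (\<lambda>F G H \<sigma> \<tau>. \<lambda>X\<in>Ob C. Comp D (on_ob F X) (on_ob G X) (on_ob H X) (\<sigma> X) (\<tau> X))\<rparr>"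

definition full_subcat :: "('o, 'm) cat \<Rightarrow> ('o \<Rightarrow> bool) \<Rightarrow> ('o, 'm) cat" where
  "full_subcat C P = C\<lparr>Ob := {X \<in> Ob C. P X}\<rparr>"

definition left_adjoint ::
  "('o, 'm) cat \<Rightarrow> ('o2, 'm2) cat \<Rightarrow> ('o, 'm, 'o2, 'm2) cat_functor \<Rightarrow>
     ('o2, 'm2, 'o, 'm) cat_functor \<Rightarrow> bool" where
  "left_adjoint C D L R \<longleftrightarrow>
     is_functor C D L \<and> is_functor D C R \<and>
     (\<exists>\<theta>.
       (\<forall>X\<in>Ob C. \<forall>Y\<in>Ob D. bij_betw (\<theta> X Y) (Hom D (on_ob L X) Y) (Hom C X (on_ob R Y))) \<and>
       (\<forall>X\<in>Ob C. \<forall>X'\<in>Ob C. \<forall>Y\<in>Ob D. \<forall>Y'\<in>Ob D.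
         \<forall>f\<in>Hom C X' X. \<forall>g\<in>Hom D Y Y'. \<forall>h\<in>Hom D (on_ob L X) Y.
           \<theta> X' Y' (Comp D (on_ob L X') Y Y' g
                      (Comp D (on_ob L X') (on_ob L X) Y h (on_mor L X' X f))) =
           Comp C X' (on_ob R Y) (on_ob R Y') (on_mor R Y Y' g)
             (Comp C X' X (on_ob R Y) (\<theta> X Y h) f)))"


section \<open>Pro-objects\<close>

definition cofiltered :: "('o, 'm) cat \<Rightarrow> bool" where
  "cofiltered I \<longleftrightarrow> is_category I \<and> Ob I \<noteq> {} \<and>
     (\<forall>i\<in>Ob I. \<forall>j\<in>Ob I. \<exists>k\<in>Ob I. Hom I k i \<noteq> {} \<and> Hom I k j \<noteq> {}) \<and>
     (\<forall>i\<in>Ob I. \<forall>j\<in>Ob I. \<forall>u\<in>Hom I i j. \<forall>v\<in>Hom I i j.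
        \<exists>k\<in>Ob I. \<exists>w\<in>Hom I k i. Comp I k i j u w = Comp I k i j v w)"

record ('i, 'o, 'm) pro_obj =
  index :: "('i, 'i) cat"
  diag :: "('i, 'i, 'o, 'm) cat_functor"

text \<open>
  \<open>pro_colim C X A\<close> is the colimit of the sets \<open>Hom(X\<^sub>i, A)\<close>; a morphism from \<open>X\<close> to \<open>Y\<close> is an
  element of the limit over \<open>j\<close> of the sets \<open>pro_colim C X Y\<^sub>j\<close>.
\<close>

definition germ_rel ::
  "('o, 'm) cat \<Rightarrow> ('i, 'o, 'm) pro_obj \<Rightarrow> 'o \<Rightarrow> (('i \<times> 'm) \<times> ('i \<times> 'm)) set" where
  "germ_rel C X A =
     {((i, f), (i', f')). i \<in> Ob (index X) \<and> i' \<in> Ob (index X) \<and>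
        f \<in> Hom C (on_ob (diag X) i) A \<and> f' \<in> Hom C (on_ob (diag X) i') A \<and>
        (\<exists>k\<in>Ob (index X). \<exists>u\<in>Hom (index X) k i. \<exists>u'\<in>Hom (index X) k i'.
           Comp C (on_ob (diag X) k) (on_ob (diag X) i) A f (on_mor (diag X) k i u) =
           Comp C (on_ob (diag X) k) (on_ob (diag X) i') A f' (on_mor (diag X) k i' u'))}"

definition germ ::
  "('o, 'm) cat \<Rightarrow> ('i, 'o, 'm) pro_obj \<Rightarrow> 'o \<Rightarrow> 'i \<Rightarrow> 'm \<Rightarrow> ('i \<times> 'm) set" where
  "germ C X A i f = germ_rel C X A `` {(i, f)}"

definition pro_colim ::
  "('o, 'm) cat \<Rightarrow> ('i, 'o, 'm) pro_obj \<Rightarrow> 'o \<Rightarrow> ('i \<times> 'm) set set" where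
  "pro_colim C X A = (SIGMA i:Ob (index X). Hom C (on_ob (diag X) i) A) // germ_rel C X A"

definition pro_push ::
  "('o, 'm) cat \<Rightarrow> ('i, 'o, 'm) pro_obj \<Rightarrow> 'o \<Rightarrow> 'o \<Rightarrow> 'm \<Rightarrow> ('i \<times> 'm) set \<Rightarrow> ('i \<times> 'm) set" where
  "pro_push C X A B g c = (\<Union>(i, f)\<in>c. germ C X B i (Comp C (on_ob (diag X) i) A B g f))"

definition pro_hom ::
  "('o, 'm) cat \<Rightarrow> ('i, 'o, 'm) pro_obj \<Rightarrow> ('i, 'o, 'm) pro_obj \<Rightarrow> ('i \<Rightarrow> ('i \<times> 'm) set) set" where
  "pro_hom C X Y =
     {\<phi> \<in> (\<Pi>\<^sub>E j\<in>Ob (index Y). pro_colim C X (on_ob (diag Y) j)).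
        \<forall>j\<in>Ob (index Y). \<forall>j'\<in>Ob (index Y). \<forall>v\<in>Hom (index Y) j j'.
          pro_push C X (on_ob (diag Y) j) (on_ob (diag Y) j') (on_mor (diag Y) j j' v) (\<phi> j) = \<phi> j'}"

definition pro_cat ::
  "('o, 'm) cat \<Rightarrow> (('i, 'o, 'm) pro_obj, 'i \<Rightarrow> ('i \<times> 'm) set) cat" where
  "pro_cat C =
     \<lparr>Ob = {X. cofiltered (index X) \<and> is_functor (index X) C (diag X)},
      Hom = pro_hom C,
      Id = (\<lambda>X. \<lambda>j\<in>Ob (index X). germ C X (on_ob (diag X) j) j (Id C (on_ob (diag X) j))),
      Comp = (\<lambda>X Y Z \<psi> \<phi>. \<lambda>k\<in>Ob (index Z).
        \<Union>(j, f)\<in>\<psi> k. pro_push C X (on_ob (diag Y) j) (on_ob (diag Z) k) f (\<phi> j))\<rparr>"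

text \<open>The embedding of \<open>C\<close> into its pro-category; the index category has a single morphism.\<close>

definition pro_const :: "('o, 'm) cat \<Rightarrow> 'o \<Rightarrow> ('i, 'o, 'm) pro_obj" where
  "pro_const C A =
     \<lparr>index = \<lparr>Ob = {undefined}, Hom = (\<lambda>_ _. {undefined}), Id = (\<lambda>_. undefined),
               Comp = (\<lambda>_ _ _ _ _. undefined)\<rparr>,
      diag = \<lparr>on_ob = (\<lambda>_. A), on_mor = (\<lambda>_ _ _. Id C A)\<rparr>\<rparr>"

definition pro_const_mor ::
  "('o, 'm) cat \<Rightarrow> 'o \<Rightarrow> 'o \<Rightarrow> 'm \<Rightarrow> ('i \<Rightarrow> ('i \<times> 'm) set)" where
  "pro_const_mor C A B f = (\<lambda>j\<in>{undefined}. germ C (pro_const C A) B undefined f)"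


section \<open>Finite-dimensional algebras, abelian groups, formal groups\<close>

definition perfect_field_char :: "nat \<Rightarrow> 'k ring \<Rightarrow> bool" where
  "perfect_field_char p K \<longleftrightarrow> field K \<and> prime p \<and> [p] \<cdot>\<^bsub>K\<^esub> \<one>\<^bsub>K\<^esub> = \<zero>\<^bsub>K\<^esub> \<and>
     (\<forall>c\<in>carrier K. \<exists>d\<in>carrier K. d [^]\<^bsub>K\<^esub> p = c)"

definition fin_dim :: "'k ring \<Rightarrow> ('k, 'a) module \<Rightarrow> bool" where
  "fin_dim K A \<longleftrightarrow> (\<exists>B. finite B \<and> B \<subseteq> carrier A \<and>
     (\<forall>x\<in>carrier A. \<exists>c\<in>B \<rightarrow> carrier K. x = (\<Oplus>\<^bsub>A\<^esub>b\<in>B. c b \<odot>\<^bsub>A\<^esub> b)))"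

definition alg_hom :: "'k ring \<Rightarrow> ('k, 'a) module \<Rightarrow> ('k, 'a) module \<Rightarrow> ('a \<Rightarrow> 'a) set" where
  "alg_hom K A B = {f \<in> ring_hom A B. f \<in> extensional (carrier A) \<and>
     (\<forall>c\<in>carrier K. \<forall>x\<in>carrier A. f (c \<odot>\<^bsub>A\<^esub> x) = c \<odot>\<^bsub>B\<^esub> f x)}"

definition alg_cat :: "'k ring \<Rightarrow> (('k, 'a) module, 'a \<Rightarrow> 'a) cat" where
  "alg_cat K = \<lparr>Ob = {A. algebra K A \<and> fin_dim K A},
     Hom = alg_hom K,
     Id = (\<lambda>A. \<lambda>x\<in>carrier A. x),
     Comp = (\<lambda>A B C g f. compose (carrier A) g f)\<rparr>"

definition ab_cat :: "('g monoid, 'g \<Rightarrow> 'g) cat" where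
  "ab_cat = \<lparr>Ob = {G. comm_group G},
     Hom = (\<lambda>G H. hom G H \<inter> extensional (carrier G)),
     Id = (\<lambda>G. \<lambda>x\<in>carrier G. x),
     Comp = (\<lambda>G H L g f. compose (carrier G) g f)\<rparr>"

text \<open>
  Universes.  The carriers of finite-dimensional algebras are subsets of a type \<open>'a\<close>; the carriers
  of the groups \<open>G(A)\<close> and the index categories of pro-objects live in \<open>nat \<Rightarrow> 'a\<close>.  If \<open>'a\<close> is
  infinite and at least as large as \<open>K\<close>, every finite-dimensional algebra has a copy on \<open>'a\<close>, and
  \<open>nat \<Rightarrow> 'a\<close> is closed under all constructions involved: the values \<open>CW(A)\<close> are sets of sequences
  in \<open>A\<close>, and a pro-algebra with indices in \<open>nat \<Rightarrow> 'a\<close> represents a functor, and has a free formal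
  group, of cardinality at most that of \<open>nat \<Rightarrow> 'a\<close>.
\<close>

type_synonym ('k, 'a) pro_alg = "(nat \<Rightarrow> 'a, ('k, 'a) module, 'a \<Rightarrow> 'a) pro_obj"

type_synonym ('k, 'a) pro_alg_mor = "(nat \<Rightarrow> 'a) \<Rightarrow> ((nat \<Rightarrow> 'a) \<times> ('a \<Rightarrow> 'a)) set"

type_synonym ('k, 'a) ab_functor =
  "(('k, 'a) module, 'a \<Rightarrow> 'a, (nat \<Rightarrow> 'a) monoid, (nat \<Rightarrow> 'a) \<Rightarrow> (nat \<Rightarrow> 'a)) cat_functor"

type_synonym ('k, 'a) ab_functor_mor = "('k, 'a) module \<Rightarrow> (nat \<Rightarrow> 'a) \<Rightarrow> (nat \<Rightarrow> 'a)"

definition pro_alg_cat :: "'k ring \<Rightarrow> (('k, 'a) pro_alg, ('k, 'a) pro_alg_mor) cat" where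
  "pro_alg_cat K = pro_cat (alg_cat K)"

text \<open>\<open>\<rho>\<close> is an isomorphism of set-valued functors from \<open>colim Hom(P\<^sub>i, -)\<close> to \<open>G\<close>.\<close>

definition represents ::
  "'k ring \<Rightarrow> ('k, 'a) ab_functor \<Rightarrow> ('k, 'a) pro_alg \<Rightarrow>
     (('k, 'a) module \<Rightarrow> ((nat \<Rightarrow> 'a) \<times> ('a \<Rightarrow> 'a)) set \<Rightarrow> (nat \<Rightarrow> 'a)) \<Rightarrow> bool" where
  "represents K G P \<rho> \<longleftrightarrow> P \<in> Ob (pro_alg_cat K) \<and>
     (\<forall>A\<in>Ob (alg_cat K). bij_betw (\<rho> A) (pro_colim (alg_cat K) P A) (carrier (on_ob G A))) \<and>
     (\<forall>A\<in>Ob (alg_cat K). \<forall>B\<in>Ob (alg_cat K). \<forall>f\<in>Hom (alg_cat K) A B.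
        \<forall>c\<in>pro_colim (alg_cat K) P A.
          \<rho> B (pro_push (alg_cat K) P A B f c) = on_mor G A B f (\<rho> A c))"

definition ind_representable :: "'k ring \<Rightarrow> ('k, 'a) ab_functor \<Rightarrow> bool" where
  "ind_representable K G \<longleftrightarrow> (\<exists>P \<rho>. represents K G P \<rho>)"

definition fgps :: "'k ring \<Rightarrow> (('k, 'a) ab_functor, ('k, 'a) ab_functor_mor) cat" where
  "fgps K = full_subcat (functor_cat (alg_cat K) ab_cat) (ind_representable K)"

text \<open>
  The representing pro-algebra is unique up to unique isomorphism compatible with \<open>\<rho>\<close>; we choose one.
\<close>

definition fg_choice ::
  "'k ring \<Rightarrow> ('k, 'a) ab_functor \<Rightarrow> ('k, 'a) pro_alg \<times>
     (('k, 'a) module \<Rightarrow> ((nat \<Rightarrow> 'a) \<times> ('a \<Rightarrow> 'a)) set \<Rightarrow> (nat \<Rightarrow> 'a))" where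
  "fg_choice K G = (SOME P\<rho>. represents K G (fst P\<rho>) (snd P\<rho>))"

definition fg_pro :: "'k ring \<Rightarrow> ('k, 'a) ab_functor \<Rightarrow> ('k, 'a) pro_alg" where
  "fg_pro K G = fst (fg_choice K G)"

definition fg_iso ::
  "'k ring \<Rightarrow> ('k, 'a) ab_functor \<Rightarrow>
     ('k, 'a) module \<Rightarrow> ((nat \<Rightarrow> 'a) \<times> ('a \<Rightarrow> 'a)) set \<Rightarrow> (nat \<Rightarrow> 'a)" where
  "fg_iso K G = snd (fg_choice K G)"

text \<open>
  The forgetful functor from \<open>fgps K\<close> to the opposite of \<open>pro_alg_cat K\<close>.  With \<open>P\<close>, \<open>Q\<close>
  representing \<open>G\<close>, \<open>H\<close>, a morphism \<open>\<tau> : G \<rightarrow> H\<close> gives the morphism \<open>Q \<rightarrow> P\<close> whose component in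
  \<open>colim Hom(Q\<^sub>i, P\<^sub>j) \<cong> H(P\<^sub>j)\<close> is the image under \<open>\<tau>\<close> of the element of \<open>G(P\<^sub>j)\<close> given by the
  identity of \<open>P\<^sub>j\<close> (Yoneda).
\<close>

definition fg_forget ::
  "'k ring \<Rightarrow> (('k, 'a) ab_functor, ('k, 'a) ab_functor_mor,
                ('k, 'a) pro_alg, ('k, 'a) pro_alg_mor) cat_functor" where
  "fg_forget K =
     \<lparr>on_ob = fg_pro K,
      on_mor = (\<lambda>G H \<tau>. \<lambda>j\<in>Ob (index (fg_pro K G)).
        let A = on_ob (diag (fg_pro K G)) j
        in inv_into (pro_colim (alg_cat K) (fg_pro K H) A) (fg_iso K H A)
             (\<tau> A (fg_iso K G A (germ (alg_cat K) (fg_pro K G) A j (Id (alg_cat K) A)))))\<rparr>"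

definition is_free_fg_functor ::
  "'k ring \<Rightarrow> (('k, 'a) pro_alg, ('k, 'a) pro_alg_mor,
                ('k, 'a) ab_functor, ('k, 'a) ab_functor_mor) cat_functor \<Rightarrow> bool" where
  "is_free_fg_functor K Fr \<longleftrightarrow> left_adjoint (op_cat (pro_alg_cat K)) (fgps K) Fr (fg_forget K)"


section \<open>Witt vectors\<close>

text \<open>Integer polynomials in the variables \<open>X\<^sub>i\<close> (\<open>Inl i\<close>) and \<open>Y\<^sub>i\<close> (\<open>Inr i\<close>).\<close>

type_synonym xy_poly = "((nat + nat) \<Rightarrow>\<^sub>0 nat) \<Rightarrow>\<^sub>0 int"

definition xy_var :: "nat + nat \<Rightarrow> xy_poly" where
  "xy_var v = Poly_Mapping.single (Poly_Mapping.single v 1) 1"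

definition xy_eval :: "('a, 'b) ring_scheme \<Rightarrow> (nat \<Rightarrow> 'a) \<Rightarrow> (nat \<Rightarrow> 'a) \<Rightarrow> xy_poly \<Rightarrow> 'a" where
  "xy_eval R x y P = (\<Oplus>\<^bsub>R\<^esub>m\<in>Poly_Mapping.keys P. [Poly_Mapping.lookup P m] \<cdot>\<^bsub>R\<^esub>
     (\<Otimes>\<^bsub>R\<^esub>v\<in>Poly_Mapping.keys m. case_sum x y v [^]\<^bsub>R\<^esub> Poly_Mapping.lookup m v))"

definition ghost :: "nat \<Rightarrow> (nat \<Rightarrow> 'r::comm_semiring_1) \<Rightarrow> nat \<Rightarrow> 'r" where
  "ghost p x n = (\<Sum>i\<le>n. of_nat p ^ i * x i ^ (p ^ (n - i)))"

text \<open>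
  By Witt's theorem there are unique integer polynomials with these ghost components, for all \<open>n\<close>.
\<close>

definition witt_add_poly :: "nat \<Rightarrow> nat \<Rightarrow> xy_poly" where
  "witt_add_poly p = (THE S. \<forall>n. ghost p S n =
     ghost p (\<lambda>i. xy_var (Inl i)) n + ghost p (\<lambda>i. xy_var (Inr i)) n)"

definition witt_mult_poly :: "nat \<Rightarrow> nat \<Rightarrow> xy_poly" where
  "witt_mult_poly p = (THE M. \<forall>n. ghost p M n =
     ghost p (\<lambda>i. xy_var (Inl i)) n * ghost p (\<lambda>i. xy_var (Inr i)) n)"

definition witt :: "nat \<Rightarrow> 'k ring \<Rightarrow> (nat \<Rightarrow> 'k) ring" where
  "witt p K =
     \<lparr>carrier = {x. \<forall>n. x n \<in> carrier K},
      mult = (\<lambda>x y n. xy_eval K x y (witt_mult_poly p n)),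
      one = (\<lambda>n. if n = 0 then \<one>\<^bsub>K\<^esub> else \<zero>\<^bsub>K\<^esub>),
      zero = (\<lambda>n. \<zero>\<^bsub>K\<^esub>),
      add = (\<lambda>x y n. xy_eval K x y (witt_add_poly p n))\<rparr>"

text \<open>In characteristic \<open>p\<close> the Witt vector Frobenius raises every component to the \<open>p\<close>-th power.\<close>

definition witt_frob :: "nat \<Rightarrow> 'k ring \<Rightarrow> (nat \<Rightarrow> 'k) \<Rightarrow> (nat \<Rightarrow> 'k)" where
  "witt_frob p K x = (\<lambda>n. x n [^]\<^bsub>K\<^esub> p)"


section \<open>Dieudonne modules\<close>

text \<open>The fields \<open>mult\<close> and \<open>one\<close> inherited from the type of modules are irrelevant.\<close>

record ('w, 'm) dieudonne = "('w, 'm) module" +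
  Fop :: "'m \<Rightarrow> 'm"
  Vop :: "'m \<Rightarrow> 'm"

definition dieudonne_module :: "nat \<Rightarrow> 'k ring \<Rightarrow> (nat \<Rightarrow> 'k, 'm) dieudonne \<Rightarrow> bool" where
  "dieudonne_module p K M \<longleftrightarrow> module (witt p K) M \<and>
     Fop M \<in> hom (add_monoid M) (add_monoid M) \<and>
     Vop M \<in> hom (add_monoid M) (add_monoid M) \<and>
     (\<forall>x\<in>carrier M. Fop M (Vop M x) = [p] \<cdot>\<^bsub>M\<^esub> x \<and> Vop M (Fop M x) = [p] \<cdot>\<^bsub>M\<^esub> x) \<and>
     (\<forall>a\<in>carrier (witt p K). \<forall>x\<in>carrier M.
        Fop M (a \<odot>\<^bsub>M\<^esub> x) = witt_frob p K a \<odot>\<^bsub>M\<^esub> Fop M x \<and>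
        a \<odot>\<^bsub>M\<^esub> Vop M x = Vop M (witt_frob p K a \<odot>\<^bsub>M\<^esub> x))"

definition dieudonne_iso ::
  "nat \<Rightarrow> 'k ring \<Rightarrow> (nat \<Rightarrow> 'k, 'm) dieudonne \<Rightarrow> (nat \<Rightarrow> 'k, 'n) dieudonne \<Rightarrow> ('m \<Rightarrow> 'n) set" where
  "dieudonne_iso p K M N =
     {h. dieudonne_module p K M \<and> dieudonne_module p K N \<and>
         bij_betw h (carrier M) (carrier N) \<and>
         (\<forall>x\<in>carrier M. \<forall>y\<in>carrier M. h (x \<oplus>\<^bsub>M\<^esub> y) = h x \<oplus>\<^bsub>N\<^esub> h y) \<and>
         (\<forall>a\<in>carrier (witt p K). \<forall>x\<in>carrier M. h (a \<odot>\<^bsub>M\<^esub> x) = a \<odot>\<^bsub>N\<^esub> h x) \<and>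
         (\<forall>x\<in>carrier M. h (Fop M x) = Fop N (h x) \<and> h (Vop M x) = Vop N (h x))}"


section \<open>Witt covectors\<close>

primrec ideal_pow :: "('a, 'b) ring_scheme \<Rightarrow> 'a set \<Rightarrow> nat \<Rightarrow> 'a set" where
  "ideal_pow R I 0 = carrier R"
| "ideal_pow R I (Suc n) = ideal_prod R I (ideal_pow R I n)"

definition eventual_value :: "(nat \<Rightarrow> 'a) \<Rightarrow> 'a" where
  "eventual_value f = (THE c. \<forall>\<^sub>F m in sequentially. f m = c)"

definition field_root :: "'k ring \<Rightarrow> nat \<Rightarrow> 'k \<Rightarrow> 'k" where
  "field_root K q c = (THE d. d \<in> carrier K \<and> d [^]\<^bsub>K\<^esub> q = c)"

text \<open>
  A covector \<open>(\<dots>, a\<^sub>-\<^sub>1, a\<^sub>0)\<close> is the function sending \<open>n\<close> to \<open>a\<^sub>-\<^sub>n\<close>, and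
  \<open>cw_window a n m\<close> is \<open>(a\<^sub>-\<^sub>n\<^sub>-\<^sub>m, \<dots>, a\<^sub>-\<^sub>n)\<close>, indexed by \<open>0, \<dots>, m\<close>.

  Fontaine's action: the vector \<open>x\<close> acts on windows of length \<open>m + 1\<close> ending in position \<open>-n\<close>, seen
  as truncated Witt vectors, by Witt multiplication with \<open>frob\<^sup>-\<^sup>(\<^sup>n\<^sup>+\<^sup>m\<^sup>) x\<close>.  A Teichmueller
  representative \<open>[c]\<close> multiplies the last entry of such a window by
  \<open>(c\<^bsup>1/p^(n+m)\<^esup>)\<^bsup>p^m\<^esup> = c\<^bsup>1/p^n\<^esup>\<close>.
\<close>

definition cw_window :: "(nat \<Rightarrow> 'a) \<Rightarrow> nat \<Rightarrow> nat \<Rightarrow> nat \<Rightarrow> 'a" where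
  "cw_window a n m i = a (n + m - i)"

definition CW :: "nat \<Rightarrow> 'k ring \<Rightarrow> ('k, 'a) module \<Rightarrow> (nat \<Rightarrow> 'k, nat \<Rightarrow> 'a) dieudonne" where
  "CW p K A =
     \<lparr>carrier = {a. (\<forall>n. a n \<in> carrier A) \<and>
        (\<exists>r s. ideal_pow A (genideal A (a ` {r..})) s = {\<zero>\<^bsub>A\<^esub>})},
      mult = undefined,
      one = undefined,
      zero = (\<lambda>n. \<zero>\<^bsub>A\<^esub>),
      add = (\<lambda>a b n. eventual_value (\<lambda>m.
        xy_eval A (cw_window a n m) (cw_window b n m) (witt_add_poly p m))),
      smult = (\<lambda>x a n. eventual_value (\<lambda>m.
        xy_eval A (\<lambda>i. field_root K (p ^ (n + m)) (x i) \<odot>\<^bsub>A\<^esub> \<one>\<^bsub>A\<^esub>) (cw_window a n m)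
          (witt_mult_poly p m))),
      Fop = (\<lambda>a n. a n [^]\<^bsub>A\<^esub> p),
      Vop = (\<lambda>a n. a (Suc n))\<rparr>"

definition CW_map ::
  "nat \<Rightarrow> 'k ring \<Rightarrow> ('k, 'a) module \<Rightarrow> ('k, 'a) module \<Rightarrow> ('a \<Rightarrow> 'a) \<Rightarrow> (nat \<Rightarrow> 'a) \<Rightarrow> (nat \<Rightarrow> 'a)" where
  "CW_map p K A B f = (\<lambda>a\<in>carrier (CW p K A). f \<circ> a)"

definition CW_functor :: "nat \<Rightarrow> 'k ring \<Rightarrow> ('k, 'a) ab_functor" where
  "CW_functor p K =
     \<lparr>on_ob = (\<lambda>A. \<lparr>carrier = carrier (CW p K A), mult = add (CW p K A), one = zero (CW p K A)\<rparr>),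
      on_mor = CW_map p K\<rparr>"

definition D_f ::
  "nat \<Rightarrow> 'k ring \<Rightarrow> ('k, 'a) ab_functor \<Rightarrow> (nat \<Rightarrow> 'k, ('k, 'a) ab_functor_mor) dieudonne" where
  "D_f p K G =
     \<lparr>carrier = Hom (fgps K) G (CW_functor p K),
      mult = undefined,
      one = undefined,
      zero = (\<lambda>A\<in>Ob (alg_cat K). \<lambda>g\<in>carrier (on_ob G A). \<zero>\<^bsub>CW p K A\<^esub>),
      add = (\<lambda>\<sigma> \<tau>. \<lambda>A\<in>Ob (alg_cat K). \<lambda>g\<in>carrier (on_ob G A). \<sigma> A g \<oplus>\<^bsub>CW p K A\<^esub> \<tau> A g),
      smult = (\<lambda>x \<tau>. \<lambda>A\<in>Ob (alg_cat K). \<lambda>g\<in>carrier (on_ob G A). x \<odot>\<^bsub>CW p K A\<^esub> \<tau> A g),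
      Fop = (\<lambda>\<tau>. \<lambda>A\<in>Ob (alg_cat K). \<lambda>g\<in>carrier (on_ob G A). Fop (CW p K A) (\<tau> A g)),
      Vop = (\<lambda>\<tau>. \<lambda>A\<in>Ob (alg_cat K). \<lambda>g\<in>carrier (on_ob G A). Vop (CW p K A) (\<tau> A g))\<rparr>"

text \<open>\<open>Fr\<close> is contravariant in pro-algebras:
  \<open>f : R \<rightarrow> R'\<close> induces \<open>Fr(R') \<rightarrow> Fr(R)\<close> and, by precomposition, \<open>D_f(Fr(R)) \<rightarrow> D_f(Fr(R'))\<close>.\<close>

definition free_fg ::
  "'k ring \<Rightarrow> (('k, 'a) pro_alg, ('k, 'a) pro_alg_mor,
                ('k, 'a) ab_functor, ('k, 'a) ab_functor_mor) cat_functor \<Rightarrow>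
     ('k, 'a) module \<Rightarrow> ('k, 'a) ab_functor" where
  "free_fg K Fr R = on_ob Fr (pro_const (alg_cat K) R)"

definition free_fg_map ::
  "'k ring \<Rightarrow> (('k, 'a) pro_alg, ('k, 'a) pro_alg_mor,
                ('k, 'a) ab_functor, ('k, 'a) ab_functor_mor) cat_functor \<Rightarrow>
     ('k, 'a) module \<Rightarrow> ('k, 'a) module \<Rightarrow> ('a \<Rightarrow> 'a) \<Rightarrow> ('k, 'a) ab_functor_mor" where
  "free_fg_map K Fr R R' f =
     on_mor Fr (pro_const (alg_cat K) R') (pro_const (alg_cat K) R) (pro_const_mor (alg_cat K) R R' f)"

definition D_f_map ::
  "nat \<Rightarrow> 'k ring \<Rightarrow> ('k, 'a) ab_functor \<Rightarrow> ('k, 'a) ab_functor \<Rightarrow> ('k, 'a) ab_functor_mor \<Rightarrow>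
     ('k, 'a) ab_functor_mor \<Rightarrow> ('k, 'a) ab_functor_mor" where
  "D_f_map p K G H \<sigma> \<tau> = Comp (fgps K) G H (CW_functor p K) \<tau> \<sigma>"

end

theory Submission
  imports Defs "HOL-Algebra.QuotRing"
begin

text \<open>
  Write \<open>u\<^sub>R\<close> for the point of \<open>Fr(R)(R)\<close> that the adjunction assigns to the identity of \<open>Fr(R)\<close>.
  Naturality of the adjunction gives \<open>Hom(Fr(R), G) \<cong> G(R)\<close>, \<open>\<tau> \<mapsto> \<tau>\<^sub>R(u\<^sub>R)\<close>, for every formal group
  \<open>G\<close>.  For \<open>G = CW\<close> this map respects addition, scalars, \<open>F\<close> and \<open>V\<close>, because all of these are
  defined pointwise on \<open>Hom(Fr(R), CW)\<close>.  What remains is Fontaine's theorem that \<open>CW\<close> is a functor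
  to Dieudonne modules and that it is ind-representable.

  A monomial in \<open>S\<^sub>m\<close> that involves an early variable has high degree in the early variables, by
  homogeneity, and vanishes when these are nilpotent.  Hence the first entries of a long window do not
  influence the last entries of a sum or product of windows, a covector may be replaced by the
  Witt vectors given by its windows, and the identities in \<open>CW(A)\<close> follow from those in \<open>W(A)\<close>.
  For ind-representability, the pairs \<open>(A, a)\<close> with \<open>A\<close> generated by the entries of \<open>a \<in> CW(A)\<close> form,
  up to isomorphism, a small cofiltered preorder, and the algebras \<open>A\<close> represent \<open>CW\<close>.
\<close>

(* ambiguous with the notation for integer multiples in a ring *)
no_notation ideal_prod (infixl "\<cdot>\<index>" 80)

section \<open>Evaluation of integer polynomials\<close>

text \<open>Ghost vectors decide identities only where \<open>p\<close> is not a zero divisor, while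
  \<open>A\<close> has characteristic \<open>p\<close>; hence the detour through polynomial rings
  whose variables are the elements of \<open>A\<close>. Relations special to characteristic
  \<open>p\<close>, such as \<open>V F = p\<close>, come from congruences modulo \<open>p\<close> of
  integer polynomials.

  Sums of covectors are limits, so associativity is awkward entry by entry. A sum of windows is not
  the window of the sum: its first entries are wrong, though still nilpotent. Families of Witt
  vectors that may be wrong in a bounded number of first entries are closed under all operations and
  determine the covector; they replace the limits.

  Early variables occur in high degree because a monomial of \<open>S_m\<close> has weight
  \<open>p ^ m\<close> if index \<open>l\<close> weighs \<open>p ^ l\<close>: low digits reach
  \<open>p ^ m\<close> only through carries, and every carry costs further factors.

  Size shapes the representability proof. Indices must have type
  \<open>nat \<Rightarrow> 'a\<close>, which need not have room for all pairs \<open>(A, a)\<close>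
  on \<open>'a\<close>; a pair is therefore coded by structure constants and coordinates in a basis,
  which fix it up to isomorphism.\<close>

type_synonym 'v ipoly = "('v \<Rightarrow>\<^sub>0 nat) \<Rightarrow>\<^sub>0 int"

definition ivar :: "'v \<Rightarrow> 'v ipoly" where
  "ivar v = Poly_Mapping.single (Poly_Mapping.single v 1) 1"

lemma ipoly_sum:
  "(P :: 'v ipoly) = (\<Sum>m\<in>Poly_Mapping.keys P. Poly_Mapping.single m (Poly_Mapping.lookup P m))"
proof (rule poly_mapping_eqI)
  fix k
  have "(\<Sum>m\<in>Poly_Mapping.keys P. Poly_Mapping.lookup (Poly_Mapping.single m (Poly_Mapping.lookup P m)) k)
      = (\<Sum>m\<in>Poly_Mapping.keys P. if m = k then Poly_Mapping.lookup P m else 0)"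
    by (intro sum.cong) (auto simp: lookup_single when_def)
  also have "\<dots> = Poly_Mapping.lookup P k"
    by (simp add: sum.delta in_keys_iff)
  finally show "Poly_Mapping.lookup P k = Poly_Mapping.lookup
      (\<Sum>m\<in>Poly_Mapping.keys P. Poly_Mapping.single m (Poly_Mapping.lookup P m)) k"
    by (simp add: lookup_sum)
qed

lemma ipoly_add_induct [case_names zero single add]:
  fixes P :: "'v ipoly"
  assumes "Q 0" "\<And>m c. Q (Poly_Mapping.single m c)" "\<And>a b. Q a \<Longrightarrow> Q b \<Longrightarrow> Q (a + b)"
  shows "Q P"
proof -
  have "Q (\<Sum>m\<in>A. Poly_Mapping.single m (Poly_Mapping.lookup P m))" if "finite A" for A
    using that by induction (auto intro: assms)
  from this[of "Poly_Mapping.keys P"] show ?thesis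
    by (subst ipoly_sum) simp
qed

lemma monom_induct [case_names zero single]:
  fixes m :: "'v \<Rightarrow>\<^sub>0 nat"
  assumes "Q 0" and "\<And>v m. Q m \<Longrightarrow> Q (Poly_Mapping.single v 1 + m)"
  shows "Q m"
proof (induction m rule: update_induct)
  case const
  show ?case using assms(1) by simp
next
  case (update f v c)
  have eq: "Poly_Mapping.update v c f = Poly_Mapping.single v c + f"
    using update.hyps by (intro poly_mapping_eqI)
      (auto simp: lookup_update lookup_add lookup_single when_def in_keys_iff)
  have "Q (Poly_Mapping.single v c + f)" for c
  proof (induction c)
    case 0
    show ?case using update by simp
  next
    case (Suc c)
    have "Poly_Mapping.single v (Suc c) + f = Poly_Mapping.single v 1 + (Poly_Mapping.single v c + f)"
      by (metis add.assoc single_add plus_1_eq_Suc)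
    then show ?case using assms(2) Suc by simp
  qed
  then show ?case by (simp add: eq)
qed

text \<open>Closure under differences, rather than sums, yields negatives and all integer constants
  as well. A statement that defines a subring thus needs checking only on the variables.\<close>

lemma ipoly_ring_induct [case_names var one diff mult]:
  fixes P :: "'v ipoly"
  assumes var: "\<And>v. Q (ivar v)" and one: "Q 1"
    and diff: "\<And>a b. Q a \<Longrightarrow> Q b \<Longrightarrow> Q (a - b)"
    and mult: "\<And>a b. Q a \<Longrightarrow> Q b \<Longrightarrow> Q (a * b)"
  shows "Q P"
proof -
  have zero: "Q 0" using diff[OF one one] by simp
  have add: "Q (a + b)" if "Q a" "Q b" for a b
    using diff[OF that(1) diff[OF zero that(2)]] by simp
  have int: "Q (of_int c)" for c
  proof (induction c rule: int_induct[of _ 0])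
    case base
    then show ?case by (simp add: zero)
  next
    case (step1 i)
    then show ?case using add one by simp
  next
    case (step2 i)
    then show ?case using diff one by simp
  qed
  have mon: "Q (Poly_Mapping.single m 1)" for m :: "'v \<Rightarrow>\<^sub>0 nat"
  proof (induction m rule: monom_induct)
    case zero
    then show ?case using one by simp
  next
    case (single v m)
    have "Poly_Mapping.single (Poly_Mapping.single v 1 + m) 1 = ivar v * Poly_Mapping.single m (1::int)"
      by (simp add: ivar_def mult_single)
    then show ?case using mult[OF var single] by simp
  qed
  show ?thesis
  proof (induction P rule: ipoly_add_induct)
    case (single m c)
    have "Poly_Mapping.single m c = of_int c * Poly_Mapping.single m 1"
      by (subst single_of_int[symmetric]) (simp add: mult_single)
    then show ?case using mult int mon by metis
  qed (auto intro: zero add)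
qed

section \<open>Evaluation of polynomials in a commutative ring\<close>

definition pmon :: "('a, 'b) ring_scheme \<Rightarrow> ('v \<Rightarrow> 'a) \<Rightarrow> ('v \<Rightarrow>\<^sub>0 nat) \<Rightarrow> 'a" where
  "pmon R f m = (\<Otimes>\<^bsub>R\<^esub>v\<in>Poly_Mapping.keys m. f v [^]\<^bsub>R\<^esub> Poly_Mapping.lookup m v)"

text \<open>Any type of variables is allowed, because the variables will also be the elements of a
  ring (\<open>proj\<close>); \<open>xy_eval\<close> is the case \<open>nat + nat\<close>.\<close>

definition peval :: "('a, 'b) ring_scheme \<Rightarrow> ('v \<Rightarrow> 'a) \<Rightarrow> 'v ipoly \<Rightarrow> 'a" where
  "peval R f P = (\<Oplus>\<^bsub>R\<^esub>m\<in>Poly_Mapping.keys P. [Poly_Mapping.lookup P m] \<cdot>\<^bsub>R\<^esub> pmon R f m)"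

lemma xy_eval_peval: "xy_eval R x y P = peval R (case_sum x y) P"
  by (simp add: xy_eval_def peval_def pmon_def)

context cring
begin

lemma pmon_closed [simp, intro]: "(\<And>v. f v \<in> carrier R) \<Longrightarrow> pmon R f m \<in> carrier R"
  unfolding pmon_def by (intro finprod_closed) auto

lemma pmon_superset:
  assumes f: "\<And>v. f v \<in> carrier R" and "finite S" "Poly_Mapping.keys m \<subseteq> S"
  shows "pmon R f m = (\<Otimes>v\<in>S. f v [^] Poly_Mapping.lookup m v)"
  unfolding pmon_def
  by (intro finprod_mono_neutral_cong_left) (use assms in \<open>auto simp: in_keys_iff\<close>)

lemma pmon_add:
  assumes f: "\<And>v. f v \<in> carrier R"
  shows "pmon R f (m + n) = pmon R f m \<otimes> pmon R f n"
proof -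
  let ?S = "Poly_Mapping.keys m \<union> Poly_Mapping.keys n"
  have "pmon R f (m + n) = (\<Otimes>v\<in>?S. f v [^] Poly_Mapping.lookup (m + n) v)"
    by (intro pmon_superset f keys_add) auto
  also have "\<dots> = (\<Otimes>v\<in>?S. f v [^] Poly_Mapping.lookup m v \<otimes> f v [^] Poly_Mapping.lookup n v)"
    by (intro finprod_cong') (auto simp: lookup_add nat_pow_mult f)
  also have "\<dots> = (\<Otimes>v\<in>?S. f v [^] Poly_Mapping.lookup m v) \<otimes> (\<Otimes>v\<in>?S. f v [^] Poly_Mapping.lookup n v)"
    by (intro finprod_multf) (auto simp: f)
  also have "(\<Otimes>v\<in>?S. f v [^] Poly_Mapping.lookup m v) = pmon R f m"
    by (intro pmon_superset[symmetric] f) auto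
  also have "(\<Otimes>v\<in>?S. f v [^] Poly_Mapping.lookup n v) = pmon R f n"
    by (intro pmon_superset[symmetric] f) auto
  finally show ?thesis .
qed

lemma pmon_zero [simp]: "pmon R f 0 = \<one>"
  by (simp add: pmon_def)

lemma pmon_single [simp]: "f v \<in> carrier R \<Longrightarrow> pmon R f (Poly_Mapping.single v 1) = f v"
  by (simp add: pmon_def)

lemma peval_closed [simp, intro]: "(\<And>v. f v \<in> carrier R) \<Longrightarrow> peval R f P \<in> carrier R"
  unfolding peval_def by (intro finsum_closed) auto

lemma add_pow_int_zero [simp]: "[(0::int)] \<cdot> x = \<zero>"
  by (simp add: add_pow_def int_pow_def)

lemma add_pow_int_one [simp]: "x \<in> carrier R \<Longrightarrow> [(1::int)] \<cdot> x = x"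
  by (simp add: add_pow_def int_pow_def)

lemma peval_superset:
  assumes f: "\<And>v. f v \<in> carrier R" and "finite S" "Poly_Mapping.keys P \<subseteq> S"
  shows "peval R f P = (\<Oplus>m\<in>S. [Poly_Mapping.lookup P m] \<cdot> pmon R f m)"
  unfolding peval_def
  by (intro add.finprod_mono_neutral_cong_left) (use assms in \<open>auto simp: in_keys_iff\<close>)

lemma peval_add:
  assumes f: "\<And>v. f v \<in> carrier R"
  shows "peval R f (P + Q) = peval R f P \<oplus> peval R f Q"
proof -
  let ?S = "Poly_Mapping.keys P \<union> Poly_Mapping.keys Q"
  have "peval R f (P + Q) = (\<Oplus>m\<in>?S. [Poly_Mapping.lookup (P + Q) m] \<cdot> pmon R f m)"
    by (intro peval_superset f keys_add) auto
  also have "\<dots> = (\<Oplus>m\<in>?S. [Poly_Mapping.lookup P m] \<cdot> pmon R f m \<oplus> [Poly_Mapping.lookup Q m] \<cdot> pmon R f m)"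
    by (intro finsum_cong') (auto simp: lookup_add add.int_pow_mult f)
  also have "\<dots> = (\<Oplus>m\<in>?S. [Poly_Mapping.lookup P m] \<cdot> pmon R f m) \<oplus> (\<Oplus>m\<in>?S. [Poly_Mapping.lookup Q m] \<cdot> pmon R f m)"
    by (intro finsum_addf) (auto simp: f)
  also have "(\<Oplus>m\<in>?S. [Poly_Mapping.lookup P m] \<cdot> pmon R f m) = peval R f P"
    by (intro peval_superset[symmetric] f) auto
  also have "(\<Oplus>m\<in>?S. [Poly_Mapping.lookup Q m] \<cdot> pmon R f m) = peval R f Q"
    by (intro peval_superset[symmetric] f) auto
  finally show ?thesis .
qed

lemma peval_zero [simp]: "peval R f 0 = \<zero>"
  by (simp add: peval_def)

lemma peval_single:
  assumes f: "\<And>v. f v \<in> carrier R"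
  shows "peval R f (Poly_Mapping.single m c) = [c] \<cdot> pmon R f m"
proof -
  have "peval R f (Poly_Mapping.single m c)
      = (\<Oplus>n\<in>{m}. [Poly_Mapping.lookup (Poly_Mapping.single m c) n] \<cdot> pmon R f n)"
    by (intro peval_superset f) auto
  then show ?thesis by (simp add: f)
qed

lemma peval_mult:
  assumes f: "\<And>v. f v \<in> carrier R"
  shows "peval R f (P * Q) = peval R f P \<otimes> peval R f Q"
proof (induction P rule: ipoly_add_induct)
  case zero
  show ?case by (simp add: f)
next
  case (single m c)
  show ?case
  proof (induction Q rule: ipoly_add_induct)
    case zero
    show ?case by (simp add: f)
  next
    case (single n d)
    let ?m = "pmon R f m" and ?n = "pmon R f n"
    have "add_pow R c ?m \<otimes> add_pow R d ?n = add_pow R c (?m \<otimes> add_pow R d ?n)"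
      by (intro add_pow_ldistr_int) (auto simp: f)
    also have "?m \<otimes> add_pow R d ?n = add_pow R d (?m \<otimes> ?n)"
      by (intro add_pow_rdistr_int) (auto simp: f)
    also have "add_pow R c (add_pow R d (?m \<otimes> ?n)) = add_pow R (d * c) (?m \<otimes> ?n)"
      by (intro add.int_pow_pow) (auto simp: f)
    finally show ?case
      by (simp add: mult_single peval_single f pmon_add mult.commute)
  next
    case (add a b)
    then show ?case by (simp add: distrib_left peval_add f r_distr)
  qed
next
  case (add a b)
  then show ?case by (simp add: distrib_right peval_add f l_distr)
qed

lemma peval_one [simp]: "peval R f 1 = \<one>"
  by (simp add: peval_def)

lemma peval_ivar [simp]:
  assumes f: "\<And>v. f v \<in> carrier R"
  shows "peval R f (ivar v) = f v"
  unfolding ivar_def by (subst peval_single) (simp_all add: f flip: One_nat_def)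

end

text \<open>Turns a type-class ring into a record, so that \<open>peval\<close> and Witt vectors can
  be formed over polynomial rings.\<close>

definition cls :: "'r::comm_ring_1 ring" where
  "cls = \<lparr>carrier = UNIV, mult = (*), one = 1, zero = 0, add = (+)\<rparr>"

lemma cls_simps [simp]:
  "carrier cls = UNIV" "x \<otimes>\<^bsub>cls\<^esub> y = x * y" "\<one>\<^bsub>cls\<^esub> = 1" "\<zero>\<^bsub>cls\<^esub> = 0" "x \<oplus>\<^bsub>cls\<^esub> y = x + y"
  by (simp_all add: cls_def)

lemma cring_cls [simp, intro]: "cring (cls :: 'a::comm_ring_1 ring)"
proof (rule cringI)
  show "abelian_group (cls :: 'a ring)"
  proof (rule abelian_groupI)
    fix x :: 'a assume "x \<in> carrier cls"
    show "\<exists>y\<in>carrier cls. y \<oplus>\<^bsub>cls\<^esub> x = \<zero>\<^bsub>cls\<^esub>"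
      by (intro bexI[of _ "- x"]) auto
  qed (auto simp: algebra_simps)
  show "comm_monoid (cls :: 'a ring)"
    by (rule comm_monoidI) (auto simp: algebra_simps)
qed (auto simp: algebra_simps)

interpretation cls: cring cls by (rule cring_cls)

lemmas cls_peval_simps [simp] =
  cls.peval_add[simplified] cls.peval_mult[simplified] cls.peval_one[simplified]
  cls.peval_zero[simplified] cls.peval_ivar[simplified]

lemma hom_peval:
  assumes "cring R" "cring S" "h \<in> ring_hom R S" and f: "\<And>v. f v \<in> carrier R"
  shows "h (peval R f P) = peval S (\<lambda>v. h (f v)) P"
proof -
  interpret R: cring R by fact
  interpret S: cring S by fact
  interpret h: ring_hom_cring R S h
    using assms by unfold_locales auto
  have hf: "h (f v) \<in> carrier S" for v using f by simp
  show ?thesis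
  proof (induction P rule: ipoly_ring_induct)
    case (var v)
    then show ?case by (simp add: f hf)
  next
    case one
    show ?case by simp
  next
    case (diff a b)
    \<comment> \<open>Evaluation is so far known to respect sums but not differences, so
      \<open>b\<close> is added back and cancelled.\<close>
    have "h (peval R f (a - b)) \<oplus>\<^bsub>S\<^esub> peval S (\<lambda>v. h (f v)) b = h (peval R f (a - b) \<oplus>\<^bsub>R\<^esub> peval R f b)"
      by (simp add: f diff)
    also have "\<dots> = peval S (\<lambda>v. h (f v)) (a - b) \<oplus>\<^bsub>S\<^esub> peval S (\<lambda>v. h (f v)) b"
      using diff by (simp flip: R.peval_add[OF f] S.peval_add[of "\<lambda>v. h (f v)", OF hf])
    finally show ?case
      by (subst (asm) S.add.right_cancel) (auto simp: f hf)
  next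
    case (mult a b)
    then show ?case by (simp add: f hf R.peval_mult S.peval_mult)
  qed
qed

lemma (in cring) peval_ring_hom: "(\<And>v. f v \<in> carrier R) \<Longrightarrow> peval R f \<in> ring_hom cls R"
  by (auto simp: ring_hom_def peval_add peval_mult)

section \<open>Witt polynomials\<close>

lemma prime_dvd_power_add:
  fixes a b :: "'r::comm_ring_1"
  assumes "prime p"
  shows "of_nat p dvd (a + b) ^ p - (a ^ p + b ^ p)"
proof -
  have p: "p > 0" using assms prime_gt_0_nat by blast
  have "(a + b) ^ p = (\<Sum>k\<le>p. of_nat (p choose k) * a ^ k * b ^ (p - k))"
    by (rule binomial_ring)
  also have "{..p} = insert 0 (insert p {0<..<p})" using p by auto
  also have "(\<Sum>k\<in>insert 0 (insert p {0<..<p}). of_nat (p choose k) * a ^ k * b ^ (p - k)) =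
      b ^ p + (a ^ p + (\<Sum>k\<in>{0<..<p}. of_nat (p choose k) * a ^ k * b ^ (p - k)))"
    using p by simp
  finally have "(a + b) ^ p - (a ^ p + b ^ p) =
      (\<Sum>k\<in>{0<..<p}. of_nat (p choose k) * a ^ k * b ^ (p - k))" by simp
  moreover have "of_nat p dvd (\<Sum>k\<in>{0<..<p}. of_nat (p choose k) * a ^ k * b ^ (p - k))"
  proof (rule dvd_sum)
    fix k assume "k \<in> {0<..<p}"
    then have "p dvd (p choose k)" by (intro dvd_choose_prime assms) auto
    then obtain c where "p choose k = p * c" by (auto elim: dvdE)
    then show "of_nat p dvd of_nat (p choose k) * a ^ k * b ^ (p - k)" by simp
  qed
  ultimately show ?thesis by simp
qed

text \<open>In \<open>x ^ p - y ^ p = (x - y) * S\<close> every term of \<open>S\<close> is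
  congruent to \<open>y ^ (p - 1)\<close> modulo \<open>p\<close>. There are \<open>p\<close> terms,
  so \<open>S\<close> supplies the extra factor \<open>p\<close>.\<close>

lemma dvd_power_prime_step:
  fixes x y :: "'r::comm_ring_1"
  assumes "k > 0" "of_nat p ^ k dvd x - y"
  shows "of_nat p ^ Suc k dvd x ^ p - y ^ p"
proof (cases p)
  case (Suc q)
  let ?S = "\<Sum>i<p. y ^ (p - Suc i) * x ^ i"
  have eq: "x ^ p - y ^ p = (x - y) * ?S"
    unfolding Suc by (subst power_diff_sumr2) simp
  have d: "of_nat p dvd x - y"
    by (rule dvd_trans[OF dvd_power]) (use assms in auto)
  have pw: "of_nat p dvd x ^ i - y ^ i" for i
  proof -
    have "x - y dvd x ^ i - y ^ i"
      by (metis dvd_triv_left power_diff_sumr2)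
    then show ?thesis using d dvd_trans by blast
  qed
  have "of_nat p dvd (\<Sum>i<p. y ^ (p - Suc i) * x ^ i - y ^ q)"
  proof (rule dvd_sum)
    fix i assume "i \<in> {..<p}"
    then have "y ^ q = y ^ (p - Suc i) * y ^ i"
      using Suc by (simp flip: power_add)
    then have "y ^ (p - Suc i) * x ^ i - y ^ q = y ^ (p - Suc i) * (x ^ i - y ^ i)"
      by (simp add: right_diff_distrib)
    then show "of_nat p dvd y ^ (p - Suc i) * x ^ i - y ^ q" using pw by simp
  qed
  then have "of_nat p dvd ?S - of_nat p * y ^ q" by (simp add: sum_subtractf)
  from dvd_add[OF this dvd_triv_left[of "of_nat p" "y ^ q"]] have "of_nat p dvd ?S" by simp
  with assms(2) have "of_nat p ^ k * of_nat p dvd (x - y) * ?S" by (rule mult_dvd_mono)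
  then show ?thesis by (simp add: eq mult.commute)
qed (use assms in auto)

lemma dvd_power_prime_power:
  fixes x y :: "'r::comm_ring_1"
  assumes "of_nat p dvd x - y"
  shows "of_nat p ^ Suc k dvd x ^ (p ^ k) - y ^ (p ^ k)"
proof (induction k)
  case 0
  show ?case using assms by simp
next
  case (Suc k)
  then have "of_nat p ^ Suc (Suc k) dvd (x ^ (p ^ k)) ^ p - (y ^ (p ^ k)) ^ p"
    by (intro dvd_power_prime_step) auto
  then show ?case by (simp add: mult.commute flip: power_mult)
qed

section \<open>Absence of torsion, the Frobenius lift and Dwork's criterion\<close>

lemma lookup_of_nat_mult: "Poly_Mapping.lookup (of_nat c * P :: 'v ipoly) m = int c * Poly_Mapping.lookup P m"
proof (induction c)
  case (Suc c)
  then show ?case by (simp add: distrib_right lookup_add)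
qed simp

text \<open>This cancellation is the reason why ghost components determine a Witt vector over
  integer polynomials.\<close>

lemma ipoly_cancel:
  fixes P Q :: "'v ipoly"
  assumes "c > 0" "of_nat c * P = of_nat c * Q"
  shows "P = Q"
proof (rule poly_mapping_eqI)
  fix m
  have "Poly_Mapping.lookup (of_nat c * P) m = Poly_Mapping.lookup (of_nat c * Q) m"
    using assms by simp
  then show "Poly_Mapping.lookup P m = Poly_Mapping.lookup Q m"
    using assms(1) by (simp add: lookup_of_nat_mult)
qed

lemma ipoly_cancel_pow:
  fixes P Q :: "'v ipoly"
  assumes "p > 0" "of_nat p ^ n * P = of_nat p ^ n * Q"
  shows "P = Q"
  using ipoly_cancel[of "p ^ n" P Q] assms by simp

text \<open>The lift of Frobenius to characteristic 0 that sends each variable to its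
  \<open>p\<close>-th power; it is a ring endomorphism, unlike
  \<open>a \<mapsto> a ^ p\<close>.\<close>

definition frobl :: "nat \<Rightarrow> 'v ipoly \<Rightarrow> 'v ipoly" where
  "frobl p = peval cls (\<lambda>v. ivar v ^ p)"

lemma frobl_hom [simp]:
  "frobl p 0 = 0" "frobl p 1 = 1" "frobl p (a + b) = frobl p a + frobl p b"
  "frobl p (a * b) = frobl p a * frobl p b" "frobl p (ivar v) = ivar v ^ p"
  by (simp_all add: frobl_def)

lemma frobl_diff [simp]: "frobl p (a - b) = frobl p a - frobl p b"
  by (metis add_diff_cancel diff_add_cancel frobl_hom(3))

lemma frobl_uminus [simp]: "frobl p (- a) = - frobl p a"
  by (metis diff_0 frobl_diff frobl_hom(1))

lemma frobl_power [simp]: "frobl p (a ^ n) = frobl p a ^ n"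
  by (induction n) auto

lemma frobl_of_nat [simp]: "frobl p (of_nat n) = of_nat n"
  by (induction n) auto

lemma frobl_sum [simp]: "frobl p (sum f A) = (\<Sum>x\<in>A. frobl p (f x))"
  by (induction A rule: infinite_finite_induct) auto

lemma frobl_cong:
  assumes "prime p"
  shows "of_nat p dvd frobl p a - a ^ p"
proof (induction a rule: ipoly_ring_induct)
  case (diff a b)
  have "of_nat p dvd ((a - b) + b) ^ p - ((a - b) ^ p + b ^ p)"
    by (rule prime_dvd_power_add[OF assms])
  then have "of_nat p dvd a ^ p - ((a - b) ^ p + b ^ p)" by simp
  from dvd_diff[OF dvd_add[OF diff(1) this] diff(2)]
  show ?case by (simp add: algebra_simps)
next
  case (mult a b)
  have "frobl p (a * b) - (a * b) ^ p = (frobl p a - a ^ p) * frobl p b + a ^ p * (frobl p b - b ^ p)"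
    by (simp add: algebra_simps power_mult_distrib)
  then show ?case using mult by simp
qed auto

text \<open>\<open>s i ^ p\<close> and \<open>frobl p (s i)\<close> agree modulo \<open>p\<close>,
  so their \<open>p ^ (n - i)\<close>-th powers agree modulo \<open>p ^ (n - i + 1)\<close>, and the
  coefficient \<open>p ^ i\<close> supplies the rest. The sum is the ghost component of index
  \<open>Suc n\<close> without its last term.\<close>

lemma ghost_Suc_cong:
  fixes s :: "nat \<Rightarrow> 'v ipoly"
  assumes p: "prime p"
  shows "of_nat p ^ Suc n dvd (\<Sum>i\<le>n. of_nat p ^ i * s i ^ (p ^ (Suc n - i))) - frobl p (ghost p s n)"
proof -
  have "of_nat p ^ Suc n dvd (\<Sum>i\<le>n. of_nat p ^ i * s i ^ (p ^ (Suc n - i)) - of_nat p ^ i * frobl p (s i) ^ (p ^ (n - i)))"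
  proof (rule dvd_sum)
    fix i assume "i \<in> {..n}"
    then have i: "i \<le> n" by simp
    have "of_nat p dvd s i ^ p - frobl p (s i)"
      using dvd_minus_iff[of "of_nat p" "frobl p (s i) - s i ^ p"] frobl_cong[OF p, of "s i"] by simp
    then have "of_nat p ^ Suc (n - i) dvd (s i ^ p) ^ (p ^ (n - i)) - frobl p (s i) ^ (p ^ (n - i))"
      by (rule dvd_power_prime_power)
    then have "of_nat p ^ i * of_nat p ^ Suc (n - i) dvd
        of_nat p ^ i * ((s i ^ p) ^ (p ^ (n - i)) - frobl p (s i) ^ (p ^ (n - i)))"
      by (intro mult_dvd_mono dvd_refl)
    moreover have "of_nat p ^ i * of_nat p ^ Suc (n - i) = (of_nat p ^ Suc n :: 'v ipoly)"
      using i by (simp flip: power_add power_Suc)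
    moreover have "(s i ^ p) ^ (p ^ (n - i)) = s i ^ (p ^ (Suc n - i))"
      using i by (simp add: Suc_diff_le flip: power_mult)
    ultimately show "of_nat p ^ Suc n dvd of_nat p ^ i * s i ^ (p ^ (Suc n - i)) - of_nat p ^ i * frobl p (s i) ^ (p ^ (n - i))"
      by (simp add: right_diff_distrib)
  qed
  then show ?thesis by (simp add: ghost_def sum_subtractf)
qed

lemma ghost_Suc: "ghost p s (Suc n) =
    (\<Sum>i\<le>n. of_nat p ^ i * s i ^ (p ^ (Suc n - i))) + of_nat p ^ Suc n * s (Suc n)"
  by (simp add: ghost_def)

text \<open>Dwork's condition. It characterises sequences of ghost components
  (\<open>ghostly_ghost\<close>, \<open>ghostly_imp_ghost\<close>) and produces Witt vectors without
  writing down their entries.\<close>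

definition ghostly :: "nat \<Rightarrow> (nat \<Rightarrow> 'v ipoly) \<Rightarrow> bool" where
  "ghostly p w \<longleftrightarrow> (\<forall>n. of_nat p ^ Suc n dvd w (Suc n) - frobl p (w n))"

lemma ghostly_ghost: 
  assumes "prime p" shows "ghostly p (ghost p s)"
  unfolding ghostly_def
proof
  fix n
  have "ghost p s (Suc n) - frobl p (ghost p s n) = 
    ((\<Sum>i\<le>n. of_nat p ^ i * s i ^ (p ^ (Suc n - i))) - frobl p (ghost p s n)) + of_nat p ^ Suc n * s (Suc n)"
    by (simp add: ghost_Suc)
  then show "of_nat p ^ Suc n dvd ghost p s (Suc n) - frobl p (ghost p s n)"
    using dvd_add[OF ghost_Suc_cong[OF assms, of n s] dvd_triv_left[of _ "s (Suc n)"]] by (simp only:)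
qed

text \<open>The system is triangular with diagonal coefficients \<open>p ^ n\<close>, which cancel.
  The bounded form is needed to glue finite solutions in \<open>ghostly_imp_ghost\<close>.\<close>

lemma ghost_inj_le:
  fixes s t :: "nat \<Rightarrow> 'v ipoly"
  assumes "prime p" and eq: "\<And>n. n \<le> N \<Longrightarrow> ghost p s n = ghost p t n" and "n \<le> N"
  shows "s n = t n"
  using \<open>n \<le> N\<close>
proof (induction n rule: less_induct)
  case (less n)
  have p: "p > 0" using assms(1) prime_gt_0_nat by blast
  show ?case
  proof (cases n)
    case 0
    then show ?thesis using eq[of 0] by (simp add: ghost_def)
  next
    case (Suc m)
    have "(\<Sum>i\<le>m. of_nat p ^ i * s i ^ (p ^ (Suc m - i))) = (\<Sum>i\<le>m. of_nat p ^ i * t i ^ (p ^ (Suc m - i)))"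
      using less Suc by (intro sum.cong) auto
    with eq[OF less.prems] have "of_nat p ^ Suc m * s (Suc m) = of_nat p ^ Suc m * t (Suc m)"
      unfolding Suc ghost_Suc by simp
    then show ?thesis using ipoly_cancel_pow[OF p] Suc by blast
  qed
qed

lemma ghost_inj:
  fixes s t :: "nat \<Rightarrow> 'v ipoly"
  assumes "prime p" and "\<And>n. ghost p s n = ghost p t n"
  shows "s = t"
  using ghost_inj_le[of p _ s t] assms by blast

lemma ghostly_imp_ghost:
  fixes w :: "nat \<Rightarrow> 'v ipoly"
  assumes p: "prime p" and w: "ghostly p w"
  shows "\<exists>s. \<forall>n. ghost p s n = w n"
proof -
  have "\<exists>s. \<forall>n\<le>N. ghost p s n = w n" for N
  proof (induction N)
    case 0
    show ?case by (intro exI[of _ "\<lambda>_. w 0"]) (simp add: ghost_def)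
  next
    case (Suc N)
    then obtain s where s: "\<And>n. n \<le> N \<Longrightarrow> ghost p s n = w n" by blast
    let ?c = "\<Sum>i\<le>N. of_nat p ^ i * s i ^ (p ^ (Suc N - i))"
    \<comment> \<open>Both \<open>w (Suc N)\<close> and \<open>?c\<close> are congruent to
      \<open>frobl p (w N)\<close>, one by Dwork's condition and the other by
      \<open>ghost_Suc_cong\<close>. The quotient of their difference by \<open>p ^ Suc N\<close> is
      the next entry.\<close>
    have "of_nat p ^ Suc N dvd (w (Suc N) - frobl p (w N)) - (?c - frobl p (ghost p s N))"
      using w by (intro dvd_diff[OF _ ghost_Suc_cong[OF p]]) (simp add: ghostly_def)
    then have "of_nat p ^ Suc N dvd w (Suc N) - ?c" using s[of N] by simp
    then obtain u where u: "w (Suc N) - ?c = of_nat p ^ Suc N * u" by (auto elim: dvdE)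
    let ?s = "s(Suc N := u)"
    have "ghost p ?s n = w n" if "n \<le> Suc N" for n
    proof (cases "n = Suc N")
      case True
      have "(\<Sum>i\<le>N. of_nat p ^ i * ?s i ^ (p ^ (Suc N - i))) = ?c"
        by (intro sum.cong) auto
      then show ?thesis using u unfolding True ghost_Suc by (simp add: algebra_simps)
    next
      case False
      then have "ghost p ?s n = ghost p s n"
        unfolding ghost_def using that by (intro sum.cong) auto
      then show ?thesis using s False that by simp
    qed
    then show ?case by blast
  qed
  then obtain S where S: "\<And>N n. n \<le> N \<Longrightarrow> ghost p (S N) n = w n" by metis
  \<comment> \<open>By uniqueness the finite solutions extend one another, so their diagonal solves
    all equations.\<close>
  have SS: "S N n = S n n" if "n \<le> N" for N n
    using ghost_inj_le[OF p, of n "S N" "S n" n] S that by auto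
  have "ghost p (\<lambda>n. S n n) n = ghost p (S n) n" for n
    unfolding ghost_def
  proof (intro sum.cong refl)
    fix i assume "i \<in> {..n}"
    then have "S i i = S n i" using SS[of i n] by simp
    then show "of_nat p ^ i * S i i ^ p ^ (n - i) = of_nat p ^ i * S n i ^ p ^ (n - i)" by simp
  qed
  then show ?thesis using S by (metis order_refl)
qed

text \<open>Since \<open>frobl\<close> is a ring homomorphism, sequences with Dwork's property are
  closed under the ring operations; this yields existence of sums, negatives and products of Witt
  vectors.\<close>

lemma ghostly_add: "ghostly p v \<Longrightarrow> ghostly p w \<Longrightarrow> ghostly p (\<lambda>n. v n + w n)"
  unfolding ghostly_def
proof (intro allI)
  fix n assume "\<forall>n. of_nat p ^ Suc n dvd v (Suc n) - frobl p (v n)" "\<forall>n. of_nat p ^ Suc n dvd w (Suc n) - frobl p (w n)"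
  then have "of_nat p ^ Suc n dvd (v (Suc n) - frobl p (v n)) + (w (Suc n) - frobl p (w n))"
    by (intro dvd_add) simp_all
  then show "of_nat p ^ Suc n dvd v (Suc n) + w (Suc n) - frobl p (v n + w n)"
    by (simp add: algebra_simps)
qed

lemma ghostly_uminus: "ghostly p v \<Longrightarrow> ghostly p (\<lambda>n. - v n)"
  unfolding ghostly_def
proof (intro allI)
  fix n assume "\<forall>n. of_nat p ^ Suc n dvd v (Suc n) - frobl p (v n)"
  then have "of_nat p ^ Suc n dvd - (v (Suc n) - frobl p (v n))" by (subst dvd_minus_iff) simp
  then show "of_nat p ^ Suc n dvd - v (Suc n) - frobl p (- v n)" by (simp add: algebra_simps)
qed

lemma ghostly_mult: "ghostly p v \<Longrightarrow> ghostly p w \<Longrightarrow> ghostly p (\<lambda>n. v n * w n)"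
  unfolding ghostly_def
proof (intro allI)
  fix n assume "\<forall>n. of_nat p ^ Suc n dvd v (Suc n) - frobl p (v n)" "\<forall>n. of_nat p ^ Suc n dvd w (Suc n) - frobl p (w n)"
  then have "of_nat p ^ Suc n dvd (v (Suc n) - frobl p (v n)) * w (Suc n) + frobl p (v n) * (w (Suc n) - frobl p (w n))"
    by (intro dvd_add dvd_mult dvd_mult2) simp_all
  then show "of_nat p ^ Suc n dvd v (Suc n) * w (Suc n) - frobl p (v n * w n)"
    by (simp add: algebra_simps)
qed

text \<open>The source of identities that hold only in characteristic \<open>p\<close>. If the
  earlier entries agree modulo \<open>p\<close>, their contributions agree modulo
  \<open>p ^ Suc n\<close>; what remains is \<open>p ^ n * (s n - t n)\<close>, and
  \<open>p ^ n\<close> cancels.\<close>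

lemma ghost_cong_imp_cong:
  fixes s t :: "nat \<Rightarrow> 'v ipoly"
  assumes p: "prime p" and eq: "\<And>n. of_nat p ^ Suc n dvd ghost p s n - ghost p t n"
  shows "of_nat p dvd s n - t n"
proof (induction n rule: less_induct)
  case (less n)
  have p0: "p > 0" using p prime_gt_0_nat by blast
  show ?case
  proof (cases n)
    case 0
    then show ?thesis using eq[of 0] by (simp add: ghost_def)
  next
    case (Suc m)
    have "of_nat p ^ Suc n dvd (\<Sum>i\<le>m. of_nat p ^ i * s i ^ (p ^ (n - i)) - of_nat p ^ i * t i ^ (p ^ (n - i)))"
    proof (rule dvd_sum)
      fix i assume "i \<in> {..m}"
      then have i: "i < n" using Suc by simp
      have "of_nat p ^ Suc (n - i) dvd s i ^ (p ^ (n - i)) - t i ^ (p ^ (n - i))"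
        by (rule dvd_power_prime_power[OF less(1)[OF i]])
      then have "of_nat p ^ i * of_nat p ^ Suc (n - i) dvd of_nat p ^ i * (s i ^ (p ^ (n - i)) - t i ^ (p ^ (n - i)))"
        by (intro mult_dvd_mono dvd_refl)
      moreover have "of_nat p ^ i * of_nat p ^ Suc (n - i) = (of_nat p ^ Suc n :: 'v ipoly)"
        using i by (simp flip: power_add power_Suc)
      ultimately show "of_nat p ^ Suc n dvd of_nat p ^ i * s i ^ (p ^ (n - i)) - of_nat p ^ i * t i ^ (p ^ (n - i))"
        by (simp add: right_diff_distrib)
    qed
    from dvd_diff[OF eq[of n] this]
    have "of_nat p ^ Suc n dvd of_nat p ^ n * (s n - t n)"
      unfolding Suc ghost_Suc by (simp add: sum_subtractf algebra_simps)
    then obtain u where "of_nat p ^ n * (s n - t n) = of_nat p ^ Suc n * u" by (auto elim: dvdE)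
    then have "of_nat p ^ n * (s n - t n) = of_nat p ^ n * (of_nat p * u)" by (simp add: algebra_simps)
    then have "s n - t n = of_nat p * u" by (rule ipoly_cancel_pow[OF p0])
    then show ?thesis by simp
  qed
qed

lemma ghost_hom:
  fixes h :: "'r::comm_ring_1 \<Rightarrow> 's::comm_ring_1"
  assumes h: "h 0 = 0" "h 1 = 1" "\<And>a b. h (a + b) = h a + h b" "\<And>a b. h (a * b) = h a * h b"
  shows "h (ghost p s n) = ghost p (\<lambda>i. h (s i)) n"
proof -
  have pw: "h (a ^ k) = h a ^ k" for a k by (induction k) (auto simp: h)
  have nat: "h (of_nat k) = of_nat k" for k by (induction k) (auto simp: h)
  have sum: "h (sum f A) = (\<Sum>x\<in>A. h (f x))" for f and A :: "nat set"
    by (induction A rule: infinite_finite_induct) (auto simp: h)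
  show ?thesis unfolding ghost_def by (simp add: sum h pw nat)
qed

lemma xy_var_ivar: "xy_var = ivar"
  by (simp add: xy_var_def ivar_def fun_eq_iff)

text \<open>Witt's theorem: existence from Dwork's criterion, uniqueness from
  \<open>ghost_inj\<close>, which together justify the \<open>THE\<close> in the definition.\<close>

lemma ghost_witt_add_poly:
  assumes p: "prime p"
  shows "ghost p (witt_add_poly p) n = ghost p (\<lambda>i. ivar (Inl i)) n + ghost p (\<lambda>i. ivar (Inr i)) n"
proof -
  have "\<exists>!S :: nat \<Rightarrow> xy_poly. \<forall>n. ghost p S n = ghost p (\<lambda>i. xy_var (Inl i)) n + ghost p (\<lambda>i. xy_var (Inr i)) n"
  proof (rule ex_ex1I)
    show "\<exists>S :: nat \<Rightarrow> xy_poly. \<forall>n. ghost p S n = ghost p (\<lambda>i. xy_var (Inl i)) n + ghost p (\<lambda>i. xy_var (Inr i)) n"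
      by (intro ghostly_imp_ghost p ghostly_add ghostly_ghost)
  qed (use ghost_inj[OF p] in metis)
  from theI'[OF this] show ?thesis unfolding witt_add_poly_def xy_var_ivar by blast
qed

lemma ghost_witt_mult_poly:
  assumes p: "prime p"
  shows "ghost p (witt_mult_poly p) n = ghost p (\<lambda>i. ivar (Inl i)) n * ghost p (\<lambda>i. ivar (Inr i)) n"
proof -
  have "\<exists>!S :: nat \<Rightarrow> xy_poly. \<forall>n. ghost p S n = ghost p (\<lambda>i. xy_var (Inl i)) n * ghost p (\<lambda>i. xy_var (Inr i)) n"
  proof (rule ex_ex1I)
    show "\<exists>S :: nat \<Rightarrow> xy_poly. \<forall>n. ghost p S n = ghost p (\<lambda>i. xy_var (Inl i)) n * ghost p (\<lambda>i. xy_var (Inr i)) n"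
      by (intro ghostly_imp_ghost p ghostly_mult ghostly_ghost)
  qed (use ghost_inj[OF p] in metis)
  from theI'[OF this] show ?thesis unfolding witt_mult_poly_def xy_var_ivar by blast
qed

subsection \<open>Isobaric polynomials\<close>

definition monom_weight :: "('v \<Rightarrow> nat) \<Rightarrow> ('v \<Rightarrow>\<^sub>0 nat) \<Rightarrow> nat" where
  "monom_weight w m = (\<Sum>v\<in>Poly_Mapping.keys m. Poly_Mapping.lookup m v * w v)"

lemma monom_weight_superset:
  "finite S \<Longrightarrow> Poly_Mapping.keys m \<subseteq> S \<Longrightarrow> monom_weight w m = (\<Sum>v\<in>S. Poly_Mapping.lookup m v * w v)"
  unfolding monom_weight_def by (intro sum.mono_neutral_left) (auto simp: in_keys_iff)

lemma monom_weight_add: "monom_weight w (m + n) = monom_weight w m + monom_weight w n"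
proof -
  let ?S = "Poly_Mapping.keys m \<union> Poly_Mapping.keys n"
  have "monom_weight w (m + n) = (\<Sum>v\<in>?S. Poly_Mapping.lookup (m + n) v * w v)"
    by (intro monom_weight_superset keys_add) auto
  also have "\<dots> = (\<Sum>v\<in>?S. Poly_Mapping.lookup m v * w v) + (\<Sum>v\<in>?S. Poly_Mapping.lookup n v * w v)"
    by (simp add: lookup_add distrib_right sum.distrib)
  also have "(\<Sum>v\<in>?S. Poly_Mapping.lookup m v * w v) = monom_weight w m"
    by (intro monom_weight_superset[symmetric]) auto
  also have "(\<Sum>v\<in>?S. Poly_Mapping.lookup n v * w v) = monom_weight w n"
    by (intro monom_weight_superset[symmetric]) auto
  finally show ?thesis .
qed

definition isobaric :: "('v \<Rightarrow> nat) \<Rightarrow> nat \<Rightarrow> 'v ipoly \<Rightarrow> bool" where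
  "isobaric w d P \<longleftrightarrow> (\<forall>m\<in>Poly_Mapping.keys P. monom_weight w m = d)"

lemma isobaric_zero [simp]: "isobaric w d 0"
  by (simp add: isobaric_def)

lemma isobaric_one [simp]: "isobaric w 0 1"
  by (simp add: isobaric_def monom_weight_def)

lemma isobaric_add: "isobaric w d P \<Longrightarrow> isobaric w d Q \<Longrightarrow> isobaric w d (P + Q)"
  using keys_add[of P Q] unfolding isobaric_def by blast

lemma isobaric_diff: "isobaric w d P \<Longrightarrow> isobaric w d Q \<Longrightarrow> isobaric w d (P - Q)"
  using keys_diff[of P Q] unfolding isobaric_def by blast

lemma isobaric_sum: "(\<And>x. x \<in> A \<Longrightarrow> isobaric w d (f x)) \<Longrightarrow> isobaric w d (sum f A)"
  by (induction A rule: infinite_finite_induct) (auto intro: isobaric_add)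

lemma isobaric_mult: "isobaric w d P \<Longrightarrow> isobaric w e Q \<Longrightarrow> isobaric w (d + e) (P * Q)"
  using keys_mult[of P Q] unfolding isobaric_def by (fastforce simp: monom_weight_add)

lemma isobaric_power: "isobaric w d P \<Longrightarrow> isobaric w (d * k) (P ^ k)"
  by (induction k) (auto dest: isobaric_mult)

lemma isobaric_of_nat: "c > 0 \<Longrightarrow> isobaric w d (of_nat c * P) \<longleftrightarrow> isobaric w d P"
  by (auto simp: isobaric_def in_keys_iff lookup_of_nat_mult)

lemma isobaric_of_nat_pow: "p > 0 \<Longrightarrow> isobaric w d (of_nat p ^ k * P) \<longleftrightarrow> isobaric w d P"
  using isobaric_of_nat[of "p ^ k" w d P] by simp

lemma isobaric_ivar: "isobaric w (w v) (ivar v)"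
  by (simp add: isobaric_def ivar_def monom_weight_def)

lemma isobaric_ghost_aux:
  assumes p: "p > 0" and n: "i \<le> n" and "isobaric w (d * p ^ i) s"
  shows "isobaric w (d * p ^ n) (of_nat p ^ i * s ^ (p ^ (n - i)))"
proof -
  have "isobaric w (d * p ^ i * p ^ (n - i)) (s ^ (p ^ (n - i)))" by (intro isobaric_power assms)
  moreover have "p ^ i * p ^ (n - i) = p ^ n" using n by (simp flip: power_add)
  ultimately have "isobaric w (d * p ^ n) (s ^ (p ^ (n - i)))" by (simp add: mult.assoc)
  then show ?thesis by (simp add: isobaric_of_nat_pow[OF p])
qed

lemma isobaric_ghost:
  assumes "p > 0" and "\<And>i. isobaric w (d * p ^ i) (s i)"
  shows "isobaric w (d * p ^ n) (ghost p s n)"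
  unfolding ghost_def by (intro isobaric_sum isobaric_ghost_aux) (use assms in auto)

text \<open>Solving for \<open>s n\<close> divides by \<open>p ^ n\<close> only, and division by a
  positive integer does not change which monomials occur.\<close>

lemma isobaric_of_ghost:
  assumes p: "p > 0" and g: "\<And>n. isobaric w (d * p ^ n) (ghost p s n)"
  shows "isobaric w (d * p ^ n) (s n)"
proof (induction n rule: less_induct)
  case (less n)
  show ?case
  proof (cases n)
    case 0
    then show ?thesis using g[of 0] by (simp add: ghost_def)
  next
    case (Suc m)
    have "isobaric w (d * p ^ n) (\<Sum>i\<le>m. of_nat p ^ i * s i ^ (p ^ (n - i)))"
      by (intro isobaric_sum isobaric_ghost_aux[OF p] less) (auto simp: Suc)
    from isobaric_diff[OF g[of n] this] have "isobaric w (d * p ^ n) (of_nat p ^ n * s n)"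
      unfolding Suc ghost_Suc by simp
    then show ?thesis by (simp add: isobaric_of_nat_pow[OF p])
  qed
qed

definition add_wt :: "nat \<Rightarrow> nat + nat \<Rightarrow> nat" where
  "add_wt p = case_sum (\<lambda>i. p ^ i) (\<lambda>i. p ^ i)"

text \<open>Only the second factor carries weight. In the action on covectors it is the window,
  whereas the entries of the scalar need not be nilpotent.\<close>

definition mult_wt :: "nat \<Rightarrow> nat + nat \<Rightarrow> nat" where
  "mult_wt p = case_sum (\<lambda>i. 0) (\<lambda>i. p ^ i)"

lemma isobaric_witt_add_poly:
  assumes p: "prime p" shows "isobaric (add_wt p) (p ^ n) (witt_add_poly p n)"
proof -
  have p0: "p > 0" using p prime_gt_0_nat by blast
  have "isobaric (add_wt p) (1 * p ^ n) (witt_add_poly p n)"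
  proof (rule isobaric_of_ghost[OF p0])
    fix n
    have 1: "isobaric (add_wt p) (1 * p ^ i) (ivar (Inl i))" "isobaric (add_wt p) (1 * p ^ i) (ivar (Inr i))" for i
      using isobaric_ivar[of "add_wt p" "Inl i"] isobaric_ivar[of "add_wt p" "Inr i"] by (simp_all add: add_wt_def)
    show "isobaric (add_wt p) (1 * p ^ n) (ghost p (witt_add_poly p) n)"
      unfolding ghost_witt_add_poly[OF p] by (intro isobaric_add isobaric_ghost p0 1)
  qed
  then show ?thesis by simp
qed

lemma isobaric_witt_mult_poly:
  assumes p: "prime p" shows "isobaric (mult_wt p) (p ^ n) (witt_mult_poly p n)"
proof -
  have p0: "p > 0" using p prime_gt_0_nat by blast
  have "isobaric (mult_wt p) (1 * p ^ n) (witt_mult_poly p n)"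
  proof (rule isobaric_of_ghost[OF p0])
    fix n
    have 1: "isobaric (mult_wt p) (0 * p ^ i) (ivar (Inl i))" "isobaric (mult_wt p) (1 * p ^ i) (ivar (Inr i))" for i
      using isobaric_ivar[of "mult_wt p" "Inl i"] isobaric_ivar[of "mult_wt p" "Inr i"] by (simp_all add: mult_wt_def)
    have "isobaric (mult_wt p) (0 * p ^ n + 1 * p ^ n) (ghost p (witt_mult_poly p) n)"
      unfolding ghost_witt_mult_poly[OF p] by (intro isobaric_mult isobaric_ghost p0 1)
    then show "isobaric (mult_wt p) (1 * p ^ n) (ghost p (witt_mult_poly p) n)" by simp
  qed
  then show ?thesis by simp
qed

text \<open>
  The carries \<open>c\<close> in \<open>(\<Sum>l\<le>j. E l * p ^ l) = c * p ^ Suc j\<close> satisfy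
  \<open>c + (j - i + 1) \<le> (\<Sum>l\<le>j. E l)\<close>: the number of digits absorbed grows with each carry.
\<close>

lemma digit_sum_lower_bound:
  fixes E :: "nat \<Rightarrow> nat"
  assumes p: "p \<ge> 2" and E: "(\<Sum>l\<le>n. E l * p ^ l) = p ^ n" and i: "E i > 0" "i \<le> j" "j < n"
  shows "(\<Sum>l\<le>j. E l) \<ge> j - i + 2"
proof -
  \<comment> \<open>Terms above \<open>j\<close> are divisible by \<open>p ^ Suc j\<close>, and so
    is the total \<open>p ^ n\<close>, because \<open>j < n\<close>.\<close>
  have dvd: "p ^ Suc j dvd (\<Sum>l\<le>j. E l * p ^ l)" if "j < n" for j
  proof -
    have split: "(\<Sum>l\<le>n. E l * p ^ l) = (\<Sum>l\<le>j. E l * p ^ l) + (\<Sum>l\<in>{j<..n}. E l * p ^ l)"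
      using that by (subst sum.union_disjoint[symmetric]) (auto intro!: sum.cong)
    have "p ^ Suc j dvd (\<Sum>l\<in>{j<..n}. E l * p ^ l)"
      by (intro dvd_sum dvd_mult le_imp_power_dvd) auto
    moreover have "p ^ Suc j dvd p ^ n" using that by (intro le_imp_power_dvd) auto
    ultimately show ?thesis using split E by (metis dvd_add_left_iff)
  qed
  have "\<exists>c\<ge>1. (\<Sum>l\<le>j. E l * p ^ l) = c * p ^ Suc j \<and> (\<Sum>l\<le>j. E l) \<ge> c + (j - i + 1)"
    using i(2,3)
  proof (induction j rule: dec_induct)
    case base
    obtain c where c: "(\<Sum>l\<le>i. E l * p ^ l) = c * p ^ Suc i" using dvd[OF base] by (metis dvd_def mult.commute)
    have "0 < E i * p ^ i" using i p by simp
    also have "\<dots> \<le> (\<Sum>l\<le>i. E l * p ^ l)" by (intro member_le_sum) auto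
    finally have "c \<ge> 1" using c by (cases c) auto
    have "(\<Sum>l\<le>i. E l * p ^ l) \<le> (\<Sum>l\<le>i. E l * p ^ i)"
      by (intro sum_mono mult_left_mono power_increasing) (use p in auto)
    then have "(c * p) * p ^ i \<le> (\<Sum>l\<le>i. E l) * p ^ i"
      unfolding c sum_distrib_right by (simp only: power_Suc mult_ac)
    then have "c * p \<le> (\<Sum>l\<le>i. E l)" using p by simp
    \<comment> \<open>Here \<open>c * p \<ge> 2 * c \<ge> c + 1\<close>: a carry is worth at least
      \<open>p\<close> times as many units one digit lower.\<close>
    moreover have "c * 2 \<le> c * p" using p by simp
    ultimately have "c + (i - i + 1) \<le> (\<Sum>l\<le>i. E l)" using \<open>c \<ge> 1\<close> by linarith
    then show ?case using c \<open>c \<ge> 1\<close> by blast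
  next
    case (step j)
    then obtain c where c: "c \<ge> 1" "(\<Sum>l\<le>j. E l * p ^ l) = c * p ^ Suc j" "(\<Sum>l\<le>j. E l) \<ge> c + (j - i + 1)"
      by auto
    obtain c' where c': "(\<Sum>l\<le>Suc j. E l * p ^ l) = c' * p ^ Suc (Suc j)"
      using dvd[OF step.prems] by (metis dvd_def mult.commute)
    then have "(c' * p) * p ^ Suc j = (c + E (Suc j)) * p ^ Suc j"
      using c(2) by (simp add: algebra_simps)
    \<comment> \<open>So \<open>E (Suc j) = c' * p - c\<close>, which turns the bound
      \<open>c + (j - i + 1)\<close> into \<open>c' * p + (j - i + 1)\<close>; again
      \<open>c' * p \<ge> c' + 1\<close>.\<close>
    then have eq: "c' * p = c + E (Suc j)" using p by simp
    then have "c' \<ge> 1" using c(1) by (cases c') auto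
    have "c' * 2 \<le> c' * p" using p by simp
    then have "c' + (Suc j - i + 1) \<le> (\<Sum>l\<le>Suc j. E l)"
      using c(3) eq \<open>c' \<ge> 1\<close> step(1) by (simp add: Suc_diff_le)
    then show ?case using c' \<open>c' \<ge> 1\<close> by blast
  qed
  then show ?thesis by linarith
qed

subsection \<open>Witt vectors of a ring\<close>

text \<open>\<open>witt\<close> for an arbitrary ring scheme, since algebras are records that extend
  rings.\<close>

definition WR :: "nat \<Rightarrow> ('a, 'b) ring_scheme \<Rightarrow> (nat \<Rightarrow> 'a) ring" where
  "WR p A =
     \<lparr>carrier = {x. \<forall>n. x n \<in> carrier A},
      mult = (\<lambda>x y n. xy_eval A x y (witt_mult_poly p n)),
      one = (\<lambda>n. if n = 0 then \<one>\<^bsub>A\<^esub> else \<zero>\<^bsub>A\<^esub>),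
      zero = (\<lambda>n. \<zero>\<^bsub>A\<^esub>),
      add = (\<lambda>x y n. xy_eval A x y (witt_add_poly p n))\<rparr>"

lemma witt_WR: "witt p K = WR p K"
  by (simp add: witt_def WR_def)

lemma WR_sel:
  "x \<in> carrier (WR p A) \<longleftrightarrow> (\<forall>n. x n \<in> carrier A)"
  "x \<otimes>\<^bsub>WR p A\<^esub> y = (\<lambda>n. xy_eval A x y (witt_mult_poly p n))"
  "\<one>\<^bsub>WR p A\<^esub> = (\<lambda>n. if n = 0 then \<one>\<^bsub>A\<^esub> else \<zero>\<^bsub>A\<^esub>)"
  "\<zero>\<^bsub>WR p A\<^esub> = (\<lambda>n. \<zero>\<^bsub>A\<^esub>)"
  "x \<oplus>\<^bsub>WR p A\<^esub> y = (\<lambda>n. xy_eval A x y (witt_add_poly p n))"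
  by (simp_all add: WR_def)

lemma (in cring) xy_eval_closed [simp]:
  "(\<And>i. x i \<in> carrier R) \<Longrightarrow> (\<And>i. y i \<in> carrier R) \<Longrightarrow> xy_eval R x y P \<in> carrier R"
  unfolding xy_eval_peval by (intro peval_closed) (auto split: sum.splits)

lemma hom_xy_eval:
  assumes "cring R" "cring S" "h \<in> ring_hom R S" and "\<And>i. x i \<in> carrier R" "\<And>i. y i \<in> carrier R"
  shows "h (xy_eval R x y P) = xy_eval S (\<lambda>i. h (x i)) (\<lambda>i. h (y i)) P"
proof -
  have "(\<lambda>v. h (case v of Inl i \<Rightarrow> x i | Inr i \<Rightarrow> y i)) = case_sum (\<lambda>i. h (x i)) (\<lambda>i. h (y i))"
    by (auto simp: fun_eq_iff split: sum.splits)
  moreover have "\<And>v. (case v of Inl i \<Rightarrow> x i | Inr i \<Rightarrow> y i) \<in> carrier R"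
    using assms by (auto split: sum.splits)
  ultimately show ?thesis using hom_peval[OF assms(1-3), of "case_sum x y" P]
    by (simp add: xy_eval_peval)
qed

lemma xy_eval_cls_hom:
  "xy_eval cls x y (P + Q) = xy_eval cls x y P + xy_eval cls x y Q"
  "xy_eval cls x y (P * Q) = xy_eval cls x y P * xy_eval cls x y Q"
  by (simp_all add: xy_eval_peval)

lemma ghost_xy_eval_cls:
  "ghost p (\<lambda>n. xy_eval cls x y (S n)) n = xy_eval cls x y (ghost p S n)"
  by (rule ghost_hom[symmetric]) (simp_all add: xy_eval_peval)

lemma xy_eval_ghost_ivar:
  fixes x y :: "nat \<Rightarrow> 'r::comm_ring_1"
  shows "xy_eval cls x y (ghost p (\<lambda>i. ivar (Inl i)) n) = ghost p x n"
    "xy_eval cls x y (ghost p (\<lambda>i. ivar (Inr i)) n) = ghost p y n"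
  by (subst ghost_hom[where h = "xy_eval cls x y"]; simp add: xy_eval_peval)+

context
  fixes p :: nat
  assumes p: "prime p"
begin

lemma ghost_WR_add:
  "ghost p (x \<oplus>\<^bsub>WR p cls\<^esub> y) n = ghost p x n + ghost p y n"
  unfolding WR_sel ghost_xy_eval_cls ghost_witt_add_poly[OF p]
  by (simp add: xy_eval_cls_hom xy_eval_ghost_ivar)

lemma ghost_WR_mult:
  "ghost p (x \<otimes>\<^bsub>WR p cls\<^esub> y) n = ghost p x n * ghost p y n"
  unfolding WR_sel ghost_xy_eval_cls ghost_witt_mult_poly[OF p]
  by (simp add: xy_eval_cls_hom xy_eval_ghost_ivar)

lemma ghost_WR_zero: "ghost p (\<zero>\<^bsub>WR p cls\<^esub>) n = 0"
  unfolding WR_sel ghost_def using prime_gt_0_nat[OF p] by (simp add: power_0_left)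

lemma ghost_WR_one: "ghost p (\<one>\<^bsub>WR p cls\<^esub>) n = 1"
proof -
  have "ghost p (\<one>\<^bsub>WR p cls\<^esub>) n = (\<Sum>i\<le>n. if i = 0 then 1 else 0)"
    unfolding WR_sel ghost_def using prime_gt_0_nat[OF p] by (intro sum.cong) (auto simp: power_0_left)
  then show ?thesis by simp
qed

lemmas ghost_WR = ghost_WR_add ghost_WR_mult ghost_WR_zero ghost_WR_one

text \<open>Ghost components turn the operations into the componentwise ones and are injective here.
  Negatives have no explicit formula; they exist by Dwork's criterion.\<close>

lemma cring_WR_ipoly: "cring (WR p (cls :: 'v ipoly ring))"
proof (rule cringI)
  note gi = ghost_inj[OF p]
  show "abelian_group (WR p (cls :: 'v ipoly ring))"
  proof (rule abelian_groupI)
    fix x :: "nat \<Rightarrow> 'v ipoly"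
    obtain y :: "nat \<Rightarrow> 'v ipoly" where "\<And>n. ghost p y n = - ghost p x n"
      using ghostly_imp_ghost[OF p ghostly_uminus[OF ghostly_ghost[OF p]]] by blast
    then show "\<exists>y\<in>carrier (WR p cls). y \<oplus>\<^bsub>WR p cls\<^esub> x = \<zero>\<^bsub>WR p cls\<^esub>"
      by (intro bexI[of _ y] gi) (simp_all add: ghost_WR, simp add: WR_sel)
  qed (auto intro!: gi simp: ghost_WR, auto simp: WR_sel)
  show "comm_monoid (WR p (cls :: 'v ipoly ring))"
    by (rule comm_monoidI) (auto intro!: gi simp: ghost_WR mult_ac, auto simp: WR_sel)
qed (auto intro!: ghost_inj[OF p] simp: ghost_WR algebra_simps)

end

lemma WR_ring_hom:
  assumes "cring R" "cring S" "h \<in> ring_hom R S"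
  shows "(\<lambda>x n. h (x n)) \<in> ring_hom (WR p R) (WR p S)"
proof (rule ring_hom_memI)
  interpret R: cring R by fact
  interpret S: cring S by fact
  interpret h: ring_hom_cring R S h using assms by unfold_locales auto
  show "(\<lambda>n. h (\<one>\<^bsub>WR p R\<^esub> n)) = \<one>\<^bsub>WR p S\<^esub>" by (auto simp: WR_sel fun_eq_iff)
  fix x assume x: "x \<in> carrier (WR p R)"
  then show "(\<lambda>n. h (x n)) \<in> carrier (WR p S)" by (simp add: WR_sel)
  fix y assume y: "y \<in> carrier (WR p R)"
  show "(\<lambda>n. h ((x \<otimes>\<^bsub>WR p R\<^esub> y) n)) = (\<lambda>n. h (x n)) \<otimes>\<^bsub>WR p S\<^esub> (\<lambda>n. h (y n))"
    "(\<lambda>n. h ((x \<oplus>\<^bsub>WR p R\<^esub> y) n)) = (\<lambda>n. h (x n)) \<oplus>\<^bsub>WR p S\<^esub> (\<lambda>n. h (y n))"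
    using x y by (simp_all add: WR_sel hom_xy_eval[OF assms])
qed

text \<open>The canonical map onto \<open>A\<close> from the polynomial ring with one variable per
  element of the type. Variables outside the carrier need some value in \<open>A\<close> and get
  zero. Every Witt vector over \<open>A\<close> lifts along it.\<close>

definition proj :: "('a, 'b) ring_scheme \<Rightarrow> 'a ipoly \<Rightarrow> 'a" where
  "proj A = peval A (\<lambda>v. if v \<in> carrier A then v else \<zero>\<^bsub>A\<^esub>)"

context cring
begin

lemma proj_ring_hom: "proj R \<in> ring_hom cls R"
  unfolding proj_def by (rule peval_ring_hom) auto

lemma proj_ivar: "x \<in> carrier R \<Longrightarrow> proj R (ivar x) = x"
  unfolding proj_def by (subst peval_ivar) auto

lemma proj_WR_surj: "x \<in> carrier (WR p R) \<Longrightarrow> x = (\<lambda>n. proj R (ivar (x n)))"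
  by (auto simp: WR_sel proj_ivar fun_eq_iff)

text \<open>Identities in \<open>WR p R\<close> are images of identities in a polynomial ring, where ghost vectors decide.\<close>

lemma cring_WR:
  assumes p: "prime p"
  shows "cring (WR p R)"
proof -
  interpret U: cring "WR p (cls :: 'a ipoly ring)" by (rule cring_WR_ipoly[OF p])
  define h where "h = (\<lambda>X (n::nat). proj R (X n))"
  have hh: "h \<in> ring_hom (WR p cls) (WR p R)"
    unfolding h_def by (rule WR_ring_hom) (auto intro: proj_ring_hom is_cring)
  have hs: "\<exists>X\<in>carrier (WR p cls). x = h X" if "x \<in> carrier (WR p R)" for x
    using proj_WR_surj[OF that] by (auto simp: h_def WR_sel intro!: exI[of _ "\<lambda>n. ivar (x n)"])
  note hc = ring_hom_closed[OF hh] and hm = ring_hom_mult[OF hh, symmetric]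
    and ha = ring_hom_add[OF hh, symmetric] and h1 = ring_hom_one[OF hh, symmetric]
  have "\<zero>\<^bsub>WR p R\<^esub> = h \<zero>\<^bsub>WR p cls\<^esub>"
  proof -
    interpret pr: ring_hom_cring cls R "proj R" using proj_ring_hom is_cring by unfold_locales auto
    show ?thesis using pr.hom_zero by (simp add: h_def WR_sel)
  qed
  note hsimps = hm ha h1 this hc
  show ?thesis
  proof (rule cringI)
    show "abelian_group (WR p R)"
    proof (rule abelian_groupI)
      fix x assume "x \<in> carrier (WR p R)"
      then obtain X where X: "X \<in> carrier (WR p cls)" "x = h X" using hs by blast
      then show "\<exists>y\<in>carrier (WR p R). y \<oplus>\<^bsub>WR p R\<^esub> x = \<zero>\<^bsub>WR p R\<^esub>"
        by (intro bexI[of _ "h (\<ominus>\<^bsub>WR p cls\<^esub> X)"]) (simp_all add: hsimps U.l_neg)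
    next
      fix x y assume "x \<in> carrier (WR p R)" "y \<in> carrier (WR p R)"
      then obtain X Y where X: "X \<in> carrier (WR p cls)" "x = h X" "Y \<in> carrier (WR p cls)" "y = h Y"
        using hs by metis
      then show "x \<oplus>\<^bsub>WR p R\<^esub> y \<in> carrier (WR p R)" "x \<oplus>\<^bsub>WR p R\<^esub> y = y \<oplus>\<^bsub>WR p R\<^esub> x"
        by (simp_all add: hsimps U.a_comm)
      fix z assume "z \<in> carrier (WR p R)"
      then obtain Z where "Z \<in> carrier (WR p cls)" "z = h Z"
        using hs by metis
      then show "x \<oplus>\<^bsub>WR p R\<^esub> y \<oplus>\<^bsub>WR p R\<^esub> z = x \<oplus>\<^bsub>WR p R\<^esub> (y \<oplus>\<^bsub>WR p R\<^esub> z)"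
        using X by (simp add: hsimps U.a_assoc)
    next
      fix x assume "x \<in> carrier (WR p R)"
      then obtain X where X: "X \<in> carrier (WR p cls)" "x = h X" using hs by blast
      then show "\<zero>\<^bsub>WR p R\<^esub> \<oplus>\<^bsub>WR p R\<^esub> x = x" by (simp add: hsimps)
    qed (simp add: WR_sel)
    show "comm_monoid (WR p R)"
    proof (rule comm_monoidI)
      fix x y assume "x \<in> carrier (WR p R)" "y \<in> carrier (WR p R)"
      then obtain X Y where X: "X \<in> carrier (WR p cls)" "x = h X" "Y \<in> carrier (WR p cls)" "y = h Y"
        using hs by metis
      then show "x \<otimes>\<^bsub>WR p R\<^esub> y \<in> carrier (WR p R)" "x \<otimes>\<^bsub>WR p R\<^esub> y = y \<otimes>\<^bsub>WR p R\<^esub> x"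
        by (simp_all add: hsimps U.m_comm)
      fix z assume "z \<in> carrier (WR p R)"
      then obtain Z where "Z \<in> carrier (WR p cls)" "z = h Z"
        using hs by metis
      then show "x \<otimes>\<^bsub>WR p R\<^esub> y \<otimes>\<^bsub>WR p R\<^esub> z = x \<otimes>\<^bsub>WR p R\<^esub> (y \<otimes>\<^bsub>WR p R\<^esub> z)"
        using X by (simp add: hsimps U.m_assoc)
    next
      fix x assume "x \<in> carrier (WR p R)"
      then obtain X where X: "X \<in> carrier (WR p cls)" "x = h X" using hs by blast
      then show "\<one>\<^bsub>WR p R\<^esub> \<otimes>\<^bsub>WR p R\<^esub> x = x" by (simp add: hsimps)
    qed (simp add: WR_sel)
  next
    fix x y z assume "x \<in> carrier (WR p R)" "y \<in> carrier (WR p R)" "z \<in> carrier (WR p R)"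
    then obtain X Y Z where X: "X \<in> carrier (WR p cls)" "x = h X" "Y \<in> carrier (WR p cls)" "y = h Y"
        "Z \<in> carrier (WR p cls)" "z = h Z"
      using hs by metis
    then show "(x \<oplus>\<^bsub>WR p R\<^esub> y) \<otimes>\<^bsub>WR p R\<^esub> z = x \<otimes>\<^bsub>WR p R\<^esub> z \<oplus>\<^bsub>WR p R\<^esub> y \<otimes>\<^bsub>WR p R\<^esub> z"
      by (simp add: hsimps U.l_distr)
  qed
qed

end

subsection \<open>Frobenius and Verschiebung\<close>

definition wV :: "('a, 'b) ring_scheme \<Rightarrow> (nat \<Rightarrow> 'a) \<Rightarrow> nat \<Rightarrow> 'a" where
  "wV A x = (\<lambda>n. case n of 0 \<Rightarrow> \<zero>\<^bsub>A\<^esub> | Suc m \<Rightarrow> x m)"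

lemma wV_simps [simp]: "wV A x 0 = \<zero>\<^bsub>A\<^esub>" "wV A x (Suc n) = x n"
  by (simp_all add: wV_def)

lemma ghost_wV:
  fixes x :: "nat \<Rightarrow> 'r::comm_ring_1"
  assumes "p > 0"
  shows "ghost p (wV cls x) n = (case n of 0 \<Rightarrow> 0 | Suc m \<Rightarrow> of_nat p * ghost p x m)"
proof (cases n)
  case (Suc m)
  have "ghost p (wV cls x) (Suc m) = 0 ^ (p ^ Suc m) + (\<Sum>i\<le>m. of_nat p ^ Suc i * x i ^ (p ^ (m - i)))"
    unfolding ghost_def by (subst sum.atMost_Suc_shift) simp
  also have "\<dots> = of_nat p * ghost p x m"
    using assms by (simp add: ghost_def sum_distrib_left mult_ac power_0_left)
  finally show ?thesis using Suc by simp
qed (simp add: ghost_def)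

text \<open>The Witt Frobenius shifts ghost components by one; taking \<open>p\<close>-th powers of
  all entries does so up to a multiple of \<open>p ^ Suc n\<close>, exactly the precision that
  \<open>ghost_cong_imp_cong\<close> asks for.\<close>

lemma ghost_power_p:
  fixes x :: "nat \<Rightarrow> 'r::comm_ring_1"
  shows "ghost p (\<lambda>i. x i ^ p) n = ghost p x (Suc n) - of_nat p ^ Suc n * x (Suc n)"
proof -
  have "ghost p (\<lambda>i. x i ^ p) n = (\<Sum>i\<le>n. of_nat p ^ i * x i ^ (p ^ (Suc n - i)))"
    unfolding ghost_def by (intro sum.cong) (auto simp: Suc_diff_le simp flip: power_mult)
  then show ?thesis by (simp add: ghost_def)
qed

lemma wV_cls_add:
  fixes x y :: "nat \<Rightarrow> 'v ipoly"
  assumes p: "prime p"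
  shows "wV cls x \<oplus>\<^bsub>WR p cls\<^esub> wV cls y = wV cls (x \<oplus>\<^bsub>WR p cls\<^esub> y)"
  using prime_gt_0_nat[OF p]
  by (intro ghost_inj[OF p]) (auto simp: ghost_WR[OF p] ghost_wV distrib_left split: nat.splits)

text \<open>The projection formula \<open>y * V x = V (F y * x)\<close>. It is only a congruence
  because the \<open>p\<close>-th powers of the entries replace the true Frobenius
  \<open>F y\<close>.\<close>

lemma wV_cls_mult_cong:
  fixes x y :: "nat \<Rightarrow> 'v ipoly"
  assumes p: "prime p"
  shows "of_nat p dvd (y \<otimes>\<^bsub>WR p cls\<^esub> wV cls x) n - wV cls ((\<lambda>i. y i ^ p) \<otimes>\<^bsub>WR p cls\<^esub> x) n"
proof (rule ghost_cong_imp_cong[OF p])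
  fix n
  show "of_nat p ^ Suc n dvd ghost p (y \<otimes>\<^bsub>WR p cls\<^esub> wV cls x) n - ghost p (wV cls ((\<lambda>i. y i ^ p) \<otimes>\<^bsub>WR p cls\<^esub> x)) n"
  proof (cases n)
    case (Suc m)
    have "ghost p (y \<otimes>\<^bsub>WR p cls\<^esub> wV cls x) n - ghost p (wV cls ((\<lambda>i. y i ^ p) \<otimes>\<^bsub>WR p cls\<^esub> x)) n
        = of_nat p ^ Suc n * (y n * ghost p x m)"
      using prime_gt_0_nat[OF p]
      by (simp add: ghost_WR[OF p] ghost_wV ghost_power_p Suc algebra_simps)
    then show ?thesis by simp
  qed (use prime_gt_0_nat[OF p] in \<open>simp add: ghost_WR[OF p] ghost_wV\<close>)
qed

lemma ghost_WR_add_pow: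
  assumes p: "prime p"
  shows "ghost p ([k] \<cdot>\<^bsub>WR p cls\<^esub> (x :: nat \<Rightarrow> 'v ipoly)) n = of_nat k * ghost p x n"
proof -
  interpret U: cring "WR p (cls :: 'v ipoly ring)" by (rule cring_WR_ipoly[OF p])
  show ?thesis
    by (induction k) (auto simp: ghost_WR[OF p] algebra_simps)
qed

text \<open>\<open>p = V F\<close>, again only modulo \<open>p\<close> for the same reason as in
  \<open>wV_cls_mult_cong\<close>.\<close>

lemma WR_cls_p_mult_cong:
  fixes x :: "nat \<Rightarrow> 'v ipoly"
  assumes p: "prime p"
  shows "of_nat p dvd ([p] \<cdot>\<^bsub>WR p cls\<^esub> x) n - wV cls (\<lambda>i. x i ^ p) n"
proof (rule ghost_cong_imp_cong[OF p])
  fix n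
  show "of_nat p ^ Suc n dvd ghost p ([p] \<cdot>\<^bsub>WR p cls\<^esub> x) n - ghost p (wV cls (\<lambda>i. x i ^ p)) n"
  proof (cases n)
    case (Suc m)
    have "ghost p ([p] \<cdot>\<^bsub>WR p cls\<^esub> x) n - ghost p (wV cls (\<lambda>i. x i ^ p)) n = of_nat p ^ Suc n * x n"
      using prime_gt_0_nat[OF p]
      by (simp add: ghost_WR_add_pow[OF p] ghost_wV ghost_power_p Suc algebra_simps)
    then show ?thesis by simp
  qed (use prime_gt_0_nat[OF p] in \<open>simp add: ghost_WR_add_pow[OF p] ghost_wV\<close>)
qed

lemma (in cring) wV_add:
  assumes p: "prime p" and "x \<in> carrier (WR p R)" "y \<in> carrier (WR p R)"
  shows "wV R x \<oplus>\<^bsub>WR p R\<^esub> wV R y = wV R (x \<oplus>\<^bsub>WR p R\<^esub> y)"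
proof -
  interpret pr: ring_hom_cring cls R "proj R" using proj_ring_hom is_cring by unfold_locales auto
  let ?h = "\<lambda>X (n::nat). proj R (X n)"
  define X Y where "X = (\<lambda>n. ivar (x n))" and "Y = (\<lambda>n. ivar (y n))"
  have h: "?h \<in> ring_hom (WR p cls) (WR p R)"
    by (rule WR_ring_hom) (auto intro: proj_ring_hom is_cring)
  have V: "?h (wV cls Z) = wV R (?h Z)" for Z
    using pr.hom_zero by (auto simp: fun_eq_iff wV_def split: nat.splits)
  have xy: "x = ?h X" "y = ?h Y" using assms proj_WR_surj unfolding X_def Y_def by blast+
  have add: "?h (Z \<oplus>\<^bsub>WR p cls\<^esub> Z') = ?h Z \<oplus>\<^bsub>WR p R\<^esub> ?h Z'" for Z Z'
    by (rule ring_hom_add[OF h]) (auto simp: WR_sel)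
  have "?h (wV cls X \<oplus>\<^bsub>WR p cls\<^esub> wV cls Y) = ?h (wV cls (X \<oplus>\<^bsub>WR p cls\<^esub> Y))"
    unfolding wV_cls_add[OF p] ..
  then show ?thesis unfolding add V xy by simp
qed

section \<open>Witt vectors over rings of characteristic p\<close>

locale charp_ring = cring R for R (structure) +
  fixes p :: nat
  assumes p: "prime p" and charp: "[p] \<cdot> \<one> = \<zero>"
begin

sublocale W: cring "WR p R" by (rule cring_WR[OF p])

lemma p_pos: "p > 0" and p_ge_2: "p \<ge> 2"
  using p prime_gt_0_nat prime_ge_2_nat by blast+

sublocale pr: ring_hom_cring cls R "proj R"
  using proj_ring_hom is_cring by unfold_locales auto

lemma proj_pow: "proj R (a ^ n) = proj R a [^] n"
proof (induction n)
  case 0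
  then show ?case using pr.hom_one by simp
next
  case (Suc n)
  then show ?case using pr.hom_mult[of a "a ^ n"] pr.hom_closed[of a] by (simp add: m_comm)
qed

lemma proj_of_nat: "proj R (of_nat n) = [n] \<cdot> \<one>"
proof (induction n)
  case 0
  then show ?case using pr.hom_zero by simp
next
  case (Suc n)
  then show ?case using pr.hom_add[of "of_nat n" 1] pr.hom_one by (simp add: a_comm add.commute)
qed

lemma proj_dvd: "of_nat p dvd u \<Longrightarrow> proj R u = \<zero>"
proof (elim dvdE)
  fix k assume "u = of_nat p * k"
  then show ?thesis using pr.hom_mult[of "of_nat p" k] pr.hom_closed[of k] by (simp add: proj_of_nat charp)
qed

text \<open>The passage from congruences of integer polynomials to equations in
  \<open>R\<close>.\<close>

lemma proj_cong: "of_nat p dvd u - v \<Longrightarrow> proj R u = proj R v"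
proof -
  assume "of_nat p dvd u - v"
  then have "proj R (u - v) = \<zero>" by (rule proj_dvd)
  moreover have "proj R ((u - v) + v) = proj R (u - v) \<oplus> proj R v"
    using pr.hom_add[of "u - v" v] by simp
  ultimately show ?thesis using pr.hom_closed[of v] by simp
qed

lemma frob_add: "x \<in> carrier R \<Longrightarrow> y \<in> carrier R \<Longrightarrow> (x \<oplus> y) [^] p = x [^] p \<oplus> y [^] p"
proof -
  assume xy: "x \<in> carrier R" "y \<in> carrier R"
  have "proj R ((ivar x + ivar y) ^ p) = proj R (ivar x ^ p + ivar y ^ p)"
    by (intro proj_cong prime_dvd_power_add p)
  then show ?thesis using xy pr.hom_add by (simp add: proj_pow proj_ivar)
qed

lemma frob_ring_hom: "(\<lambda>x. x [^] p) \<in> ring_hom R R"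
  by (auto simp: ring_hom_def frob_add nat_pow_distrib)

lemma frob_power_ring_hom: "(\<lambda>x. x [^] (p ^ k)) \<in> ring_hom R R"
proof (induction k)
  case 0
  then show ?case by (auto simp: ring_hom_def)
next
  case (Suc k)
  have "(\<lambda>x. (x [^] (p ^ k)) [^] p) \<in> ring_hom R R"
    using ring_hom_trans[OF Suc frob_ring_hom] by (simp add: comp_def)
  then show ?case
    by (rule ring_hom_restrict) (simp add: nat_pow_pow mult.commute)
qed

lemma mult_wV:
  assumes "x \<in> carrier (WR p R)" "y \<in> carrier (WR p R)"
  shows "y \<otimes>\<^bsub>WR p R\<^esub> wV R x = wV R ((\<lambda>i. y i [^] p) \<otimes>\<^bsub>WR p R\<^esub> x)"
proof -
  let ?h = "\<lambda>X (n::nat). proj R (X n)"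
  define X Y where "X = (\<lambda>n. ivar (x n))" and "Y = (\<lambda>n. ivar (y n))"
  have h: "?h \<in> ring_hom (WR p cls) (WR p R)"
    by (rule WR_ring_hom) (auto intro: proj_ring_hom is_cring)
  have V: "?h (wV cls Z) = wV R (?h Z)" for Z
    using pr.hom_zero by (auto simp: fun_eq_iff wV_def split: nat.splits)
  have xy: "x = ?h X" "y = ?h Y" using assms proj_WR_surj unfolding X_def Y_def by blast+
  have mult: "?h (Z \<otimes>\<^bsub>WR p cls\<^esub> Z') = ?h Z \<otimes>\<^bsub>WR p R\<^esub> ?h Z'" for Z Z'
    by (rule ring_hom_mult[OF h]) (auto simp: WR_sel)
  have "?h (Y \<otimes>\<^bsub>WR p cls\<^esub> wV cls X) = ?h (wV cls ((\<lambda>i. Y i ^ p) \<otimes>\<^bsub>WR p cls\<^esub> X))"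
    by (intro ext proj_cong wV_cls_mult_cong[OF p])
  then show ?thesis unfolding mult V xy by (simp add: proj_pow)
qed

lemma WR_p_mult:
  assumes "x \<in> carrier (WR p R)"
  shows "[p] \<cdot>\<^bsub>WR p R\<^esub> x = wV R (\<lambda>i. x i [^] p)"
proof -
  let ?h = "\<lambda>X (n::nat). proj R (X n)"
  define X where "X = (\<lambda>n. ivar (x n))"
  interpret U: cring "WR p (cls :: 'a ipoly ring)" by (rule cring_WR_ipoly[OF p])
  have h: "?h \<in> ring_hom (WR p cls) (WR p R)"
    by (rule WR_ring_hom) (auto intro: proj_ring_hom is_cring)
  interpret h: ring_hom_cring "WR p cls" "WR p R" ?h
    using h by unfold_locales auto
  have V: "?h (wV cls Z) = wV R (?h Z)" for Z
    using pr.hom_zero by (auto simp: fun_eq_iff wV_def split: nat.splits)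
  have x: "x = ?h X" using assms proj_WR_surj unfolding X_def by blast
  have mult: "?h ([k] \<cdot>\<^bsub>WR p cls\<^esub> X) = [k] \<cdot>\<^bsub>WR p R\<^esub> ?h X" for k :: nat
  proof (induction k)
    case 0
    show ?case using h.hom_zero by simp
  next
    case (Suc k)
    have "X \<in> carrier (WR p cls)" by (simp add: WR_sel)
    then show ?case using Suc h.hom_add[of "[k] \<cdot>\<^bsub>WR p cls\<^esub> X" X] by simp
  qed
  have "?h ([p] \<cdot>\<^bsub>WR p cls\<^esub> X) = ?h (wV cls (\<lambda>i. X i ^ p))"
    by (intro ext proj_cong WR_cls_p_mult_cong[OF p])
  then show ?thesis unfolding mult V x by (simp add: proj_pow)
qed

end

subsection \<open>Nilpotent elements\<close>

definition nilset :: "('a, 'b) ring_scheme \<Rightarrow> 'a set" where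
  "nilset R = {x \<in> carrier R. \<exists>n::nat. x [^]\<^bsub>R\<^esub> n = \<zero>\<^bsub>R\<^esub>}"

lemma (in cring) nat_pow_eq_zero_mono:
  "x \<in> carrier R \<Longrightarrow> x [^] (n::nat) = \<zero> \<Longrightarrow> n \<le> m \<Longrightarrow> x [^] m = \<zero>"
  using nat_pow_mult[of x n "m - n"] by simp

lemma nilset_hom:
  assumes "cring R" "cring S" "h \<in> ring_hom R S" "x \<in> nilset R"
  shows "h x \<in> nilset S"
proof -
  interpret ring_hom_cring R S h
    using assms by (simp add: ring_hom_cring_def ring_hom_cring_axioms_def)
  from assms(4) obtain n :: nat where x: "x \<in> carrier R" "x [^]\<^bsub>R\<^esub> n = \<zero>\<^bsub>R\<^esub>"
    by (auto simp: nilset_def)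
  have "h x [^]\<^bsub>S\<^esub> k = h (x [^]\<^bsub>R\<^esub> k)" for k :: nat
    using x(1) by (induction k) auto
  from this[of n] have "h x [^]\<^bsub>S\<^esub> n = \<zero>\<^bsub>S\<^esub>" using x by simp
  then show ?thesis using x by (auto simp: nilset_def)
qed

lemma (in charp_ring) ideal_nilset: "ideal (nilset R) R"
proof -
  have l: "y \<otimes> x \<in> nilset R" if "x \<in> nilset R" "y \<in> carrier R" for x y
  proof -
    from that obtain n :: nat where n: "x \<in> carrier R" "x [^] n = \<zero>" by (auto simp: nilset_def)
    have "(y \<otimes> x) [^] n = \<zero>" using n that by (simp add: nat_pow_distrib)
    then show ?thesis using n that by (auto simp: nilset_def)
  qed
  have a: "x \<oplus> y \<in> nilset R" if xy: "x \<in> nilset R" "y \<in> nilset R" for x y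
  proof -
    from xy obtain n m :: nat where n: "x \<in> carrier R" "x [^] n = \<zero>" and m: "y \<in> carrier R" "y [^] m = \<zero>"
      by (auto simp: nilset_def)
    \<comment> \<open>Any power of \<open>p\<close> that exceeds both exponents will do: raising to
      it is additive, so no binomial expansion is needed.\<close>
    have "n + m < 2 ^ (n + m)" by (rule less_exp)
    also have "\<dots> \<le> p ^ (n + m)" by (intro power_mono p_ge_2) simp
    finally have le: "n \<le> p ^ (n + m)" "m \<le> p ^ (n + m)" by simp_all
    have "(x \<oplus> y) [^] (p ^ (n + m)) = x [^] (p ^ (n + m)) \<oplus> y [^] (p ^ (n + m))"
      by (rule ring_hom_add[OF frob_power_ring_hom n(1) m(1)])
    also have "\<dots> = \<zero>"
      using nat_pow_eq_zero_mono[OF n le(1)] nat_pow_eq_zero_mono[OF m le(2)] by simp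
    finally show ?thesis using n m unfolding nilset_def by blast
  qed
  have c: "nilset R \<subseteq> carrier R" by (auto simp: nilset_def)
  show ?thesis
  proof (rule idealI)
    show "ring R" by (rule ring_axioms)
    show "subgroup (nilset R) (add_monoid R)"
    proof (rule add.subgroupI)
      show "nilset R \<subseteq> carrier R" by (rule c)
      have "\<zero> [^] (1::nat) = \<zero>" by simp
      then show "nilset R \<noteq> {}" unfolding nilset_def using zero_closed by blast
      fix x assume x: "x \<in> nilset R"
      have "(\<ominus> \<one>) \<otimes> x = \<ominus> x" using x c by (subst l_minus) auto
      then show "\<ominus> x \<in> nilset R" using l[OF x, of "\<ominus> \<one>"] by simp
    qed (rule a)
    fix x y assume "x \<in> nilset R" "y \<in> carrier R"
    then show "y \<otimes> x \<in> nilset R" "x \<otimes> y \<in> nilset R"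
      using l c by (auto simp: m_comm[of x y] subset_iff)
  qed
qed

section \<open>Powers of ideals\<close>

context cring
begin

lemma ideal_ideal_pow: "ideal I R \<Longrightarrow> ideal (ideal_pow R I k) R"
  by (induction k) (auto intro: oneideal ideal_prod_is_ideal)

lemma ideal_pow_Suc_mem: "x \<in> I \<Longrightarrow> y \<in> ideal_pow R I k \<Longrightarrow> x \<otimes> y \<in> ideal_pow R I (Suc k)"
  by (auto intro: ideal_prod.prod)

lemma ideal_pow_pow_mem:
  assumes I: "ideal I R" and "x \<in> I" "y \<in> ideal_pow R I k"
  shows "x [^] (e::nat) \<otimes> y \<in> ideal_pow R I (e + k)"
proof (induction e)
  case 0
  then show ?case using assms ideal.Icarr[OF ideal_ideal_pow[OF I]] by auto
next
  case (Suc e)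
  have "x \<in> carrier R" "y \<in> carrier R"
    using assms ideal.Icarr[OF ideal_ideal_pow[OF I]] ideal.Icarr[OF I] by auto
  then have "x [^] Suc e \<otimes> y = x \<otimes> (x [^] e \<otimes> y)" by (simp add: m_ac)
  then show ?case using ideal_pow_Suc_mem[OF assms(2) Suc] by simp
qed

lemma ideal_pow_finprod_mem:
  assumes I: "ideal I R" and "finite D" "\<And>v. v \<in> D \<Longrightarrow> f v \<in> I"
  shows "(\<Otimes>v\<in>D. f v [^] (e v :: nat)) \<in> ideal_pow R I (sum e D)"
  using assms(2,3)
proof (induction D rule: finite_induct)
  case (insert v D)
  have c: "f u \<in> carrier R" if "u \<in> insert v D" for u
    using insert.prems[OF that] ideal.Icarr[OF I] by blast
  have "(\<Otimes>v\<in>insert v D. f v [^] e v) = f v [^] e v \<otimes> (\<Otimes>v\<in>D. f v [^] e v)"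
    using insert.hyps c by (intro finprod_insert) auto
  then show ?case using ideal_pow_pow_mem[OF I, of "f v"] insert by simp
qed simp

lemma ideal_pow_mono:
  assumes I: "ideal I R" and "j \<le> k"
  shows "ideal_pow R I k \<subseteq> ideal_pow R I j"
  using assms(2)
proof (induction k rule: dec_induct)
  case (step k)
  have "ideal_pow R I (Suc k) \<subseteq> ideal_pow R I k"
    using ideal_prod_inter[OF I ideal_ideal_pow[OF I]] by auto
  then show ?case using step by blast
qed simp

end

section \<open>Vanishing of monomials in nilpotent elements\<close>

locale nilp_ring = charp_ring +
  fixes s :: nat
  assumes nilp: "ideal_pow R (nilset R) s = {\<zero>}"
begin

lemma nilset_finprod_zero:
  assumes "finite D" "\<And>v. v \<in> D \<Longrightarrow> f v \<in> nilset R" "s \<le> sum e D"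
  shows "(\<Otimes>v\<in>D. f v [^] (e v :: nat)) = \<zero>"
  using ideal_pow_finprod_mem[OF ideal_nilset assms(1), of f e] assms(2)
    ideal_pow_mono[OF ideal_nilset assms(3)] nilp by blast

end

text \<open>\<open>T\<close> is the set of variables that carry weight: all of them for addition,
  those of the second factor for multiplication. One vanishing argument then serves both
  operations.\<close>

locale pweight =
  fixes p :: nat and T :: "'v set" and i :: "'v \<Rightarrow> nat" and w :: "'v \<Rightarrow> nat"
  assumes w: "\<And>v. w v = (if v \<in> T then p ^ i v else 0)" and p2: "p \<ge> 2"
begin

lemma idx_le:
  assumes "monom_weight w m = p ^ n" "v \<in> Poly_Mapping.keys m" "v \<in> T"
  shows "i v \<le> n"
proof -
  have "1 * p ^ i v \<le> Poly_Mapping.lookup m v * w v"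
    unfolding w using assms by (intro mult_mono) (auto simp: in_keys_iff)
  also have "\<dots> \<le> monom_weight w m"
    unfolding monom_weight_def by (intro member_le_sum assms) auto
  finally show ?thesis using assms p2 by (simp add: power_increasing_iff)
qed

lemma ex_idx:
  assumes "monom_weight w m = p ^ n"
  shows "\<exists>v\<in>Poly_Mapping.keys m. v \<in> T"
proof (rule ccontr)
  assume "\<not> ?thesis"
  then have "monom_weight w m = 0" unfolding monom_weight_def w by (intro sum.neutral) auto
  then show False using assms p2 by simp
qed

text \<open>If \<open>E l\<close> is the degree of \<open>m\<close> in the weighted variables of
  index \<open>l\<close>, the weight condition reads
  \<open>(\<Sum>l\<le>n. E l * p ^ l) = p ^ n\<close>, and the bound on digit sums applies.\<close>

lemma degree_lower_bound:
  assumes m: "monom_weight w m = p ^ n" and v: "v \<in> Poly_Mapping.keys m" "v \<in> T" and j: "i v \<le> j" "j < n"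
  shows "j - i v + 2 \<le> (\<Sum>u\<in>{u \<in> Poly_Mapping.keys m. u \<in> T \<and> i u \<le> j}. Poly_Mapping.lookup m u)"
proof -
  let ?S = "{u \<in> Poly_Mapping.keys m. u \<in> T}"
  define E where "E l = (\<Sum>u\<in>{u \<in> ?S. i u = l}. Poly_Mapping.lookup m u)" for l
  have "(\<Sum>l\<le>n. E l * p ^ l) = (\<Sum>l\<le>n. \<Sum>u\<in>{u \<in> ?S. i u = l}. Poly_Mapping.lookup m u * w u)"
    unfolding E_def sum_distrib_right by (intro sum.cong refl) (auto simp: w)
  also have "\<dots> = (\<Sum>u\<in>?S. Poly_Mapping.lookup m u * w u)"
    by (rule sum.group) (use idx_le[OF m] in auto)
  also have "\<dots> = monom_weight w m"
    unfolding monom_weight_def by (intro sum.mono_neutral_left) (auto simp: w)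
  finally have E: "(\<Sum>l\<le>n. E l * p ^ l) = p ^ n" using m by simp
  have "0 < Poly_Mapping.lookup m v" using v by (simp add: in_keys_iff)
  also have "\<dots> \<le> E (i v)" unfolding E_def using v by (intro member_le_sum) auto
  finally have "j - i v + 2 \<le> (\<Sum>l\<le>j. E l)"
    by (intro digit_sum_lower_bound[OF p2 E] j)
  also have "\<dots> = (\<Sum>l\<le>j. \<Sum>u\<in>{u \<in> {u \<in> Poly_Mapping.keys m. u \<in> T \<and> i u \<le> j}. i u = l}. Poly_Mapping.lookup m u)"
    unfolding E_def by (intro sum.cong refl) auto
  also have "\<dots> = (\<Sum>u\<in>{u \<in> Poly_Mapping.keys m. u \<in> T \<and> i u \<le> j}. Poly_Mapping.lookup m u)"
    by (rule sum.group) auto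
  finally show ?thesis .
qed

end

text \<open>
  A monomial involving a variable of low index has high degree in the variables of index at most
  \<open>n - r\<close>, so it vanishes when these are nilpotent.
\<close>

lemma (in nilp_ring) peval_indep:
  assumes w: "pweight p T i w"
    and fg: "\<And>v. f v \<in> carrier R" "\<And>v. g v \<in> carrier R"
    and P: "isobaric w (p ^ n) P"
    and agree: "\<And>v. v \<notin> T \<or> t \<le> i v \<and> i v \<le> n \<Longrightarrow> f v = g v"
    and nil: "\<And>v. v \<in> T \<Longrightarrow> i v + r \<le> n \<Longrightarrow> f v \<in> nilset R \<and> g v \<in> nilset R"
    and n: "t + r + s \<le> n"
  shows "peval R f P = peval R g P"
proof -
  interpret pweight p T i w by fact
  have "pmon R f m = pmon R g m" if m: "m \<in> Poly_Mapping.keys P" for m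
  proof -
    have wt: "monom_weight w m = p ^ n" using P m by (simp add: isobaric_def)
    show ?thesis
    proof (cases "\<exists>v\<in>Poly_Mapping.keys m. v \<in> T \<and> i v < t")
      case False
      then show ?thesis
        unfolding pmon_def using idx_le[OF wt] fg
        by (intro finprod_cong') (auto simp: agree not_less)
    next
      case True
      then obtain v where v: "v \<in> Poly_Mapping.keys m" "v \<in> T" "i v < t" by blast
      \<comment> \<open>All weighted variables of index up to \<open>j\<close> are nilpotent, and
        \<open>s \<le> j - i v\<close> since \<open>i v < t\<close> and
        \<open>t + r + s \<le> n\<close>. Subtracting 1 keeps \<open>j < n\<close> when
        \<open>r = 0\<close>.\<close>
      define j where "j = n - r - 1"
      have j: "i v \<le> j" "j < n" "j + r \<le> n" "s \<le> j - i v" using v n by (auto simp: j_def)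
      define D where "D = {u \<in> Poly_Mapping.keys m. u \<in> T \<and> i u \<le> j}"
      have s: "s \<le> (\<Sum>u\<in>D. Poly_Mapping.lookup m u)"
        using degree_lower_bound[OF wt v(1,2) j(1,2)] j unfolding D_def by linarith
      have z: "pmon R h m = \<zero>" if h: "\<And>v. h v \<in> carrier R" "\<And>v. v \<in> D \<Longrightarrow> h v \<in> nilset R" for h
      proof -
        have "Poly_Mapping.keys m = D \<union> (Poly_Mapping.keys m - D)" by (auto simp: D_def)
        then have "pmon R h m = (\<Otimes>v\<in>D \<union> (Poly_Mapping.keys m - D). h v [^] Poly_Mapping.lookup m v)"
          unfolding pmon_def by simp
        also have "\<dots> = (\<Otimes>v\<in>D. h v [^] Poly_Mapping.lookup m v) \<otimes> (\<Otimes>v\<in>Poly_Mapping.keys m - D. h v [^] Poly_Mapping.lookup m v)"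
          by (intro finprod_Un_disjoint) (auto simp: D_def h)
        also have "(\<Otimes>v\<in>D. h v [^] Poly_Mapping.lookup m v) = \<zero>"
          by (intro nilset_finprod_zero h s) (auto simp: D_def)
        finally show ?thesis using h by (simp add: finprod_closed)
      qed
      have "f v \<in> nilset R \<and> g v \<in> nilset R" if "v \<in> D" for v
        using that j by (intro nil) (auto simp: D_def)
      then show ?thesis using z fg by metis
    qed
  qed
  then show ?thesis unfolding peval_def using fg by (intro finsum_cong') auto
qed

text \<open>A monomial of positive weight contains a weighted variable, hence a factor from the
  ideal of nilpotent elements.\<close>

lemma (in charp_ring) peval_nil:
  assumes w: "pweight p T i w" and f: "\<And>v. f v \<in> carrier R"
    and P: "isobaric w (p ^ n) P" and nil: "\<And>v. v \<in> T \<Longrightarrow> i v \<le> n \<Longrightarrow> f v \<in> nilset R"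
  shows "peval R f P \<in> nilset R"
proof -
  interpret pweight p T i w by fact
  interpret N: ideal "nilset R" R by (rule ideal_nilset)
  have mon: "pmon R f m \<in> nilset R" if m: "m \<in> Poly_Mapping.keys P" for m
  proof -
    have wt: "monom_weight w m = p ^ n" using P m by (simp add: isobaric_def)
    then obtain v where v: "v \<in> Poly_Mapping.keys m" "v \<in> T" using ex_idx by blast
    have "Poly_Mapping.keys m = insert v (Poly_Mapping.keys m - {v})" using v by auto
    then have "pmon R f m = (\<Otimes>u\<in>insert v (Poly_Mapping.keys m - {v}). f u [^] Poly_Mapping.lookup m u)"
      by (simp add: pmon_def)
    also have "\<dots> = f v [^] Poly_Mapping.lookup m v \<otimes> (\<Otimes>u\<in>Poly_Mapping.keys m - {v}. f u [^] Poly_Mapping.lookup m u)"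
      by (intro finprod_insert) (auto simp: f)
    finally have eq: "pmon R f m = f v [^] Poly_Mapping.lookup m v \<otimes> (\<Otimes>u\<in>Poly_Mapping.keys m - {v}. f u [^] Poly_Mapping.lookup m u)" .
    obtain k where "Poly_Mapping.lookup m v = Suc k" using v by (cases "Poly_Mapping.lookup m v") (auto simp: in_keys_iff)
    then have "f v [^] Poly_Mapping.lookup m v \<in> nilset R"
      using nil[OF v(2) idx_le[OF wt v]] f by (auto intro: N.I_l_closed)
    then show ?thesis unfolding eq by (intro N.I_r_closed finprod_closed) (auto simp: f)
  qed
  have "[c] \<cdot> x \<in> nilset R" if "x \<in> nilset R" for c :: int and x
  proof -
    have x: "x \<in> carrier R" using that N.Icarr by blast
    have "[c] \<cdot> x = ([c] \<cdot> \<one>) \<otimes> x" using x by (subst add_pow_ldistr_int) auto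
    then show ?thesis using that by (simp add: N.I_l_closed)
  qed
  then have t: "[Poly_Mapping.lookup P m] \<cdot> pmon R f m \<in> nilset R" if "m \<in> Poly_Mapping.keys P" for m
    using mon that by blast
  have "(\<Oplus>m\<in>A. [Poly_Mapping.lookup P m] \<cdot> pmon R f m) \<in> nilset R" if "finite A" "A \<subseteq> Poly_Mapping.keys P" for A
    using that
  proof (induction A)
    case (insert m A)
    then show ?case using t f by (subst finsum_insert) (auto intro: N.a_closed)
  qed (simp add: N.zero_closed)
  from this[OF finite_keys order_refl] show ?thesis unfolding peval_def .
qed

context
  fixes p :: nat
  assumes p: "prime p"
begin

lemma pweight_add: "pweight p UNIV (case_sum id id) (add_wt p)"
  using prime_ge_2_nat[OF p] by unfold_locales (auto simp: add_wt_def split: sum.splits)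

lemma pweight_mult: "pweight p (range Inr) (case_sum id id) (mult_wt p)"
  using prime_ge_2_nat[OF p] by unfold_locales (auto simp: mult_wt_def split: sum.splits)

end

text \<open>The first \<open>t\<close> entries may differ and the last \<open>r\<close> need not be
  nilpotent; \<open>s\<close> is the exponent that kills the nilradical. This is why the limits in
  \<open>CW\<close> exist.\<close>

lemma (in nilp_ring) WR_add_indep:
  assumes c: "x \<in> carrier (WR p R)" "x' \<in> carrier (WR p R)" "y \<in> carrier (WR p R)" "y' \<in> carrier (WR p R)"
    and agree: "\<And>i. t \<le> i \<Longrightarrow> i \<le> n \<Longrightarrow> x i = x' i \<and> y i = y' i"
    and nil: "\<And>i. i + r \<le> n \<Longrightarrow> x i \<in> nilset R \<and> x' i \<in> nilset R \<and> y i \<in> nilset R \<and> y' i \<in> nilset R"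
    and n: "t + r + s \<le> n"
  shows "(x \<oplus>\<^bsub>WR p R\<^esub> y) n = (x' \<oplus>\<^bsub>WR p R\<^esub> y') n"
  unfolding WR_sel xy_eval_peval
  by (rule peval_indep[OF pweight_add[OF p] _ _ isobaric_witt_add_poly[OF p] _ _ n])
    (use c agree nil in \<open>auto simp: WR_sel split: sum.splits\<close>)

text \<open>The scalar \<open>x\<close> is the same on both sides; its variables have weight 0, so
  its entries may be arbitrary.\<close>

lemma (in nilp_ring) WR_mult_indep:
  assumes c: "x \<in> carrier (WR p R)" "y \<in> carrier (WR p R)" "y' \<in> carrier (WR p R)"
    and agree: "\<And>i. t \<le> i \<Longrightarrow> i \<le> n \<Longrightarrow> y i = y' i"
    and nil: "\<And>i. i + r \<le> n \<Longrightarrow> y i \<in> nilset R \<and> y' i \<in> nilset R"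
    and n: "t + r + s \<le> n"
  shows "(x \<otimes>\<^bsub>WR p R\<^esub> y) n = (x \<otimes>\<^bsub>WR p R\<^esub> y') n"
  unfolding WR_sel xy_eval_peval
  by (rule peval_indep[OF pweight_mult[OF p] _ _ isobaric_witt_mult_poly[OF p] _ _ n])
    (use c agree nil in \<open>auto simp: WR_sel split: sum.splits\<close>)

lemma (in charp_ring) WR_add_nil:
  assumes c: "x \<in> carrier (WR p R)" "y \<in> carrier (WR p R)"
    and nil: "\<And>i. i \<le> n \<Longrightarrow> x i \<in> nilset R \<and> y i \<in> nilset R"
  shows "(x \<oplus>\<^bsub>WR p R\<^esub> y) n \<in> nilset R"
  unfolding WR_sel xy_eval_peval
  by (rule peval_nil[OF pweight_add[OF p] _ isobaric_witt_add_poly[OF p]])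
    (use c nil in \<open>auto simp: WR_sel split: sum.splits\<close>)

lemma (in charp_ring) WR_mult_nil:
  assumes c: "x \<in> carrier (WR p R)" "y \<in> carrier (WR p R)"
    and nil: "\<And>i. i \<le> n \<Longrightarrow> y i \<in> nilset R"
  shows "(x \<otimes>\<^bsub>WR p R\<^esub> y) n \<in> nilset R"
  unfolding WR_sel xy_eval_peval
  by (rule peval_nil[OF pweight_mult[OF p] _ isobaric_witt_mult_poly[OF p]])
    (use c nil in \<open>auto simp: WR_sel split: sum.splits\<close>)

section \<open>Witt covectors\<close>

locale perf_field =
  fixes p :: nat and K :: "'k ring"
  assumes perf: "perfect_field_char p K"
begin

sublocale K: field K
  using perf by (simp add: perfect_field_char_def)

sublocale K: charp_ring K p
  using perf by unfold_locales (auto simp: perfect_field_char_def)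

text \<open>Powers of Frobenius are additive, and a field has no nonzero nilpotent elements.\<close>

lemma frob_power_inj:
  assumes "c \<in> carrier K" "d \<in> carrier K" "c [^]\<^bsub>K\<^esub> (p ^ n) = d [^]\<^bsub>K\<^esub> (p ^ n)"
  shows "c = d"
proof -
  let ?h = "\<lambda>x. x [^]\<^bsub>K\<^esub> (p ^ n)"
  interpret h: ring_hom_cring K K ?h
    using K.frob_power_ring_hom by unfold_locales auto
  have z: "x = \<zero>\<^bsub>K\<^esub>" if "x \<in> carrier K" "x [^]\<^bsub>K\<^esub> (m::nat) = \<zero>\<^bsub>K\<^esub>" for x m
    using that by (induction m) (auto simp: K.integral_iff)
  have "?h (c \<ominus>\<^bsub>K\<^esub> d) = ?h c \<ominus>\<^bsub>K\<^esub> ?h d"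
    unfolding a_minus_def using assms h.hom_add h.hom_a_inv by simp
  also have "\<dots> = \<zero>\<^bsub>K\<^esub>" using assms by (simp add: K.r_neg a_minus_def)
  finally have "(c \<ominus>\<^bsub>K\<^esub> d) [^]\<^bsub>K\<^esub> (p ^ n) = \<zero>\<^bsub>K\<^esub>" .
  then have "c \<ominus>\<^bsub>K\<^esub> d = \<zero>\<^bsub>K\<^esub>" by (rule z[OF K.minus_closed[OF assms(1,2)]])
  then show ?thesis using assms(1,2) by (metis a_minus_def K.add.inv_closed K.minus_equality K.minus_minus K.l_neg)
qed

lemma ex_root:
  "c \<in> carrier K \<Longrightarrow> \<exists>d\<in>carrier K. d [^]\<^bsub>K\<^esub> (p ^ n) = c"
proof (induction n arbitrary: c)
  case 0
  then show ?case by auto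
next
  case (Suc n)
  obtain d where d: "d \<in> carrier K" "d [^]\<^bsub>K\<^esub> p = c"
    using perf Suc.prems unfolding perfect_field_char_def by blast
  obtain e where "e \<in> carrier K" "e [^]\<^bsub>K\<^esub> (p ^ n) = d" using Suc.IH[OF d(1)] by blast
  then show ?case using d by (intro bexI[of _ e]) (auto simp: K.nat_pow_pow mult.commute)
qed

definition root :: "nat \<Rightarrow> 'k \<Rightarrow> 'k" where
  "root n c = field_root K (p ^ n) c"

lemma root_eqI:
  assumes "d \<in> carrier K" "d [^]\<^bsub>K\<^esub> (p ^ n) = c"
  shows "root n c = d"
  unfolding root_def field_root_def
  using assms frob_power_inj by (intro the_equality) auto

lemma root_closed [simp]: "c \<in> carrier K \<Longrightarrow> root n c \<in> carrier K"
  and root_pow: "c \<in> carrier K \<Longrightarrow> root n c [^]\<^bsub>K\<^esub> (p ^ n) = c"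
  using ex_root[of c n] root_eqI by auto

lemma root_ring_hom: "root n \<in> ring_hom K K"
proof (rule ring_hom_memI)
  fix x y assume xy: "x \<in> carrier K" "y \<in> carrier K"
  show "root n (x \<otimes>\<^bsub>K\<^esub> y) = root n x \<otimes>\<^bsub>K\<^esub> root n y"
    using xy by (intro root_eqI) (auto simp: K.nat_pow_distrib root_pow)
  have "(root n x \<oplus>\<^bsub>K\<^esub> root n y) [^]\<^bsub>K\<^esub> (p ^ n) = x \<oplus>\<^bsub>K\<^esub> y"
    using ring_hom_add[OF K.frob_power_ring_hom[of n], of "root n x" "root n y"] xy by (simp add: root_pow)
  then show "root n (x \<oplus>\<^bsub>K\<^esub> y) = root n x \<oplus>\<^bsub>K\<^esub> root n y"
    using xy by (intro root_eqI) auto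
qed (auto intro!: root_eqI)

lemma root_Suc_pow:
  assumes c: "c \<in> carrier K" shows "root (Suc n) c [^]\<^bsub>K\<^esub> p = root n c"
  using root_pow[OF c, of "Suc n"] c
  by (intro root_eqI[symmetric]) (auto simp: K.nat_pow_pow mult.commute)

lemma root_Suc_frob:
  assumes c: "c \<in> carrier K" shows "root (Suc n) (c [^]\<^bsub>K\<^esub> p) = root n c"
proof (rule root_eqI)
  have "root n c [^]\<^bsub>K\<^esub> (p ^ Suc n) = (root n c [^]\<^bsub>K\<^esub> (p ^ n)) [^]\<^bsub>K\<^esub> p"
    using c by (simp add: K.nat_pow_pow mult.commute)
  then show "root n c [^]\<^bsub>K\<^esub> (p ^ Suc n) = c [^]\<^bsub>K\<^esub> p"
    using c by (simp only: root_pow)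
qed (use c in auto)

lemma root_frob:
  assumes c: "c \<in> carrier K" shows "root n (c [^]\<^bsub>K\<^esub> p) = root n c [^]\<^bsub>K\<^esub> p"
proof (rule root_eqI)
  have "(root n c [^]\<^bsub>K\<^esub> p) [^]\<^bsub>K\<^esub> (p ^ n) = (root n c [^]\<^bsub>K\<^esub> (p ^ n)) [^]\<^bsub>K\<^esub> p"
    using c by (simp add: K.nat_pow_pow mult.commute)
  then show "(root n c [^]\<^bsub>K\<^esub> p) [^]\<^bsub>K\<^esub> (p ^ n) = c [^]\<^bsub>K\<^esub> p"
    using c by (simp add: root_pow)
qed (use c in auto)

end

lemma eventual_value_eqI: 
  assumes "\<And>m. N \<le> m \<Longrightarrow> f m = c"
  shows "eventual_value f = c"
  unfolding eventual_value_def
proof (rule the_equality)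
  show ev: "\<forall>\<^sub>F m in sequentially. f m = c"
    using assms by (auto simp: eventually_sequentially)
  fix c' assume "\<forall>\<^sub>F m in sequentially. f m = c'"
  with ev have "\<forall>\<^sub>F m in sequentially. c' = c"
    by eventually_elim simp
  then show "c' = c" by simp
qed

lemma eventual_value_const:
  assumes "\<And>m. N \<le> m \<Longrightarrow> f (Suc m) = f m" "N \<le> n"
  shows "eventual_value f = f n"
proof (rule eventual_value_eqI)
  fix m assume "n \<le> m"
  then show "f m = f n" by (induction m rule: dec_induct) (use assms in auto)
qed

lemma ideal_pow_subset:
  assumes "I \<subseteq> J" shows "ideal_pow R I k \<subseteq> ideal_pow R J k"
proof (induction k)
  case (Suc k)
  show ?case
  proof
    fix x assume "x \<in> ideal_pow R I (Suc k)"
    then have "x \<in> ideal_prod R I (ideal_pow R I k)" by simp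
    then have "x \<in> ideal_prod R J (ideal_pow R J k)"
      using assms Suc by induction (auto intro: ideal_prod.intros)
    then show "x \<in> ideal_pow R J (Suc k)" by simp
  qed
qed simp

section \<open>Covectors of an algebra with nilpotent nilradical\<close>

locale charp_alg = perf_field p K for p :: nat and K :: "'k ring" +
  fixes A :: "('k, 'a) module"
  assumes alg: "algebra K A"
begin

sublocale A: algebra K A by (rule alg)

definition iota :: "'k \<Rightarrow> 'a" where
  "iota c = c \<odot>\<^bsub>A\<^esub> \<one>\<^bsub>A\<^esub>"

lemma iota_ring_hom: "iota \<in> ring_hom K A"
proof (rule ring_hom_memI)
  fix x y assume xy: "x \<in> carrier K" "y \<in> carrier K"
  have "(x \<odot>\<^bsub>A\<^esub> \<one>\<^bsub>A\<^esub>) \<otimes>\<^bsub>A\<^esub> (y \<odot>\<^bsub>A\<^esub> \<one>\<^bsub>A\<^esub>) = x \<odot>\<^bsub>A\<^esub> (\<one>\<^bsub>A\<^esub> \<otimes>\<^bsub>A\<^esub> (y \<odot>\<^bsub>A\<^esub> \<one>\<^bsub>A\<^esub>))"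
    using xy by (intro A.smult_assoc2) auto
  then show "iota (x \<otimes>\<^bsub>K\<^esub> y) = iota x \<otimes>\<^bsub>A\<^esub> iota y"
    using xy by (simp add: iota_def A.smult_assoc1)
qed (auto simp: iota_def A.smult_l_distr)

sublocale io: ring_hom_cring K A iota
  using iota_ring_hom by unfold_locales auto

sublocale A: charp_ring A p
proof unfold_locales
  have "iota ([n] \<cdot>\<^bsub>K\<^esub> \<one>\<^bsub>K\<^esub>) = [n] \<cdot>\<^bsub>A\<^esub> \<one>\<^bsub>A\<^esub>" for n :: nat
    by (induction n) auto
  from this[of p] show "[p] \<cdot>\<^bsub>A\<^esub> \<one>\<^bsub>A\<^esub> = \<zero>\<^bsub>A\<^esub>" by (simp add: K.charp)
qed (rule K.p)

end

text \<open>The exponent \<open>s\<close> is a parameter here; \<open>nilset_nilpotent\<close>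
  supplies one for every finite-dimensional algebra.\<close>

locale cw_alg = charp_alg p K A for p :: nat and K :: "'k ring" and A :: "('k, 'a) module" +
  fixes s :: nat
  assumes nil: "ideal_pow A (nilset A) s = {\<zero>\<^bsub>A\<^esub>}"
begin

sublocale A: nilp_ring A p s
  by unfold_locales (rule nil)

abbreviation N where "N \<equiv> nilset A"
abbreviation W where "W \<equiv> WR p A"
abbreviation C where "C \<equiv> CW p K A"

sublocale N: ideal "nilset A" A by (rule A.ideal_nilset)

text \<open>The whole nilradical is a nilpotent ideal, so an ideal is nilpotent as soon as its
  generators are nilpotent elements.\<close>

lemma CW_carrier: "a \<in> carrier C \<longleftrightarrow> (\<forall>n. a n \<in> carrier A) \<and> (\<exists>r. \<forall>n\<ge>r. a n \<in> N)"
proof (cases "\<forall>n. a n \<in> carrier A")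
  case True
  then have sub: "a ` {r..} \<subseteq> carrier A" for r by auto
  have "(\<exists>s. ideal_pow A (genideal A (a ` {r..})) s = {\<zero>\<^bsub>A\<^esub>}) \<longleftrightarrow> (\<forall>n\<ge>r. a n \<in> N)" for r
  proof
    assume "\<exists>s. ideal_pow A (genideal A (a ` {r..})) s = {\<zero>\<^bsub>A\<^esub>}"
    then obtain s where s: "ideal_pow A (genideal A (a ` {r..})) s = {\<zero>\<^bsub>A\<^esub>}" by blast
    show "\<forall>n\<ge>r. a n \<in> N"
    proof (intro allI impI)
      fix n assume "r \<le> n"
      then have "a n \<in> genideal A (a ` {r..})" using A.genideal_self[OF sub] by auto
      \<comment> \<open>The \<open>s\<close>-th power of an element of an ideal lies in the
        \<open>s\<close>-th power of the ideal, which is zero.\<close>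
      from A.ideal_pow_pow_mem[OF A.genideal_ideal[OF sub] this, of "\<one>\<^bsub>A\<^esub>" 0 s]
      have "a n [^]\<^bsub>A\<^esub> s = \<zero>\<^bsub>A\<^esub>" using True s by simp
      then show "a n \<in> N" using True unfolding nilset_def by blast
    qed
  next
    assume "\<forall>n\<ge>r. a n \<in> N"
    then have "genideal A (a ` {r..}) \<subseteq> N"
      by (intro A.genideal_minimal A.ideal_nilset) auto
    then have "ideal_pow A (genideal A (a ` {r..})) s \<subseteq> {\<zero>\<^bsub>A\<^esub>}"
      using ideal_pow_subset nil by blast
    moreover have "\<zero>\<^bsub>A\<^esub> \<in> ideal_pow A (genideal A (a ` {r..})) s"
      using A.ideal_ideal_pow[OF A.genideal_ideal[OF sub]]
      by (simp add: additive_subgroup.zero_closed ideal.axioms(1))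
    ultimately show "\<exists>s. ideal_pow A (genideal A (a ` {r..})) s = {\<zero>\<^bsub>A\<^esub>}" by blast
  qed
  then show ?thesis using True by (simp add: CW_def)
qed (auto simp: CW_def)

text \<open>
  \<open>X M\<close> agrees, apart from its first few entries, which are nilpotent, with the Witt vector
  \<open>(a\<^sub>-\<^sub>M, \<dots>, a\<^sub>0)\<close>.
\<close>

definition repw :: "nat \<Rightarrow> nat \<Rightarrow> (nat \<Rightarrow> 'a) \<Rightarrow> (nat \<Rightarrow> nat \<Rightarrow> 'a) \<Rightarrow> bool" where
  "repw t r a X \<longleftrightarrow> (\<forall>M. X M \<in> carrier W) \<and> (\<forall>M i. t \<le> i \<longrightarrow> i \<le> M \<longrightarrow> X M i = a (M - i)) \<and>
     (\<forall>M i. i + r \<le> M \<longrightarrow> X M i \<in> N)"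

definition rep :: "(nat \<Rightarrow> 'a) \<Rightarrow> (nat \<Rightarrow> nat \<Rightarrow> 'a) \<Rightarrow> bool" where
  "rep a X \<longleftrightarrow> (\<exists>t r. repw t r a X)"

lemma repwD:
  assumes "repw t r a X"
  shows "X M i \<in> carrier A" "X M \<in> carrier W" "t \<le> i \<Longrightarrow> i \<le> M \<Longrightarrow> X M i = a (M - i)"
    "i + r \<le> M \<Longrightarrow> X M i \<in> N"
    "a n \<in> carrier A" "r \<le> n \<Longrightarrow> a n \<in> N"
proof -
  show 1: "X M i \<in> carrier A" for M i using assms by (simp add: repw_def WR_sel)
  show "X M \<in> carrier W" using assms by (simp add: repw_def)
  show 2: "t \<le> i \<Longrightarrow> i \<le> M \<Longrightarrow> X M i = a (M - i)" for M i using assms by (simp add: repw_def)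
  show 3: "i + r \<le> M \<Longrightarrow> X M i \<in> N" for M i using assms by (simp add: repw_def)
  show "a n \<in> carrier A" using 1[of "n + t" t] 2[of t "n + t"] by simp
  show "r \<le> n \<Longrightarrow> a n \<in> N" using 3[of t "n + t"] 2[of t "n + t"] by simp
qed

lemma repw_mono: "repw t r a X \<Longrightarrow> t \<le> t' \<Longrightarrow> r \<le> r' \<Longrightarrow> repw t' r' a X"
  unfolding repw_def by auto

lemma rep_common:
  assumes "rep a X" "rep b Y"
  obtains t r where "repw t r a X" "repw t r b Y"
proof -
  from assms obtain t r t' r' where "repw t r a X" "repw t' r' b Y" by (auto simp: rep_def)
  then have "repw (max t t') (max r r') a X" "repw (max t t') (max r r') b Y"
    by (auto intro: repw_mono)
  then show ?thesis by (rule that)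
qed

lemma rep_CW: "rep a X \<Longrightarrow> a \<in> carrier C"
  unfolding CW_carrier
proof -
  assume "rep a X"
  then obtain t r where tr: "repw t r a X" by (auto simp: rep_def)
  show "(\<forall>n. a n \<in> carrier A) \<and> (\<exists>r. \<forall>n\<ge>r. a n \<in> N)"
    using repwD(5,6)[OF tr] by blast
qed

text \<open>For \<open>i > M\<close> truncated subtraction gives the entry \<open>a 0\<close>; there
  \<open>repw\<close> only asks for an element of \<open>A\<close>.\<close>

lemma rep_self: "a \<in> carrier C \<Longrightarrow> rep a (\<lambda>M i. a (M - i))"
proof -
  assume "a \<in> carrier C"
  then obtain r where "\<forall>n. a n \<in> carrier A" "\<forall>n\<ge>r. a n \<in> N" by (auto simp: CW_carrier)
  then have "repw 0 r a (\<lambda>M i. a (M - i))" by (auto simp: repw_def WR_sel)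
  then show ?thesis by (auto simp: rep_def)
qed

text \<open>Entry \<open>n\<close> is read off at index \<open>t\<close> of the vector with
  \<open>M = n + t\<close>, just past the unreliable entries.\<close>

lemma rep_unique:
  assumes "rep a X" "rep b X" shows "a = b"
proof
  fix n
  obtain t r where tr: "repw t r a X" "repw t r b X" using rep_common[OF assms] .
  from repwD(3)[OF tr(1), of t "n + t"] repwD(3)[OF tr(2), of t "n + t"] show "a n = b n" by simp
qed

lemma window_eq: "cw_window a n m i = a (n + m - i)"
  by (simp add: cw_window_def)

text \<open>Independence of early entries is used twice: to see that the sequence defining the sum
  is constant from \<open>r + s\<close> on, and to replace windows by an arbitrary representing
  family. The latter costs \<open>r + s\<close> further unreliable entries.\<close>

lemma rep_add:
  assumes "rep a X" "rep b Y"
  shows "rep (a \<oplus>\<^bsub>C\<^esub> b) (\<lambda>M. X M \<oplus>\<^bsub>W\<^esub> Y M)"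
proof -
  obtain t r where tr: "repw t r a X" "repw t r b Y" using rep_common[OF assms] .
  note a = repwD[OF tr(1)] and b = repwD[OF tr(2)]
  have win: "cw_window a n m \<in> carrier W" "cw_window b n m \<in> carrier W" for n m
    by (auto simp: WR_sel window_eq a(5) b(5))
  have V0: "wV A x i \<in> carrier A" if "x \<in> carrier W" for x i
    using that by (cases i) (auto simp: WR_sel)
  define g where "g n m = (cw_window a n m \<oplus>\<^bsub>W\<^esub> cw_window b n m) m" for n m
  have add: "(a \<oplus>\<^bsub>C\<^esub> b) n = eventual_value (g n)" for n
    by (simp add: CW_def g_def[abs_def] WR_sel)
  \<comment> \<open>Apart from its first entry, which is nilpotent, the longer window is the
    Verschiebung of the shorter one, and Verschiebung is additive.\<close>
  have step: "g n (Suc m) = g n m" if m: "r + s \<le> m" for n m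
  proof -
    have "g n (Suc m) = (wV A (cw_window a n m) \<oplus>\<^bsub>W\<^esub> wV A (cw_window b n m)) (Suc m)"
      unfolding g_def
    proof (rule A.WR_add_indep[where t = 1 and r = r])
      fix i assume i: "i + r \<le> Suc m"
      show "cw_window a n (Suc m) i \<in> N \<and> wV A (cw_window a n m) i \<in> N \<and>
            cw_window b n (Suc m) i \<in> N \<and> wV A (cw_window b n m) i \<in> N"
        using i by (cases i) (auto simp: window_eq intro!: a(6) b(6))
    next
      fix i :: nat assume "1 \<le> i" "i \<le> Suc m"
      then show "cw_window a n (Suc m) i = wV A (cw_window a n m) i \<and> 
                 cw_window b n (Suc m) i = wV A (cw_window b n m) i"
        by (cases i) (auto simp: window_eq)
    qed (use m win V0 in \<open>auto simp: WR_sel\<close>)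
    also have "\<dots> = g n m"
      unfolding A.wV_add[OF A.p win] g_def by simp
    finally show ?thesis .
  qed
  have "repw (t + r + s) r (a \<oplus>\<^bsub>C\<^esub> b) (\<lambda>M. X M \<oplus>\<^bsub>W\<^esub> Y M)"
    unfolding repw_def
  proof (intro conjI allI impI)
    fix M show "X M \<oplus>\<^bsub>W\<^esub> Y M \<in> carrier W" by (intro A.W.a_closed a b)
  next
    fix M i assume i: "t + r + s \<le> i" "i \<le> M"
    \<comment> \<open>The window of length \<open>i + 1\<close> that ends at position
      \<open>M - i\<close> has the entries \<open>a (M - j)\<close>, the same as
      \<open>X M j\<close> for \<open>t \<le> j \<le> i\<close>.\<close>
    have "(a \<oplus>\<^bsub>C\<^esub> b) (M - i) = g (M - i) i"
      unfolding add by (rule eventual_value_const[where N = "r + s"]) (use step i in auto)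
    also have "\<dots> = (X M \<oplus>\<^bsub>W\<^esub> Y M) i"
      unfolding g_def
    proof (rule A.WR_add_indep[where t = t and r = r])
      fix j assume j: "t \<le> j" "j \<le> i"
      then show "cw_window a (M - i) i j = X M j \<and> cw_window b (M - i) i j = Y M j"
        using i by (simp add: window_eq a(3) b(3))
    next
      fix j assume "j + r \<le> i"
      then show "cw_window a (M - i) i j \<in> N \<and> X M j \<in> N \<and> cw_window b (M - i) i j \<in> N \<and> Y M j \<in> N"
        using i by (auto simp: window_eq intro!: a(4,6) b(4,6))
    qed (use i win a(2) b(2) in auto)
    finally show "(X M \<oplus>\<^bsub>W\<^esub> Y M) i = (a \<oplus>\<^bsub>C\<^esub> b) (M - i)" by simp
  next
    fix M i assume "i + r \<le> M"
    then show "(X M \<oplus>\<^bsub>W\<^esub> Y M) i \<in> N"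
      by (intro A.WR_add_nil a b) (auto intro!: a(4) b(4))
  qed
  then show ?thesis by (auto simp: rep_def)
qed

text \<open>The vector \<open>frob^(-M) x\<close>, moved from \<open>K\<close> to \<open>A\<close>:
  the factor in Fontaine's action on windows with \<open>n + m = M\<close>.\<close>

definition wroot :: "nat \<Rightarrow> (nat \<Rightarrow> 'k) \<Rightarrow> nat \<Rightarrow> 'a" where
  "wroot M x i = iota (root M (x i))"

lemma wroot_ring_hom: "wroot M \<in> ring_hom (WR p K) W"
proof -
  have "(\<lambda>c. iota (root M c)) \<in> ring_hom K A"
    using ring_hom_trans[OF root_ring_hom iota_ring_hom] by (simp add: comp_def)
  then have "(\<lambda>x n. iota (root M (x n))) \<in> ring_hom (WR p K) W"
    by (intro WR_ring_hom) (auto intro: K.is_cring A.is_cring)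
  then show ?thesis by (simp add: wroot_def[abs_def])
qed

lemma wroot_closed: "x \<in> carrier (WR p K) \<Longrightarrow> wroot M x \<in> carrier W"
  by (rule ring_hom_closed[OF wroot_ring_hom])

lemma iota_pow: "c \<in> carrier K \<Longrightarrow> iota c [^]\<^bsub>A\<^esub> n = iota (c [^]\<^bsub>K\<^esub> n)" for n :: nat
  by (induction n) auto

lemma wroot_Suc_pow: "x \<in> carrier (WR p K) \<Longrightarrow> (\<lambda>i. wroot (Suc M) x i [^]\<^bsub>A\<^esub> p) = wroot M x"
  by (auto simp: wroot_def fun_eq_iff WR_sel iota_pow root_Suc_pow)

text \<open>As for sums. The twist by inverse Frobenius is what makes the limit exist: lengthening a
  window applies \<open>V\<close> to it, the projection formula moves this past the scalar at the
  price of a Frobenius, and the Frobenius turns \<open>wroot (Suc M) x\<close> into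
  \<open>wroot M x\<close>.\<close>

lemma rep_smult:
  assumes x: "x \<in> carrier (WR p K)" and "rep a X"
  shows "rep (x \<odot>\<^bsub>C\<^esub> a) (\<lambda>M. wroot M x \<otimes>\<^bsub>W\<^esub> X M)"
proof -
  obtain t r where tr: "repw t r a X" using assms by (auto simp: rep_def)
  note a = repwD[OF tr(1)]
  have win: "cw_window a n m \<in> carrier W" for n m
    by (auto simp: WR_sel window_eq a(5))
  have V0: "wV A x i \<in> carrier A" if "x \<in> carrier W" for x i
    using that by (cases i) (auto simp: WR_sel)
  define g where "g n m = (wroot (n + m) x \<otimes>\<^bsub>W\<^esub> cw_window a n m) m" for n m
  have smult: "(x \<odot>\<^bsub>C\<^esub> a) n = eventual_value (g n)" for n
    by (simp add: CW_def g_def[abs_def] WR_sel wroot_def[abs_def] iota_def root_def)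
  have step: "g n (Suc m) = g n m" if m: "r + s \<le> m" for n m
  proof -
    have "g n (Suc m) = (wroot (n + Suc m) x \<otimes>\<^bsub>W\<^esub> wV A (cw_window a n m)) (Suc m)"
      unfolding g_def
    proof (rule A.WR_mult_indep[where t = 1 and r = r])
      fix i assume i: "i + r \<le> Suc m"
      show "cw_window a n (Suc m) i \<in> N \<and> wV A (cw_window a n m) i \<in> N"
        using i by (cases i) (auto simp: window_eq intro!: a(6))
    next
      fix i :: nat assume "1 \<le> i" "i \<le> Suc m"
      then show "cw_window a n (Suc m) i = wV A (cw_window a n m) i"
        by (cases i) (auto simp: window_eq)
    qed (use m win V0 wroot_closed[OF x] in \<open>auto simp: WR_sel\<close>)
    also have "\<dots> = g n m"
      using wroot_Suc_pow[OF x, of "n + m"]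
      by (subst A.mult_wV[OF win wroot_closed[OF x]]) (simp add: g_def)
    finally show ?thesis .
  qed
  have "repw (t + r + s) r (x \<odot>\<^bsub>C\<^esub> a) (\<lambda>M. wroot M x \<otimes>\<^bsub>W\<^esub> X M)"
    unfolding repw_def
  proof (intro conjI allI impI)
    fix M show "wroot M x \<otimes>\<^bsub>W\<^esub> X M \<in> carrier W" by (intro A.W.m_closed a wroot_closed x)
  next
    fix M i assume i: "t + r + s \<le> i" "i \<le> M"
    have "(x \<odot>\<^bsub>C\<^esub> a) (M - i) = g (M - i) i"
      unfolding smult by (rule eventual_value_const[where N = "r + s"]) (use step i in auto)
    also have "\<dots> = (wroot M x \<otimes>\<^bsub>W\<^esub> cw_window a (M - i) i) i"
      using i by (simp add: g_def)
    also have "\<dots> = (wroot M x \<otimes>\<^bsub>W\<^esub> X M) i"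
    proof (rule A.WR_mult_indep[where t = t and r = r])
      fix j assume j: "t \<le> j" "j \<le> i"
      then show "cw_window a (M - i) i j = X M j"
        using i by (simp add: window_eq a(3))
    next
      fix j assume "j + r \<le> i"
      then show "cw_window a (M - i) i j \<in> N \<and> X M j \<in> N"
        using i by (auto simp: window_eq intro!: a(4,6))
    qed (use i win a(2) wroot_closed[OF x] in auto)
    finally show "(wroot M x \<otimes>\<^bsub>W\<^esub> X M) i = (x \<odot>\<^bsub>C\<^esub> a) (M - i)" by simp
  next
    fix M i assume "i + r \<le> M"
    then show "(wroot M x \<otimes>\<^bsub>W\<^esub> X M) i \<in> N"
      by (intro A.WR_mult_nil a wroot_closed x) (auto intro!: a(4))
  qed
  then show ?thesis by (auto simp: rep_def)
qed

lemma rep_F: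
  assumes "rep a X"
  shows "rep (Fop C a) (\<lambda>M i. X M i [^]\<^bsub>A\<^esub> p)"
proof -
  obtain t r where tr: "repw t r a X" using assms by (auto simp: rep_def)
  note a = repwD[OF tr(1)]
  have "y [^]\<^bsub>A\<^esub> p \<in> N" if "y \<in> N" for y
  proof -
    have "y [^]\<^bsub>A\<^esub> p = y [^]\<^bsub>A\<^esub> (p - 1) \<otimes>\<^bsub>A\<^esub> y"
      using A.p_pos by (cases p) auto
    then show ?thesis using that N.Icarr by (simp add: N.I_l_closed)
  qed
  then have "repw t r (Fop C a) (\<lambda>M i. X M i [^]\<^bsub>A\<^esub> p)"
    using a(1,3,4) by (auto simp: repw_def WR_sel CW_def)
  then show ?thesis by (auto simp: rep_def)
qed

text \<open>Two families for the same covector. The passage to \<open>Suc M\<close> suits additivity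
  and scalars, whereas \<open>wV\<close> suits the relation \<open>V F = p\<close>.\<close>

lemma rep_V:
  assumes "rep a X"
  shows "rep (Vop C a) (\<lambda>M. X (Suc M))" "rep (Vop C a) (\<lambda>M. wV A (X M))"
proof -
  obtain t r where tr: "repw t r a X" using assms by (auto simp: rep_def)
  note a = repwD[OF tr(1)]
  have "repw t r (Vop C a) (\<lambda>M. X (Suc M))"
    using a(1,3,4) by (auto simp: repw_def WR_sel CW_def Suc_diff_le)
  then show "rep (Vop C a) (\<lambda>M. X (Suc M))" by (auto simp: rep_def)
  have "repw (Suc t) r (Vop C a) (\<lambda>M. wV A (X M))"
    unfolding repw_def
  proof (intro conjI allI impI)
    fix M i
    show "wV A (X M) \<in> carrier W" using a(1) by (auto simp: WR_sel wV_def split: nat.splits)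
    show "wV A (X M) i = Vop C a (M - i)" if "Suc t \<le> i" "i \<le> M"
      using that by (cases i) (auto simp: a(3) CW_def Suc_diff_Suc)
    show "wV A (X M) i \<in> N" if "i + r \<le> M"
      using that by (cases i) (auto intro!: a(4))
  qed
  then show "rep (Vop C a) (\<lambda>M. wV A (X M))" by (auto simp: rep_def)
qed

lemma rep_zero: "rep \<zero>\<^bsub>C\<^esub> (\<lambda>M. \<zero>\<^bsub>W\<^esub>)"
  unfolding rep_def repw_def by (intro exI[of _ 0]) (auto simp: CW_def WR_sel)

text \<open>All identities between covectors are obtained in this way from identities in
  \<open>W(A)\<close>, with no limit left to treat.\<close>

lemma rep_eq: "rep a X \<Longrightarrow> rep b Y \<Longrightarrow> (\<And>M. X M = Y M) \<Longrightarrow> a = b"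
  using rep_unique by (metis ext)

lemma CW_add_closed: "a \<in> carrier C \<Longrightarrow> b \<in> carrier C \<Longrightarrow> a \<oplus>\<^bsub>C\<^esub> b \<in> carrier C"
  by (rule rep_CW[OF rep_add[OF rep_self rep_self]])

lemma CW_smult_closed: "x \<in> carrier (WR p K) \<Longrightarrow> a \<in> carrier C \<Longrightarrow> x \<odot>\<^bsub>C\<^esub> a \<in> carrier C"
  by (rule rep_CW[OF rep_smult[OF _ rep_self]])

lemma CW_zero_closed: "\<zero>\<^bsub>C\<^esub> \<in> carrier C"
  by (rule rep_CW[OF rep_zero])

lemma CW_F_closed: "a \<in> carrier C \<Longrightarrow> Fop C a \<in> carrier C"
  by (rule rep_CW[OF rep_F[OF rep_self]])

lemma CW_V_closed: "a \<in> carrier C \<Longrightarrow> Vop C a \<in> carrier C"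
  by (rule rep_CW[OF rep_V(1)[OF rep_self]])

text \<open>Precedes the group axioms because additive inverses are obtained from the scalar
  \<open>-1\<close>.\<close>

lemma CW_smult_l_distr:
  assumes "x \<in> carrier (WR p K)" "y \<in> carrier (WR p K)" "a \<in> carrier C"
  shows "(x \<oplus>\<^bsub>WR p K\<^esub> y) \<odot>\<^bsub>C\<^esub> a = x \<odot>\<^bsub>C\<^esub> a \<oplus>\<^bsub>C\<^esub> y \<odot>\<^bsub>C\<^esub> a"
proof (rule rep_eq[OF rep_smult[OF _ rep_self] rep_add[OF rep_smult[OF _ rep_self] rep_smult[OF _ rep_self]]])
  fix M
  have "(\<lambda>i. a (M - i)) \<in> carrier W" using assms by (simp add: WR_sel CW_carrier)
  then show "wroot M (x \<oplus>\<^bsub>WR p K\<^esub> y) \<otimes>\<^bsub>W\<^esub> (\<lambda>i. a (M - i)) =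
      wroot M x \<otimes>\<^bsub>W\<^esub> (\<lambda>i. a (M - i)) \<oplus>\<^bsub>W\<^esub> wroot M y \<otimes>\<^bsub>W\<^esub> (\<lambda>i. a (M - i))"
    using assms by (simp add: ring_hom_add[OF wroot_ring_hom] wroot_closed A.W.l_distr)
qed (use assms in auto)

lemma CW_smult_one: "a \<in> carrier C \<Longrightarrow> \<one>\<^bsub>WR p K\<^esub> \<odot>\<^bsub>C\<^esub> a = a"
proof (rule rep_eq[OF rep_smult[OF _ rep_self] rep_self])
  assume a: "a \<in> carrier C"
  fix M
  have "(\<lambda>i. a (M - i)) \<in> carrier W" using a by (simp add: WR_sel CW_carrier)
  then show "wroot M \<one>\<^bsub>WR p K\<^esub> \<otimes>\<^bsub>W\<^esub> (\<lambda>i. a (M - i)) = (\<lambda>i. a (M - i))"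
    by (simp add: ring_hom_one[OF wroot_ring_hom])
qed auto

lemma CW_smult_zero: "a \<in> carrier C \<Longrightarrow> \<zero>\<^bsub>WR p K\<^esub> \<odot>\<^bsub>C\<^esub> a = \<zero>\<^bsub>C\<^esub>"
proof (rule rep_eq[OF rep_smult[OF _ rep_self] rep_zero])
  assume a: "a \<in> carrier C"
  fix M
  interpret w: ring_hom_cring "WR p K" W "wroot M"
    using wroot_ring_hom by unfold_locales auto
  have "(\<lambda>i. a (M - i)) \<in> carrier W" using a by (simp add: WR_sel CW_carrier)
  then show "wroot M \<zero>\<^bsub>WR p K\<^esub> \<otimes>\<^bsub>W\<^esub> (\<lambda>i. a (M - i)) = \<zero>\<^bsub>W\<^esub>" by simp
qed auto

lemma CW_abelian_group: "abelian_group C"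
proof (rule abelian_groupI)
  fix a b assume ab: "a \<in> carrier C" "b \<in> carrier C"
  then have w: "(\<lambda>i. a (M - i)) \<in> carrier W" "(\<lambda>i. b (M - i)) \<in> carrier W" for M
    by (auto simp: WR_sel CW_carrier)
  show "a \<oplus>\<^bsub>C\<^esub> b \<in> carrier C" by (intro CW_add_closed ab)
  show "a \<oplus>\<^bsub>C\<^esub> b = b \<oplus>\<^bsub>C\<^esub> a"
    by (rule rep_eq[OF rep_add[OF rep_self rep_self] rep_add[OF rep_self rep_self]])
      (use ab w in \<open>auto simp: A.W.a_comm\<close>)
  fix c assume c: "c \<in> carrier C"
  then have w': "(\<lambda>i. c (M - i)) \<in> carrier W" for M by (auto simp: WR_sel CW_carrier)
  show "a \<oplus>\<^bsub>C\<^esub> b \<oplus>\<^bsub>C\<^esub> c = a \<oplus>\<^bsub>C\<^esub> (b \<oplus>\<^bsub>C\<^esub> c)"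
    by (rule rep_eq[OF rep_add[OF rep_add[OF rep_self rep_self] rep_self] rep_add[OF rep_self rep_add[OF rep_self rep_self]]])
      (use ab c w w' in \<open>auto simp: A.W.a_assoc\<close>)
next
  fix a assume a: "a \<in> carrier C"
  then have w: "(\<lambda>i. a (M - i)) \<in> carrier W" for M
    by (auto simp: WR_sel CW_carrier)
  show "\<zero>\<^bsub>C\<^esub> \<oplus>\<^bsub>C\<^esub> a = a"
    by (rule rep_eq[OF rep_add[OF rep_zero rep_self] rep_self]) (use a w in auto)
  \<comment> \<open>The inverse is the action of \<open>-1\<close> in \<open>W(K)\<close>. Negating
    entries would not do: for \<open>p = 2\<close> that is the identity.\<close>
  have "((\<ominus>\<^bsub>WR p K\<^esub> \<one>\<^bsub>WR p K\<^esub>) \<odot>\<^bsub>C\<^esub> a) \<oplus>\<^bsub>C\<^esub> a = (\<ominus>\<^bsub>WR p K\<^esub> \<one>\<^bsub>WR p K\<^esub> \<oplus>\<^bsub>WR p K\<^esub> \<one>\<^bsub>WR p K\<^esub>) \<odot>\<^bsub>C\<^esub> a"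
    using a by (subst CW_smult_l_distr) (auto simp: CW_smult_one)
  also have "\<dots> = \<zero>\<^bsub>C\<^esub>" using a by (simp add: K.W.l_neg CW_smult_zero)
  finally show "\<exists>b\<in>carrier C. b \<oplus>\<^bsub>C\<^esub> a = \<zero>\<^bsub>C\<^esub>"
    using CW_smult_closed[OF _ a, of "\<ominus>\<^bsub>WR p K\<^esub> \<one>\<^bsub>WR p K\<^esub>"] by auto
qed (rule CW_zero_closed)

sublocale C: abelian_group C by (rule CW_abelian_group)

lemma CW_module: "module (WR p K) C"
proof (rule moduleI)
  show "cring (WR p K)" by (rule K.W.is_cring)
  fix x y a assume x: "x \<in> carrier (WR p K)" and y: "y \<in> carrier (WR p K)" and a: "a \<in> carrier C"
  show "(x \<oplus>\<^bsub>WR p K\<^esub> y) \<odot>\<^bsub>C\<^esub> a = x \<odot>\<^bsub>C\<^esub> a \<oplus>\<^bsub>C\<^esub> y \<odot>\<^bsub>C\<^esub> a"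
    by (rule CW_smult_l_distr[OF x y a])
  have w: "(\<lambda>i. a (M - i)) \<in> carrier W" for M using a by (auto simp: WR_sel CW_carrier)
  show "(x \<otimes>\<^bsub>WR p K\<^esub> y) \<odot>\<^bsub>C\<^esub> a = x \<odot>\<^bsub>C\<^esub> (y \<odot>\<^bsub>C\<^esub> a)"
    by (rule rep_eq[OF rep_smult[OF _ rep_self] rep_smult[OF _ rep_smult[OF _ rep_self]]])
      (use x y a w in \<open>auto simp: ring_hom_mult[OF wroot_ring_hom] wroot_closed A.W.m_assoc\<close>)
next
  fix x a b assume x: "x \<in> carrier (WR p K)" and a: "a \<in> carrier C" and b: "b \<in> carrier C"
  have w: "(\<lambda>i. a (M - i)) \<in> carrier W" "(\<lambda>i. b (M - i)) \<in> carrier W" for M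
    using a b by (auto simp: WR_sel CW_carrier)
  show "x \<odot>\<^bsub>C\<^esub> (a \<oplus>\<^bsub>C\<^esub> b) = x \<odot>\<^bsub>C\<^esub> a \<oplus>\<^bsub>C\<^esub> x \<odot>\<^bsub>C\<^esub> b"
    by (rule rep_eq[OF rep_smult[OF _ rep_add[OF rep_self rep_self]] rep_add[OF rep_smult[OF _ rep_self] rep_smult[OF _ rep_self]]])
      (use x a b w in \<open>auto simp: wroot_closed A.W.r_distr\<close>)
qed (auto intro: CW_abelian_group CW_smult_closed CW_smult_one)

lemma rep_add_pow: "a \<in> carrier C \<Longrightarrow> rep ([k] \<cdot>\<^bsub>C\<^esub> a) (\<lambda>M. [k] \<cdot>\<^bsub>W\<^esub> (\<lambda>i. a (M - i)))" for k :: nat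
proof (induction k)
  case 0
  then show ?case using rep_zero by simp
next
  case (Suc k)
  then show ?case using rep_add[OF Suc.IH rep_self] by simp
qed

lemma CW_dieudonne: "dieudonne_module p K C"
  unfolding dieudonne_module_def witt_WR
proof (intro conjI ballI)
  show "module (WR p K) C" by (rule CW_module)
  have wF: "(\<lambda>x i. x i [^]\<^bsub>A\<^esub> p) \<in> ring_hom W W"
    by (rule WR_ring_hom[OF A.is_cring A.is_cring A.frob_ring_hom])
  have w: "(\<lambda>i. a (M - i)) \<in> carrier W" if "a \<in> carrier C" for M a
    using that by (auto simp: WR_sel CW_carrier)
  show "Fop C \<in> hom (add_monoid C) (add_monoid C)"
  proof (rule homI)
    fix a b assume "a \<in> carrier (add_monoid C)" "b \<in> carrier (add_monoid C)"
    then have ab: "a \<in> carrier C" "b \<in> carrier C" by auto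
    have "Fop C (a \<oplus>\<^bsub>C\<^esub> b) = Fop C a \<oplus>\<^bsub>C\<^esub> Fop C b"
      by (rule rep_eq[OF rep_F[OF rep_add[OF rep_self rep_self]] rep_add[OF rep_F[OF rep_self] rep_F[OF rep_self]]])
        (use ab w ring_hom_add[OF wF] in auto)
    then show "Fop C (a \<otimes>\<^bsub>add_monoid C\<^esub> b) = Fop C a \<otimes>\<^bsub>add_monoid C\<^esub> Fop C b" by simp
  qed (auto intro: CW_F_closed)
  show "Vop C \<in> hom (add_monoid C) (add_monoid C)"
  proof (rule homI)
    fix a b assume "a \<in> carrier (add_monoid C)" "b \<in> carrier (add_monoid C)"
    then have ab: "a \<in> carrier C" "b \<in> carrier C" by auto
    have "Vop C (a \<oplus>\<^bsub>C\<^esub> b) = Vop C a \<oplus>\<^bsub>C\<^esub> Vop C b"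
      by (rule rep_eq[OF rep_V(1)[OF rep_add[OF rep_self rep_self]] rep_add[OF rep_V(1)[OF rep_self] rep_V(1)[OF rep_self]]])
        (use ab in auto)
    then show "Vop C (a \<otimes>\<^bsub>add_monoid C\<^esub> b) = Vop C a \<otimes>\<^bsub>add_monoid C\<^esub> Vop C b" by simp
  qed (auto intro: CW_V_closed)
  fix a assume a: "a \<in> carrier C"
  have F: "(\<lambda>i. a (M - i) [^]\<^bsub>A\<^esub> p) \<in> carrier W" for M
    using a by (auto simp: WR_sel CW_carrier)
  \<comment> \<open>The second family of \<open>rep_V\<close> applied to \<open>p\<close>-th powers
    of windows is \<open>V F\<close> in \<open>W(A)\<close>, that is, multiplication by
    \<open>p\<close>.\<close>
  have "Vop C (Fop C a) = [p] \<cdot>\<^bsub>C\<^esub> a"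
    by (rule rep_eq[OF rep_V(2)[OF rep_F[OF rep_self]] rep_add_pow])
      (use a w in \<open>auto simp: A.WR_p_mult\<close>)
  moreover have "Fop C (Vop C a) = Vop C (Fop C a)" by (simp add: CW_def)
  ultimately show "Fop C (Vop C a) = [p] \<cdot>\<^bsub>C\<^esub> a" "Vop C (Fop C a) = [p] \<cdot>\<^bsub>C\<^esub> a" by simp_all
next
  have wF: "(\<lambda>x i. x i [^]\<^bsub>A\<^esub> p) \<in> ring_hom W W"
    by (rule WR_ring_hom[OF A.is_cring A.is_cring A.frob_ring_hom])
  fix x a assume x: "x \<in> carrier (WR p K)" and a: "a \<in> carrier C"
  have w: "(\<lambda>i. a (M - i)) \<in> carrier W" for M
    using a by (auto simp: WR_sel CW_carrier)
  have fx: "witt_frob p K x \<in> carrier (WR p K)"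
    using x by (auto simp: witt_frob_def WR_sel)
  have 1: "(\<lambda>i. wroot M x i [^]\<^bsub>A\<^esub> p) = wroot M (witt_frob p K x)" for M
    using x by (auto simp: wroot_def witt_frob_def fun_eq_iff WR_sel iota_pow root_frob)
  \<comment> \<open>The shift from \<open>M\<close> to \<open>Suc M\<close> that represents
    \<open>V\<close> takes one more \<open>p\<close>-th root, which undoes the Frobenius on the
    scalar.\<close>
  have 2: "wroot (Suc M) (witt_frob p K x) = wroot M x" for M
    using x by (auto simp: wroot_def witt_frob_def fun_eq_iff WR_sel root_Suc_frob)
  show "Fop C (x \<odot>\<^bsub>C\<^esub> a) = witt_frob p K x \<odot>\<^bsub>C\<^esub> Fop C a"
  proof (rule rep_eq[OF rep_F[OF rep_smult[OF x rep_self[OF a]]] rep_smult[OF fx rep_F[OF rep_self[OF a]]]])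
    fix M
    show "(\<lambda>i. (wroot M x \<otimes>\<^bsub>W\<^esub> (\<lambda>i. a (M - i))) i [^]\<^bsub>A\<^esub> p) = wroot M (witt_frob p K x) \<otimes>\<^bsub>W\<^esub> (\<lambda>i. a (M - i) [^]\<^bsub>A\<^esub> p)"
      using ring_hom_mult[OF wF wroot_closed[OF x, of M] w[of M]] 1 by simp
  qed
  show "x \<odot>\<^bsub>C\<^esub> Vop C a = Vop C (witt_frob p K x \<odot>\<^bsub>C\<^esub> a)"
    by (rule rep_eq[OF rep_smult[OF x rep_V(1)[OF rep_self[OF a]]] rep_V(1)[OF rep_smult[OF fx rep_self[OF a]]]])
      (simp add: 2)
qed

end

section \<open>Functoriality of covectors\<close>

locale cw_alg_hom = A: cw_alg p K A s + B: cw_alg p K B s'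
  for p :: nat and K :: "'k ring" and A B :: "('k, 'a) module" and s s' :: nat +
  fixes f :: "'a \<Rightarrow> 'a"
  assumes f: "f \<in> alg_hom K A B"
begin

lemma ring_hom: "f \<in> ring_hom A B"
  using f by (simp add: alg_hom_def)

sublocale f: ring_hom_cring A B f
  using ring_hom by unfold_locales auto

lemma wroot_map: "x \<in> carrier (WR p K) \<Longrightarrow> f (A.wroot M x i) = B.wroot M x i"
proof -
  assume x: "x \<in> carrier (WR p K)"
  have "f (c \<odot>\<^bsub>A\<^esub> \<one>\<^bsub>A\<^esub>) = c \<odot>\<^bsub>B\<^esub> f \<one>\<^bsub>A\<^esub>" if "c \<in> carrier K" for c
    using f that by (auto simp: alg_hom_def)
  then show ?thesis using x by (simp add: A.wroot_def B.wroot_def A.iota_def B.iota_def WR_sel)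
qed

text \<open>Homomorphisms preserve nilpotent elements, so representing families may be mapped
  entrywise; compatibility with the operations then follows from functoriality of Witt
  vectors.\<close>

lemma rep_map: "A.rep a X \<Longrightarrow> B.rep (f \<circ> a) (\<lambda>M i. f (X M i))"
proof -
  assume "A.rep a X"
  then obtain t r where "A.repw t r a X" by (auto simp: A.rep_def)
  then have "B.repw t r (f \<circ> a) (\<lambda>M i. f (X M i))"
    using nilset_hom[OF A.A.is_cring B.A.is_cring ring_hom] by (auto simp: A.repw_def B.repw_def WR_sel)
  then show ?thesis by (auto simp: B.rep_def)
qed

lemma map_closed: "a \<in> carrier (CW p K A) \<Longrightarrow> f \<circ> a \<in> carrier (CW p K B)"
  by (rule B.rep_CW[OF rep_map[OF A.rep_self]])

lemma WRf: "(\<lambda>x n. f (x n)) \<in> ring_hom (WR p A) (WR p B)"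
  by (rule WR_ring_hom[OF A.A.is_cring B.A.is_cring ring_hom])

lemma map_add:
  assumes "a \<in> carrier (CW p K A)" "b \<in> carrier (CW p K A)"
  shows "f \<circ> (a \<oplus>\<^bsub>CW p K A\<^esub> b) = (f \<circ> a) \<oplus>\<^bsub>CW p K B\<^esub> (f \<circ> b)"
proof (rule B.rep_eq[OF rep_map[OF A.rep_add[OF A.rep_self A.rep_self]] B.rep_add[OF rep_map[OF A.rep_self] rep_map[OF A.rep_self]]])
  fix M
  have w: "(\<lambda>i. a (M - i)) \<in> carrier (WR p A)" "(\<lambda>i. b (M - i)) \<in> carrier (WR p A)"
    using assms by (auto simp: WR_sel A.CW_carrier)
  show "(\<lambda>i. f (((\<lambda>i. a (M - i)) \<oplus>\<^bsub>WR p A\<^esub> (\<lambda>i. b (M - i))) i)) = (\<lambda>i. f (a (M - i))) \<oplus>\<^bsub>WR p B\<^esub> (\<lambda>i. f (b (M - i)))"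
    using ring_hom_add[OF WRf w] by simp
qed (use assms in auto)

lemma map_smult:
  assumes "x \<in> carrier (WR p K)" "a \<in> carrier (CW p K A)"
  shows "f \<circ> (x \<odot>\<^bsub>CW p K A\<^esub> a) = x \<odot>\<^bsub>CW p K B\<^esub> (f \<circ> a)"
proof (rule B.rep_eq[OF rep_map[OF A.rep_smult[OF _ A.rep_self]] B.rep_smult[OF _ rep_map[OF A.rep_self]]])
  fix M
  have w: "(\<lambda>i. a (M - i)) \<in> carrier (WR p A)"
    using assms by (auto simp: WR_sel A.CW_carrier)
  show "(\<lambda>i. f ((A.wroot M x \<otimes>\<^bsub>WR p A\<^esub> (\<lambda>i. a (M - i))) i)) = B.wroot M x \<otimes>\<^bsub>WR p B\<^esub> (\<lambda>i. f (a (M - i)))"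
    using ring_hom_mult[OF WRf A.wroot_closed[OF assms(1)] w] assms(1) by (simp add: wroot_map)
qed (use assms in auto)

lemma map_F: "a \<in> carrier (CW p K A) \<Longrightarrow> f \<circ> Fop (CW p K A) a = Fop (CW p K B) (f \<circ> a)"
proof
  fix n assume "a \<in> carrier (CW p K A)"
  then have "a n \<in> carrier A" by (simp add: A.CW_carrier)
  then have "f (a n [^]\<^bsub>A\<^esub> k) = f (a n) [^]\<^bsub>B\<^esub> k" for k :: nat by (induction k) auto
  then show "(f \<circ> Fop (CW p K A) a) n = Fop (CW p K B) (f \<circ> a) n" by (simp add: CW_def)
qed

lemma map_V: "f \<circ> Vop (CW p K A) a = Vop (CW p K B) (f \<circ> a)"
  by (auto simp: CW_def)

lemma map_zero: "f \<circ> \<zero>\<^bsub>CW p K A\<^esub> = \<zero>\<^bsub>CW p K B\<^esub>"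
  by (auto simp: CW_def)

end

section \<open>Finite-dimensional algebras\<close>

definition submod :: "'k ring \<Rightarrow> ('k, 'a) module \<Rightarrow> 'a set \<Rightarrow> bool" where
  "submod K A W \<longleftrightarrow> W \<subseteq> carrier A \<and> \<zero>\<^bsub>A\<^esub> \<in> W \<and> (\<forall>x\<in>W. \<forall>y\<in>W. x \<oplus>\<^bsub>A\<^esub> y \<in> W) \<and>
     (\<forall>c\<in>carrier K. \<forall>x\<in>W. c \<odot>\<^bsub>A\<^esub> x \<in> W)"

text \<open>Phrased with submodules instead of linear combinations, so that spanning can be verified
  in subalgebras and products without handling sums; \<open>spanning_iff\<close> relates it to
  \<open>lspan\<close>.\<close>

definition spanning :: "'k ring \<Rightarrow> ('k, 'a) module \<Rightarrow> 'a set \<Rightarrow> bool" where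
  "spanning K A B \<longleftrightarrow> B \<subseteq> carrier A \<and> (\<forall>W. submod K A W \<and> B \<subseteq> W \<longrightarrow> carrier A \<subseteq> W)"

definition lspan :: "'k ring \<Rightarrow> ('k, 'a) module \<Rightarrow> 'a set \<Rightarrow> 'a set" where
  "lspan K A B = {x. \<exists>c\<in>B \<rightarrow> carrier K. x = (\<Oplus>\<^bsub>A\<^esub>b\<in>B. c b \<odot>\<^bsub>A\<^esub> b)}"

locale kmod = K: field K + A: module K A for K :: "'k ring" and A :: "('k, 'a) module"
begin


lemma submodD:
  assumes "submod K A W"
  shows "x \<in> W \<Longrightarrow> x \<in> carrier A" "\<zero>\<^bsub>A\<^esub> \<in> W" "x \<in> W \<Longrightarrow> y \<in> W \<Longrightarrow> x \<oplus>\<^bsub>A\<^esub> y \<in> W"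
    "c \<in> carrier K \<Longrightarrow> x \<in> W \<Longrightarrow> c \<odot>\<^bsub>A\<^esub> x \<in> W"
  using assms by (auto simp: submod_def)

lemma lspan_empty: "lspan K A {} = {\<zero>\<^bsub>A\<^esub>}"
  by (auto simp: lspan_def)

lemma lspan_insert:
  assumes "finite B" "insert b B \<subseteq> carrier A" "b \<notin> B"
  shows "x \<in> lspan K A (insert b B) \<longleftrightarrow> (\<exists>c\<in>carrier K. \<exists>y\<in>lspan K A B. x = c \<odot>\<^bsub>A\<^esub> b \<oplus>\<^bsub>A\<^esub> y)"
proof
  assume "x \<in> lspan K A (insert b B)"
  then obtain c where c: "c \<in> insert b B \<rightarrow> carrier K" "x = (\<Oplus>\<^bsub>A\<^esub>v\<in>insert b B. c v \<odot>\<^bsub>A\<^esub> v)"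
    by (auto simp: lspan_def)
  then have "x = c b \<odot>\<^bsub>A\<^esub> b \<oplus>\<^bsub>A\<^esub> (\<Oplus>\<^bsub>A\<^esub>v\<in>B. c v \<odot>\<^bsub>A\<^esub> v)"
    using assms by (subst (asm) A.M.finsum_insert) auto
  then show "\<exists>c\<in>carrier K. \<exists>y\<in>lspan K A B. x = c \<odot>\<^bsub>A\<^esub> b \<oplus>\<^bsub>A\<^esub> y"
    using c(1) by (auto simp: lspan_def)
next
  assume "\<exists>c\<in>carrier K. \<exists>y\<in>lspan K A B. x = c \<odot>\<^bsub>A\<^esub> b \<oplus>\<^bsub>A\<^esub> y"
  then obtain c d where c: "c \<in> carrier K" "d \<in> B \<rightarrow> carrier K"
    "x = c \<odot>\<^bsub>A\<^esub> b \<oplus>\<^bsub>A\<^esub> (\<Oplus>\<^bsub>A\<^esub>v\<in>B. d v \<odot>\<^bsub>A\<^esub> v)" by (auto simp: lspan_def)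
  define e where "e = d(b := c)"
  have e: "e \<in> insert b B \<rightarrow> carrier K" using c assms by (auto simp: e_def)
  have "(\<Oplus>\<^bsub>A\<^esub>v\<in>B. d v \<odot>\<^bsub>A\<^esub> v) = (\<Oplus>\<^bsub>A\<^esub>v\<in>B. e v \<odot>\<^bsub>A\<^esub> v)"
    using c(2) assms by (intro A.M.finsum_cong') (auto simp: e_def Pi_iff subset_iff)
  then have "x = (\<Oplus>\<^bsub>A\<^esub>v\<in>insert b B. e v \<odot>\<^bsub>A\<^esub> v)"
    using c e assms by (subst A.M.finsum_insert) (auto simp: Pi_iff e_def)
  then show "x \<in> lspan K A (insert b B)" using e by (auto simp: lspan_def)
qed

lemma lspan_submod:
  assumes "finite B" "B \<subseteq> carrier A"
  shows "submod K A (lspan K A B) \<and> B \<subseteq> lspan K A B"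
  using assms
proof (induction B rule: finite_induct)
  case empty
  then show ?case by (auto simp: submod_def lspan_empty)
next
  case (insert b B)
  then have IH: "submod K A (lspan K A B)" "B \<subseteq> lspan K A B" by auto
  have b: "b \<in> carrier A" using insert.prems by auto
  note ins = lspan_insert[OF insert.hyps(1) insert.prems insert.hyps(2)]
  note D = submodD[OF IH(1)]
  have "submod K A (lspan K A (insert b B))"
    unfolding submod_def
  proof (intro conjI ballI subsetI)
    fix x assume "x \<in> lspan K A (insert b B)"
    then show "x \<in> carrier A" using b D(1) unfolding ins by auto
  next
    have "\<zero>\<^bsub>A\<^esub> = \<zero>\<^bsub>K\<^esub> \<odot>\<^bsub>A\<^esub> b \<oplus>\<^bsub>A\<^esub> \<zero>\<^bsub>A\<^esub>" using b by simp
    then show "\<zero>\<^bsub>A\<^esub> \<in> lspan K A (insert b B)" unfolding ins using D(2) by blast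
  next
    fix x y assume "x \<in> lspan K A (insert b B)" "y \<in> lspan K A (insert b B)"
    then obtain c d x' y' where c: "c \<in> carrier K" "d \<in> carrier K" "x' \<in> lspan K A B" "y' \<in> lspan K A B"
      "x = c \<odot>\<^bsub>A\<^esub> b \<oplus>\<^bsub>A\<^esub> x'" "y = d \<odot>\<^bsub>A\<^esub> b \<oplus>\<^bsub>A\<^esub> y'" unfolding ins by blast
    then have "x \<oplus>\<^bsub>A\<^esub> y = (c \<oplus>\<^bsub>K\<^esub> d) \<odot>\<^bsub>A\<^esub> b \<oplus>\<^bsub>A\<^esub> (x' \<oplus>\<^bsub>A\<^esub> y')"
      using b D(1) by (simp add: A.smult_l_distr A.M.a_ac)
    then show "x \<oplus>\<^bsub>A\<^esub> y \<in> lspan K A (insert b B)" unfolding ins using c D(3) by blast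
  next
    fix c x assume c: "c \<in> carrier K" and "x \<in> lspan K A (insert b B)"
    then obtain d x' where d: "d \<in> carrier K" "x' \<in> lspan K A B" "x = d \<odot>\<^bsub>A\<^esub> b \<oplus>\<^bsub>A\<^esub> x'"
      unfolding ins by blast
    then have "c \<odot>\<^bsub>A\<^esub> x = (c \<otimes>\<^bsub>K\<^esub> d) \<odot>\<^bsub>A\<^esub> b \<oplus>\<^bsub>A\<^esub> (c \<odot>\<^bsub>A\<^esub> x')"
      using b c D(1) by (simp add: A.smult_r_distr A.smult_assoc1)
    then show "c \<odot>\<^bsub>A\<^esub> x \<in> lspan K A (insert b B)"
      unfolding ins using c d D(4) by blast
  qed
  moreover have "b \<in> lspan K A (insert b B)"
    unfolding ins using b D(2) by (intro bexI[of _ "\<one>\<^bsub>K\<^esub>"] bexI[of _ "\<zero>\<^bsub>A\<^esub>"]) auto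
  moreover have "B \<subseteq> lspan K A (insert b B)"
  proof
    fix x assume "x \<in> B"
    then have "x \<in> lspan K A B" "x = \<zero>\<^bsub>K\<^esub> \<odot>\<^bsub>A\<^esub> b \<oplus>\<^bsub>A\<^esub> x" using IH b D(1) by auto
    then show "x \<in> lspan K A (insert b B)" unfolding ins by blast
  qed
  ultimately show ?case by blast
qed

lemma lspan_least:
  assumes "finite B" "submod K A W" "B \<subseteq> W"
  shows "lspan K A B \<subseteq> W"
proof -
  note D = submodD[OF assms(2)]
  show ?thesis using assms(1,3)
  proof (induction B rule: finite_induct)
    case empty
    then show ?case using D(2) by (simp add: lspan_empty)
  next
    case (insert b B)
    have sub: "insert b B \<subseteq> carrier A" using insert.prems D(1) by auto
    show ?case
    proof
      fix x assume "x \<in> lspan K A (insert b B)"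
      then obtain c y where "c \<in> carrier K" "y \<in> lspan K A B" "x = c \<odot>\<^bsub>A\<^esub> b \<oplus>\<^bsub>A\<^esub> y"
        using lspan_insert[OF insert.hyps(1) sub insert.hyps(2)] by blast
      then show "x \<in> W" using insert D by auto
    qed
  qed
qed

lemma spanning_iff:
  assumes "finite B" "B \<subseteq> carrier A"
  shows "spanning K A B \<longleftrightarrow> carrier A \<subseteq> lspan K A B"
  using lspan_submod[OF assms] lspan_least[OF assms(1)] assms(2) unfolding spanning_def by blast

lemma fin_dim_spanning: "fin_dim K A \<longleftrightarrow> (\<exists>B. finite B \<and> spanning K A B)"
proof -
  have "fin_dim K A \<longleftrightarrow> (\<exists>B. finite B \<and> B \<subseteq> carrier A \<and> carrier A \<subseteq> lspan K A B)"
    by (auto simp: fin_dim_def lspan_def subset_iff)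
  also have "\<dots> \<longleftrightarrow> (\<exists>B. finite B \<and> B \<subseteq> carrier A \<and> spanning K A B)"
    using spanning_iff by blast
  finally show ?thesis by (auto simp: spanning_def)
qed

text \<open>Elimination of one generator \<open>b\<close>: either \<open>W\<close> avoids
  \<open>b\<close>, or some \<open>w\<close> in \<open>W\<close> involves \<open>b\<close> with
  nonzero coefficient, and then \<open>W\<close> is generated by \<open>w\<close> and the part of
  \<open>W\<close> in the span of \<open>B\<close>.\<close>

lemma submod_fg:
  assumes "finite B" "B \<subseteq> carrier A" "submod K A W" "W \<subseteq> lspan K A B"
  shows "\<exists>B'. finite B' \<and> B' \<subseteq> W \<and> W \<subseteq> lspan K A B'"
  using assms
proof (induction B arbitrary: W rule: finite_induct)
  case empty
  then show ?case by (intro exI[of _ "{}"]) (auto simp: lspan_empty)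
next
  case (insert b B)
  have B: "finite B" "B \<subseteq> carrier A" "b \<in> carrier A" using insert by auto
  note ins = lspan_insert[OF insert.hyps(1) insert.prems(1) insert.hyps(2)]
  note SB = submodD[OF conjunct1[OF lspan_submod[OF B(1,2)]]]
  note W = submodD[OF insert.prems(2)]
  have sub: "submod K A (W \<inter> lspan K A B)"
    unfolding submod_def using SB W by auto
  obtain B' where B': "finite B'" "B' \<subseteq> W \<inter> lspan K A B" "W \<inter> lspan K A B \<subseteq> lspan K A B'"
    using insert.IH[OF B(2) sub] by auto
  show ?case
  proof (cases "W \<subseteq> lspan K A B")
    case True
    then show ?thesis using B' by (intro exI[of _ B']) auto
  next
    case False
    then obtain w where w: "w \<in> W" "w \<notin> lspan K A B" by blast
    then obtain c y where c: "c \<in> carrier K" "y \<in> lspan K A B" "w = c \<odot>\<^bsub>A\<^esub> b \<oplus>\<^bsub>A\<^esub> y"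
      using insert.prems(3) ins by blast
    have "c \<noteq> \<zero>\<^bsub>K\<^esub>"
    proof
      assume "c = \<zero>\<^bsub>K\<^esub>"
      then have "w = y" using c SB(1) B(3) by simp
      then show False using w c by simp
    qed
    then have ci: "inv\<^bsub>K\<^esub> c \<in> carrier K" "inv\<^bsub>K\<^esub> c \<otimes>\<^bsub>K\<^esub> c = \<one>\<^bsub>K\<^esub>"
      using c K.field_Units by auto
    have B'A: "insert w B' \<subseteq> carrier A" using B' w W(1) by auto
    note S' = submodD[OF conjunct1[OF lspan_submod[OF finite.insertI[OF B'(1)] B'A]]]
    have B'W: "lspan K A B' \<subseteq> lspan K A (insert w B')"
      using lspan_submod[OF finite.insertI[OF B'(1)] B'A] by (intro lspan_least B') auto
    have wS: "w \<in> lspan K A (insert w B')"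
      using lspan_submod[OF finite.insertI[OF B'(1)] B'A] by auto
    have "W \<subseteq> lspan K A (insert w B')"
    proof
      fix x assume x: "x \<in> W"
      then obtain d z where d: "d \<in> carrier K" "z \<in> lspan K A B" "x = d \<odot>\<^bsub>A\<^esub> b \<oplus>\<^bsub>A\<^esub> z"
        using insert.prems(3) ins by blast
      \<comment> \<open>The multiple of \<open>w\<close> whose coefficient at \<open>b\<close>
        equals that of \<open>x\<close>; subtracting it leaves an element of the span of
        \<open>B\<close>.\<close>
      define f where "f = d \<otimes>\<^bsub>K\<^esub> inv\<^bsub>K\<^esub> c"
      define e where "e = \<ominus>\<^bsub>K\<^esub> f"
      have e: "e \<in> carrier K" "f \<in> carrier K" "f \<oplus>\<^bsub>K\<^esub> e = \<zero>\<^bsub>K\<^esub>"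
        using ci d by (auto simp: e_def f_def K.r_neg)
      have "f \<otimes>\<^bsub>K\<^esub> c = d" using ci c d by (simp add: f_def K.m_assoc)
      then have ec: "d \<oplus>\<^bsub>K\<^esub> e \<otimes>\<^bsub>K\<^esub> c = \<zero>\<^bsub>K\<^esub>"
        using e c d by (simp add: e_def K.l_minus K.r_neg)
      define x' where "x' = x \<oplus>\<^bsub>A\<^esub> e \<odot>\<^bsub>A\<^esub> w"
      have y: "y \<in> carrier A" "z \<in> carrier A" "w \<in> carrier A" "x \<in> carrier A" using c d SB(1) w W(1) x by auto
      have "x' = (d \<oplus>\<^bsub>K\<^esub> e \<otimes>\<^bsub>K\<^esub> c) \<odot>\<^bsub>A\<^esub> b \<oplus>\<^bsub>A\<^esub> (z \<oplus>\<^bsub>A\<^esub> e \<odot>\<^bsub>A\<^esub> y)"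
        unfolding x'_def d(3) c(3) using y B(3) c(1) d(1) e(1)
        by (simp add: A.smult_l_distr A.smult_r_distr A.smult_assoc1 A.M.a_ac)
      then have "x' = z \<oplus>\<^bsub>A\<^esub> e \<odot>\<^bsub>A\<^esub> y" using ec y B(3) e by simp
      then have "x' \<in> lspan K A B" using SB c d e by auto
      moreover have "x' \<in> W" unfolding x'_def using W x w e by auto
      ultimately have x': "x' \<in> lspan K A (insert w B')" using B' B'W by blast
      have "f \<odot>\<^bsub>A\<^esub> w \<oplus>\<^bsub>A\<^esub> x' = x \<oplus>\<^bsub>A\<^esub> (f \<oplus>\<^bsub>K\<^esub> e) \<odot>\<^bsub>A\<^esub> w"
        unfolding x'_def using y e(1,2) by (simp add: A.smult_l_distr A.M.a_ac)
      then have "x = f \<odot>\<^bsub>A\<^esub> w \<oplus>\<^bsub>A\<^esub> x'" using y e(3) by simp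
      then show "x \<in> lspan K A (insert w B')" using S' wS x' e by simp
    qed
    then show ?thesis using B' w by (intro exI[of _ "insert w B'"]) auto
  qed
qed

lemma submod_spanned:
  assumes "fin_dim K A" "submod K A W"
  shows "\<exists>B. finite B \<and> B \<subseteq> W \<and> W = lspan K A B"
proof -
  from assms(1) obtain B where fB: "finite B" "spanning K A B" using fin_dim_spanning by blast
  then have B: "finite B" "B \<subseteq> carrier A" by (auto simp: spanning_def)
  have cB: "carrier A \<subseteq> lspan K A B" using spanning_iff[OF B] fB(2) by blast
  have "W \<subseteq> lspan K A B" using cB submodD(1)[OF assms(2)] by blast
  from submod_fg[OF B assms(2) this] obtain B' where B': "finite B'" "B' \<subseteq> W" "W \<subseteq> lspan K A B'"
    by blast
  then have "W = lspan K A B'" using lspan_least[OF B'(1) assms(2) B'(2)] by blast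
  then show ?thesis using B' by blast
qed

section \<open>Bases and coordinates\<close>

definition lc :: "nat \<Rightarrow> (nat \<Rightarrow> 'a) \<Rightarrow> (nat \<Rightarrow> 'k) \<Rightarrow> 'a" where
  "lc n b c = (\<Oplus>\<^bsub>A\<^esub>k\<in>{..<n}. c k \<odot>\<^bsub>A\<^esub> b k)"

text \<open>Bases are enumerated by numbers, so that structure constants of algebras on different
  carriers can be compared.\<close>

definition basis :: "nat \<Rightarrow> (nat \<Rightarrow> 'a) \<Rightarrow> bool" where
  "basis n b \<longleftrightarrow> b ` {..<n} \<subseteq> carrier A \<and>
     (\<forall>x\<in>carrier A. \<exists>c\<in>{..<n} \<rightarrow> carrier K. x = lc n b c) \<and>
     (\<forall>c\<in>{..<n} \<rightarrow> carrier K. \<forall>d\<in>{..<n} \<rightarrow> carrier K. lc n b c = lc n b d \<longrightarrow> (\<forall>k<n. c k = d k))"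

text \<open>A spanning set of least cardinality: if two representations differed at
  \<open>b\<close>, then \<open>b\<close> would lie in the span of the others and could be
  dropped.\<close>

lemma ex_independent:
  assumes "fin_dim K A"
  obtains B where "finite B" "B \<subseteq> carrier A" "carrier A \<subseteq> lspan K A B"
    "\<And>c d b. c \<in> B \<rightarrow> carrier K \<Longrightarrow> d \<in> B \<rightarrow> carrier K \<Longrightarrow>
      (\<Oplus>\<^bsub>A\<^esub>b\<in>B. c b \<odot>\<^bsub>A\<^esub> b) = (\<Oplus>\<^bsub>A\<^esub>b\<in>B. d b \<odot>\<^bsub>A\<^esub> b) \<Longrightarrow> b \<in> B \<Longrightarrow> c b = d b"
proof -
  have "\<exists>B. finite B \<and> spanning K A B" using assms fin_dim_spanning by blast
  then obtain B0 where "finite B0 \<and> spanning K A B0" ..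
  from ex_has_least_nat[of "\<lambda>B. finite B \<and> spanning K A B", OF this, of card]
  obtain B where B: "finite B" "spanning K A B"
    and min: "\<And>B'. finite B' \<Longrightarrow> spanning K A B' \<Longrightarrow> card B \<le> card B'"
    by auto
  then have Bc: "B \<subseteq> carrier A" by (simp add: spanning_def)
  show ?thesis
  proof (rule that[OF B(1) Bc])
    show "carrier A \<subseteq> lspan K A B" using B spanning_iff Bc by blast
    fix c d b assume c: "c \<in> B \<rightarrow> carrier K" and d: "d \<in> B \<rightarrow> carrier K" and b: "b \<in> B"
      and eq: "(\<Oplus>\<^bsub>A\<^esub>b\<in>B. c b \<odot>\<^bsub>A\<^esub> b) = (\<Oplus>\<^bsub>A\<^esub>b\<in>B. d b \<odot>\<^bsub>A\<^esub> b)"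
    show "c b = d b"
    proof (rule ccontr)
      assume ne: "c b \<noteq> d b"
      define B0 where "B0 = B - {b}"
      have B0: "finite B0" "B0 \<subseteq> carrier A" "B = insert b B0" "b \<notin> B0" "b \<in> carrier A"
        using B Bc b by (auto simp: B0_def)
      note S = submodD[OF conjunct1[OF lspan_submod[OF B0(1,2)]]]
      have split: "(\<Oplus>\<^bsub>A\<^esub>b\<in>B. e b \<odot>\<^bsub>A\<^esub> b) = e b \<odot>\<^bsub>A\<^esub> b \<oplus>\<^bsub>A\<^esub> (\<Oplus>\<^bsub>A\<^esub>b\<in>B0. e b \<odot>\<^bsub>A\<^esub> b)"
        if "e \<in> B \<rightarrow> carrier K" for e
        unfolding B0(3) by (subst A.M.finsum_insert) (use that B0 in \<open>auto simp: Pi_iff\<close>)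
      define y z where "y = (\<Oplus>\<^bsub>A\<^esub>b\<in>B0. c b \<odot>\<^bsub>A\<^esub> b)" and "z = (\<Oplus>\<^bsub>A\<^esub>b\<in>B0. d b \<odot>\<^bsub>A\<^esub> b)"
      have yz: "y \<in> lspan K A B0" "z \<in> lspan K A B0"
        unfolding lspan_def y_def z_def using c d B0(3) by blast+
      have yzA: "y \<in> carrier A" "z \<in> carrier A" using yz S(1) by auto
      have cd: "c b \<in> carrier K" "d b \<in> carrier K" using c d b by auto
      have e1: "c b \<odot>\<^bsub>A\<^esub> b \<oplus>\<^bsub>A\<^esub> y = d b \<odot>\<^bsub>A\<^esub> b \<oplus>\<^bsub>A\<^esub> z"
        using eq split[OF c] split[OF d] by (simp add: y_def z_def)
      define u where "u = c b \<oplus>\<^bsub>K\<^esub> \<ominus>\<^bsub>K\<^esub> d b"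
      have u: "u \<in> carrier K" "u \<noteq> \<zero>\<^bsub>K\<^esub>"
        using cd ne by (auto simp: u_def) (metis K.minus_equality K.minus_minus K.add.inv_closed)
      have "u \<odot>\<^bsub>A\<^esub> b = (c b \<odot>\<^bsub>A\<^esub> b \<oplus>\<^bsub>A\<^esub> y) \<oplus>\<^bsub>A\<^esub> (\<ominus>\<^bsub>K\<^esub> d b \<odot>\<^bsub>A\<^esub> b \<oplus>\<^bsub>A\<^esub> \<ominus>\<^bsub>A\<^esub> y)"
      proof -
        have "(c b \<odot>\<^bsub>A\<^esub> b \<oplus>\<^bsub>A\<^esub> y) \<oplus>\<^bsub>A\<^esub> (\<ominus>\<^bsub>K\<^esub> d b \<odot>\<^bsub>A\<^esub> b \<oplus>\<^bsub>A\<^esub> \<ominus>\<^bsub>A\<^esub> y) = (c b \<odot>\<^bsub>A\<^esub> b \<oplus>\<^bsub>A\<^esub> \<ominus>\<^bsub>K\<^esub> d b \<odot>\<^bsub>A\<^esub> b) \<oplus>\<^bsub>A\<^esub> (y \<oplus>\<^bsub>A\<^esub> \<ominus>\<^bsub>A\<^esub> y)"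
          using cd B0(5) yzA by (simp add: A.M.a_ac)
        then show ?thesis using cd B0(5) yzA by (simp add: u_def A.smult_l_distr A.M.r_neg)
      qed
      also have "\<dots> = (d b \<odot>\<^bsub>A\<^esub> b \<oplus>\<^bsub>A\<^esub> \<ominus>\<^bsub>K\<^esub> d b \<odot>\<^bsub>A\<^esub> b) \<oplus>\<^bsub>A\<^esub> (z \<oplus>\<^bsub>A\<^esub> \<ominus>\<^bsub>A\<^esub> y)"
        unfolding e1 using cd B0(5) yzA by (simp add: A.M.a_ac)
      also have "d b \<odot>\<^bsub>A\<^esub> b \<oplus>\<^bsub>A\<^esub> \<ominus>\<^bsub>K\<^esub> d b \<odot>\<^bsub>A\<^esub> b = \<zero>\<^bsub>A\<^esub>"
        using cd B0(5) by (simp add: A.smult_l_minus A.M.r_neg)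
      also have "\<zero>\<^bsub>A\<^esub> \<oplus>\<^bsub>A\<^esub> (z \<oplus>\<^bsub>A\<^esub> \<ominus>\<^bsub>A\<^esub> y) = z \<oplus>\<^bsub>A\<^esub> (\<ominus>\<^bsub>K\<^esub> \<one>\<^bsub>K\<^esub>) \<odot>\<^bsub>A\<^esub> y"
        using yzA by (simp add: A.smult_l_minus)
      finally have "u \<odot>\<^bsub>A\<^esub> b \<in> lspan K A B0" using S yz by auto
      then have "inv\<^bsub>K\<^esub> u \<odot>\<^bsub>A\<^esub> (u \<odot>\<^bsub>A\<^esub> b) \<in> lspan K A B0"
        using S(4) u K.field_Units by auto
      moreover have "inv\<^bsub>K\<^esub> u \<odot>\<^bsub>A\<^esub> (u \<odot>\<^bsub>A\<^esub> b) = b"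
        using u K.field_Units B0(5) by (simp flip: A.smult_assoc1)
      ultimately have "b \<in> lspan K A B0" by simp
      then have "B \<subseteq> lspan K A B0" using lspan_submod[OF B0(1,2)] B0(3) by auto
      then have "spanning K A B0"
        using B(2) lspan_submod[OF B0(1,2)] spanning_iff[OF B0(1,2)] unfolding spanning_def by blast
      then have "card B \<le> card B0" using min B0(1) by blast
      then show False using B0 by simp
    qed
  qed
qed

lemma lc_cong: "b ` {..<n} \<subseteq> carrier A \<Longrightarrow> d \<in> {..<n} \<rightarrow> carrier K \<Longrightarrow>
    (\<And>k. k < n \<Longrightarrow> c k = d k) \<Longrightarrow> lc n b c = lc n b d"
  unfolding lc_def
proof (intro A.M.finsum_cong' refl)
  assume b: "b ` {..<n} \<subseteq> carrier A" and d: "d \<in> {..<n} \<rightarrow> carrier K"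
    and cd: "\<And>k. k < n \<Longrightarrow> c k = d k"
  show "(\<lambda>k. d k \<odot>\<^bsub>A\<^esub> b k) \<in> {..<n} \<rightarrow> carrier A" using b d by auto
  fix k assume "k \<in> {..<n}"
  then show "c k \<odot>\<^bsub>A\<^esub> b k = d k \<odot>\<^bsub>A\<^esub> b k" using cd[of k] by simp
qed

lemma ex_basis:
  assumes "fin_dim K A"
  shows "\<exists>n b. basis n b"
proof (rule ex_independent[OF assms])
  fix B assume B: "finite B" "B \<subseteq> carrier A" "carrier A \<subseteq> lspan K A B"
    "\<And>c d b. c \<in> B \<rightarrow> carrier K \<Longrightarrow> d \<in> B \<rightarrow> carrier K \<Longrightarrow>
      (\<Oplus>\<^bsub>A\<^esub>b\<in>B. c b \<odot>\<^bsub>A\<^esub> b) = (\<Oplus>\<^bsub>A\<^esub>b\<in>B. d b \<odot>\<^bsub>A\<^esub> b) \<Longrightarrow> b \<in> B \<Longrightarrow> c b = d b"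
  obtain h where h: "bij_betw h {0..<card B} B" using ex_bij_betw_nat_finite[OF B(1)] by blast
  let ?n = "card B"
  have hi: "inj_on h {..<?n}" "h ` {..<?n} = B" using h by (auto simp: bij_betw_def atLeast0LessThan)
  have re: "(\<Oplus>\<^bsub>A\<^esub>b\<in>B. c b \<odot>\<^bsub>A\<^esub> b) = lc ?n h (c \<circ> h)" if "c \<in> B \<rightarrow> carrier K" for c
  proof -
    have "(\<lambda>b. c b \<odot>\<^bsub>A\<^esub> b) \<in> B \<rightarrow> carrier A" using that B(2) by auto
    then have "(\<lambda>b. c b \<odot>\<^bsub>A\<^esub> b) \<in> h ` {..<?n} \<rightarrow> carrier A" by (simp only: hi(2))
    from A.M.finsum_reindex[OF this hi(1)] show ?thesis by (simp only: hi(2) lc_def comp_def)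
  qed
  have "basis ?n h"
    unfolding basis_def
  proof (intro conjI ballI impI allI)
    show "h ` {..<?n} \<subseteq> carrier A" using hi B(2) by simp
    fix x assume "x \<in> carrier A"
    then obtain c where c: "c \<in> B \<rightarrow> carrier K" "x = (\<Oplus>\<^bsub>A\<^esub>b\<in>B. c b \<odot>\<^bsub>A\<^esub> b)"
      using B(3) by (auto simp: lspan_def)
    have "h i \<in> B" if "i < ?n" for i using that hi(2) by blast
    then have "c \<circ> h \<in> {..<?n} \<rightarrow> carrier K" using c(1) by auto
    then show "\<exists>c\<in>{..<?n} \<rightarrow> carrier K. x = lc ?n h c"
      unfolding c(2) re[OF c(1)] by blast
  next
    fix c d k assume c: "c \<in> {..<?n} \<rightarrow> carrier K" and d: "d \<in> {..<?n} \<rightarrow> carrier K"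
      and eq: "lc ?n h c = lc ?n h d" and k: "k < ?n"
    define g where "g = the_inv_into {..<?n} h"
    have g: "g (h i) = i" if "i < ?n" for i using that hi by (simp add: g_def the_inv_into_f_f)
    have gB: "e \<circ> g \<in> B \<rightarrow> carrier K" if "e \<in> {..<?n} \<rightarrow> carrier K" for e
    proof
      fix x assume "x \<in> B"
      then obtain i where "i < ?n" "x = h i" using hi(2) by blast
      then show "(e \<circ> g) x \<in> carrier K" using that g by auto
    qed
    have "lc ?n h (e \<circ> g \<circ> h) = lc ?n h e" if "e \<in> {..<?n} \<rightarrow> carrier K" for e
      by (rule lc_cong) (use that g hi(2) B(2) in auto)
    then have "(\<Oplus>\<^bsub>A\<^esub>b\<in>B. (c \<circ> g) b \<odot>\<^bsub>A\<^esub> b) = (\<Oplus>\<^bsub>A\<^esub>b\<in>B. (d \<circ> g) b \<odot>\<^bsub>A\<^esub> b)"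
      using re[OF gB[OF c]] re[OF gB[OF d]] eq c d by simp
    from B(4)[OF gB[OF c] gB[OF d] this, of "h k"] show "c k = d k"
      using g[OF k] hi k by auto
  qed
  then show "\<exists>n b. basis n b" by blast
qed

lemma lc_closed: "b ` {..<n} \<subseteq> carrier A \<Longrightarrow> c \<in> {..<n} \<rightarrow> carrier K \<Longrightarrow> lc n b c \<in> carrier A"
  unfolding lc_def by (intro A.M.finsum_closed) (auto simp: Pi_iff)

lemma lc_add:
  assumes "b ` {..<n} \<subseteq> carrier A" "c \<in> {..<n} \<rightarrow> carrier K" "d \<in> {..<n} \<rightarrow> carrier K"
  shows "lc n b (\<lambda>k. c k \<oplus>\<^bsub>K\<^esub> d k) = lc n b c \<oplus>\<^bsub>A\<^esub> lc n b d"
proof -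
  have "lc n b (\<lambda>k. c k \<oplus>\<^bsub>K\<^esub> d k) = (\<Oplus>\<^bsub>A\<^esub>k\<in>{..<n}. c k \<odot>\<^bsub>A\<^esub> b k \<oplus>\<^bsub>A\<^esub> d k \<odot>\<^bsub>A\<^esub> b k)"
    unfolding lc_def using assms by (intro A.M.finsum_cong') (auto simp: Pi_iff A.smult_l_distr)
  also have "\<dots> = lc n b c \<oplus>\<^bsub>A\<^esub> lc n b d"
    unfolding lc_def using assms by (intro A.M.finsum_addf) (auto simp: Pi_iff)
  finally show ?thesis .
qed

lemma lc_smult:
  assumes "b ` {..<n} \<subseteq> carrier A" "c \<in> {..<n} \<rightarrow> carrier K" "d \<in> carrier K"
  shows "lc n b (\<lambda>k. d \<otimes>\<^bsub>K\<^esub> c k) = d \<odot>\<^bsub>A\<^esub> lc n b c"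
  using assms(1,2)
proof (induction n)
  case 0
  show ?case using assms by (simp add: lc_def)
next
  case (Suc n)
  have IH: "lc n b (\<lambda>k. d \<otimes>\<^bsub>K\<^esub> c k) = d \<odot>\<^bsub>A\<^esub> lc n b c"
    by (rule Suc.IH) (use Suc.prems in auto)
  have step: "lc (Suc n) b c = c n \<odot>\<^bsub>A\<^esub> b n \<oplus>\<^bsub>A\<^esub> lc n b c" if "c \<in> {..<Suc n} \<rightarrow> carrier K" for c
    unfolding lc_def lessThan_Suc using Suc.prems that
    by (subst A.M.finsum_insert) (auto simp: Pi_iff image_subset_iff)
  have c: "c n \<in> carrier K" "b n \<in> carrier A" "lc n b c \<in> carrier A"
    using Suc.prems by (auto intro!: lc_closed)
  have "(\<lambda>k. d \<otimes>\<^bsub>K\<^esub> c k) \<in> {..<Suc n} \<rightarrow> carrier K" using Suc.prems assms(3) by auto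
  from step[OF this] step[OF Suc.prems(2)] show ?case
    using c assms(3) IH by (simp add: A.smult_r_distr A.smult_assoc1)
qed

lemma lc_delta:
  assumes "b ` {..<n} \<subseteq> carrier A" "k < n"
  shows "lc n b (\<lambda>j. if j = k then \<one>\<^bsub>K\<^esub> else \<zero>\<^bsub>K\<^esub>) = b k"
proof -
  have "lc n b (\<lambda>j. if j = k then \<one>\<^bsub>K\<^esub> else \<zero>\<^bsub>K\<^esub>) = (\<Oplus>\<^bsub>A\<^esub>j\<in>{..<n}. if k = j then b j else \<zero>\<^bsub>A\<^esub>)"
    unfolding lc_def using assms by (intro A.M.finsum_cong') auto
  also have "\<dots> = b k" using assms by (subst A.M.finsum_singleton) auto
  finally show ?thesis .
qed

lemma basis_spanning: "basis n b \<Longrightarrow> spanning K A (b ` {..<n})"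
  unfolding spanning_def
proof (intro conjI allI impI)
  assume b: "basis n b"
  show bA: "b ` {..<n} \<subseteq> carrier A" using b by (simp add: basis_def)
  fix W assume W: "submod K A W \<and> b ` {..<n} \<subseteq> W"
  then have D: "submod K A W" by simp
  show "carrier A \<subseteq> W"
  proof
    fix x assume "x \<in> carrier A"
    then obtain c where c: "c \<in> {..<n} \<rightarrow> carrier K" "x = lc n b c" using b unfolding basis_def by blast
    have "lc m b c \<in> W" if "m \<le> n" for m
      using that
    proof (induction m)
      case 0
      then show ?case using submodD(2)[OF D] by (simp add: lc_def)
    next
      case (Suc m)
      have "lc (Suc m) b c = c m \<odot>\<^bsub>A\<^esub> b m \<oplus>\<^bsub>A\<^esub> lc m b c"
        unfolding lc_def lessThan_Suc using Suc.prems c bA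
        by (subst A.M.finsum_insert) (auto simp: Pi_iff image_subset_iff)
      moreover have "c m \<odot>\<^bsub>A\<^esub> b m \<in> W" using Suc.prems c W by (intro submodD(4)[OF D]) auto
      ultimately show ?case using Suc submodD(3)[OF D] by auto
    qed
    then show "x \<in> W" using c by simp
  qed
qed

text \<open>Only the values below \<open>n\<close> are determined, which explains the guards
  \<open>l < n\<close> in \<open>structure_table\<close>.\<close>

definition coord :: "nat \<Rightarrow> (nat \<Rightarrow> 'a) \<Rightarrow> 'a \<Rightarrow> nat \<Rightarrow> 'k" where
  "coord n b x = (SOME c. c \<in> {..<n} \<rightarrow> carrier K \<and> x = lc n b c)"

lemma coord:
  assumes "basis n b" "x \<in> carrier A"
  shows "coord n b x \<in> {..<n} \<rightarrow> carrier K" "lc n b (coord n b x) = x"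
proof -
  have "\<exists>c. c \<in> {..<n} \<rightarrow> carrier K \<and> x = lc n b c" using assms unfolding basis_def by blast
  from someI_ex[OF this] show "coord n b x \<in> {..<n} \<rightarrow> carrier K" "lc n b (coord n b x) = x"
    unfolding coord_def by auto
qed

lemma coord_eqI:
  assumes "basis n b" "c \<in> {..<n} \<rightarrow> carrier K" "lc n b c = x" "k < n"
  shows "coord n b x k = c k"
proof -
  have x: "x \<in> carrier A" using assms by (auto simp: basis_def intro!: lc_closed)
  have "lc n b (coord n b x) = lc n b c" using coord(2)[OF assms(1) x] assms(3) by simp
  then show ?thesis using assms(1,2,4) coord(1)[OF assms(1) x] unfolding basis_def by blast
qed

end

section \<open>Pro-objects and the Yoneda lemma for the free formal group\<close>

lemma is_categoryD:
  assumes "is_category C"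
  shows "X \<in> Ob C \<Longrightarrow> Id C X \<in> Hom C X X"
    "X \<in> Ob C \<Longrightarrow> Y \<in> Ob C \<Longrightarrow> Z \<in> Ob C \<Longrightarrow> f \<in> Hom C X Y \<Longrightarrow> g \<in> Hom C Y Z \<Longrightarrow> Comp C X Y Z g f \<in> Hom C X Z"
    "X \<in> Ob C \<Longrightarrow> Y \<in> Ob C \<Longrightarrow> f \<in> Hom C X Y \<Longrightarrow> Comp C X X Y f (Id C X) = f"
    "X \<in> Ob C \<Longrightarrow> Y \<in> Ob C \<Longrightarrow> f \<in> Hom C X Y \<Longrightarrow> Comp C X Y Y (Id C Y) f = f"
    "U \<in> Ob C \<Longrightarrow> X \<in> Ob C \<Longrightarrow> Y \<in> Ob C \<Longrightarrow> Z \<in> Ob C \<Longrightarrow> f \<in> Hom C U X \<Longrightarrow> g \<in> Hom C X Y \<Longrightarrow> h \<in> Hom C Y Z \<Longrightarrow>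
      Comp C U Y Z h (Comp C U X Y g f) = Comp C U X Z (Comp C X Y Z h g) f"
  using assms unfolding is_category_def by blast+

lemma is_functorD:
  assumes "is_functor C D F"
  shows "X \<in> Ob C \<Longrightarrow> on_ob F X \<in> Ob D"
    "X \<in> Ob C \<Longrightarrow> Y \<in> Ob C \<Longrightarrow> f \<in> Hom C X Y \<Longrightarrow> on_mor F X Y f \<in> Hom D (on_ob F X) (on_ob F Y)"
    "X \<in> Ob C \<Longrightarrow> on_mor F X X (Id C X) = Id D (on_ob F X)"
    "X \<in> Ob C \<Longrightarrow> Y \<in> Ob C \<Longrightarrow> Z \<in> Ob C \<Longrightarrow> f \<in> Hom C X Y \<Longrightarrow> g \<in> Hom C Y Z \<Longrightarrow>
      on_mor F X Z (Comp C X Y Z g f) = Comp D (on_ob F X) (on_ob F Y) (on_ob F Z) (on_mor F Y Z g) (on_mor F X Y f)"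
  using assms unfolding is_functor_def by blast+

section \<open>The filtered colimit attached to a pro-object\<close>

locale pro_object =
  fixes C :: "('o, 'm) cat" and X :: "('i, 'o, 'm) pro_obj"
  assumes C: "is_category C" and X: "X \<in> Ob (pro_cat C)"
begin

abbreviation "I \<equiv> index X"
abbreviation "ob \<equiv> on_ob (diag X)"
abbreviation "mor \<equiv> on_mor (diag X)"

lemma cofiltered: "cofiltered I" and fdiag: "is_functor I C (diag X)"
  using X by (auto simp: pro_cat_def)

lemma cat_I: "is_category I"
  using cofiltered by (simp add: cofiltered_def)

lemmas CD = is_categoryD[OF C] and ID = is_categoryD[OF cat_I] and FD = is_functorD[OF fdiag]

abbreviation elts :: "'o \<Rightarrow> ('i \<times> 'm) set" where
  "elts A \<equiv> (SIGMA i:Ob I. Hom C (ob i) A)"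

lemma germ_relI:
  assumes "(i, f) \<in> elts A" "(j, g) \<in> elts A" "k \<in> Ob I" "u \<in> Hom I k i" "v \<in> Hom I k j"
    "Comp C (ob k) (ob i) A f (mor k i u) = Comp C (ob k) (ob j) A g (mor k j v)"
  shows "((i, f), (j, g)) \<in> germ_rel C X A"
  using assms by (auto simp: germ_rel_def)

lemma germ_relE:
  assumes "((i, f), (j, g)) \<in> germ_rel C X A"
  obtains k u v where "(i, f) \<in> elts A" "(j, g) \<in> elts A" "k \<in> Ob I" "u \<in> Hom I k i" "v \<in> Hom I k j"
    "Comp C (ob k) (ob i) A f (mor k i u) = Comp C (ob k) (ob j) A g (mor k j v)"
  using assms by (auto simp: germ_rel_def)

lemma refine:
  assumes "A \<in> Ob C" "(i, f) \<in> elts A" "k \<in> Ob I" "u \<in> Hom I k i" "n \<in> Ob I" "x \<in> Hom I n k"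
  shows "Comp C (ob n) (ob i) A f (mor n i (Comp I n k i u x)) =
    Comp C (ob n) (ob k) A (Comp C (ob k) (ob i) A f (mor k i u)) (mor n k x)"
proof -
  have i: "i \<in> Ob I" "f \<in> Hom C (ob i) A" using assms by auto
  show ?thesis
    unfolding FD(4)[OF assms(5,3) i(1) assms(6,4)]
    by (rule CD(5)) (use assms i FD in auto)
qed

lemma germ_equiv:
  assumes A: "A \<in> Ob C"
  shows "equiv (elts A) (germ_rel C X A)"
proof (rule equivI)
  show "germ_rel C X A \<subseteq> elts A \<times> elts A" by (auto simp: germ_rel_def)
  show "refl_on (elts A) (germ_rel C X A)"
  proof (rule refl_onI)
    fix x assume x: "x \<in> elts A"
    obtain i f where xi: "x = (i, f)" by (cases x)
    have "i \<in> Ob I" using x xi by auto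
    then show "(x, x) \<in> germ_rel C X A"
      using x unfolding xi by (intro germ_relI[where k = i and u = "Id I i" and v = "Id I i"] ID) auto
  qed
  show "sym (germ_rel C X A)"
  proof (rule symI)
    fix x y assume "(x, y) \<in> germ_rel C X A"
    moreover obtain i f j g where "x = (i, f)" "y = (j, g)" by (cases x, cases y)
    ultimately have xy: "((i, f), (j, g)) \<in> germ_rel C X A" "x = (i, f)" "y = (j, g)" by auto
    from xy(1) show "(y, x) \<in> germ_rel C X A"
      unfolding xy(2,3) by (elim germ_relE) (auto intro: germ_relI)
  qed
  show "trans (germ_rel C X A)"
  proof (rule transI)
    fix x y z assume 0: "(x, y) \<in> germ_rel C X A" "(y, z) \<in> germ_rel C X A"
    obtain i f j g h l where xyz: "x = (i, f)" "y = (j, g)" "z = (l, h)" by (cases x, cases y, cases z)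
    from 0(1) obtain k u v where k: "(i, f) \<in> elts A" "(j, g) \<in> elts A" "k \<in> Ob I" "u \<in> Hom I k i" "v \<in> Hom I k j"
      "Comp C (ob k) (ob i) A f (mor k i u) = Comp C (ob k) (ob j) A g (mor k j v)"
      unfolding xyz by (rule germ_relE)
    from 0(2) obtain k' u' v' where k': "(j, g) \<in> elts A" "(l, h) \<in> elts A" "k' \<in> Ob I" "u' \<in> Hom I k' j" "v' \<in> Hom I k' l"
      "Comp C (ob k') (ob j) A g (mor k' j u') = Comp C (ob k') (ob l) A h (mor k' l v')"
      unfolding xyz by (rule germ_relE)
    have ijl: "i \<in> Ob I" "j \<in> Ob I" "l \<in> Ob I" using k k' by auto
    \<comment> \<open>Transitivity uses both halves of cofilteredness: \<open>m\<close> lies over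
      \<open>k\<close> and \<open>k'\<close>, and \<open>n\<close> equalises the two resulting maps
      to \<open>j\<close>.\<close>
    obtain m a b where m: "m \<in> Ob I" "a \<in> Hom I m k" "b \<in> Hom I m k'"
      using cofiltered k(3) k'(3) unfolding cofiltered_def by blast
    have vb: "Comp I m k j v a \<in> Hom I m j" "Comp I m k' j u' b \<in> Hom I m j"
      using ID(2) m k k' ijl by blast+
    then obtain n c where n: "n \<in> Ob I" "c \<in> Hom I n m"
      "Comp I n m j (Comp I m k j v a) c = Comp I n m j (Comp I m k' j u' b) c"
      using cofiltered m(1) ijl(2) unfolding cofiltered_def by metis
    define a' b' where "a' = Comp I n m k a c" and "b' = Comp I n m k' b c"
    have ab: "a' \<in> Hom I n k" "b' \<in> Hom I n k'"
      unfolding a'_def b'_def using ID(2) n m k(3) k'(3) by blast+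
    have eq: "Comp I n k j v a' = Comp I n k' j u' b'"
      unfolding a'_def b'_def using n(3)
      by (simp add: ID(5)[OF n(1) m(1) k(3) ijl(2) n(2) m(2) k(5)] ID(5)[OF n(1) m(1) k'(3) ijl(2) n(2) m(3) k'(4)])
    have "Comp C (ob n) (ob i) A f (mor n i (Comp I n k i u a')) = Comp C (ob n) (ob j) A g (mor n j (Comp I n k j v a'))"
      using refine[OF A k(1,3,4) n(1) ab(1)] refine[OF A k(2,3,5) n(1) ab(1)] k(6) by simp
    also have "\<dots> = Comp C (ob n) (ob l) A h (mor n l (Comp I n k' l v' b'))"
      unfolding eq using refine[OF A k'(1,3,4) n(1) ab(2)] refine[OF A k'(2,3,5) n(1) ab(2)] k'(6) by simp
    finally show "(x, z) \<in> germ_rel C X A"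
      unfolding xyz
      by (rule germ_relI[OF k(1) k'(2) n(1) ID(2)[OF n(1) k(3) ijl(1) ab(1) k(4)]
            ID(2)[OF n(1) k'(3) ijl(3) ab(2) k'(5)]])
  qed
qed

lemma germ_in_pro_colim: "(i, f) \<in> elts A \<Longrightarrow> germ C X A i f \<in> pro_colim C X A"
  unfolding germ_def pro_colim_def by (rule quotientI)

lemma pro_colimE:
  assumes "c \<in> pro_colim C X A"
  obtains i f where "(i, f) \<in> elts A" "c = germ C X A i f"
  using assms unfolding germ_def pro_colim_def by (auto elim!: quotientE)

lemma germ_eq_iff:
  assumes "A \<in> Ob C" "(i, f) \<in> elts A" "(j, g) \<in> elts A"
  shows "germ C X A i f = germ C X A j g \<longleftrightarrow> ((i, f), (j, g)) \<in> germ_rel C X A"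
  unfolding germ_def using eq_equiv_class_iff[OF germ_equiv[OF assms(1)] assms(2,3)] .

lemma mem_germ:
  "A \<in> Ob C \<Longrightarrow> (i, f) \<in> elts A \<Longrightarrow> (i, f) \<in> germ C X A i f"
  unfolding germ_def by (rule equiv_class_self[OF germ_equiv])

lemma pro_colim_mem:
  assumes A: "A \<in> Ob C" and c: "c \<in> pro_colim C X A" "(i, f) \<in> c"
  shows "(i, f) \<in> elts A" "c = germ C X A i f"
proof -
  obtain j g where j: "(j, g) \<in> elts A" "c = germ C X A j g" using pro_colimE[OF c(1)] .
  then have r: "((j, g), (i, f)) \<in> germ_rel C X A" using c(2) by (simp add: germ_def)
  then show 1: "(i, f) \<in> elts A" by (auto simp: germ_rel_def)
  show "c = germ C X A i f" using germ_eq_iff[OF A j(1) 1] r j(2) by simp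
qed

text \<open>The union defining \<open>pro_push\<close> runs over all representatives; it is over a
  nonempty class, and each representative contributes the same germ.\<close>

lemma pro_push_germ:
  assumes A: "A \<in> Ob C" and B: "B \<in> Ob C" and g: "g \<in> Hom C A B" and f: "(i, f) \<in> elts A"
  shows "pro_push C X A B g (germ C X A i f) = germ C X B i (Comp C (ob i) A B g f)"
proof -
  have el: "(j, Comp C (ob j) A B g h) \<in> elts B" if "(j, h) \<in> elts A" for j h
    using that FD(1)[of j] CD(2)[of "ob j" A B h g] A B g by auto
  have const: "germ C X B j (Comp C (ob j) A B g h) = germ C X B i (Comp C (ob i) A B g f)"
    if jh: "(j, h) \<in> germ C X A i f" for j h
  proof -
    from jh have r: "((i, f), (j, h)) \<in> germ_rel C X A" by (simp add: germ_def)
    then obtain k u v where k: "(i, f) \<in> elts A" "(j, h) \<in> elts A" "k \<in> Ob I" "u \<in> Hom I k i" "v \<in> Hom I k j"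
      "Comp C (ob k) (ob i) A f (mor k i u) = Comp C (ob k) (ob j) A h (mor k j v)"
      by (rule germ_relE)
    have ij: "i \<in> Ob I" "j \<in> Ob I" using k by auto
    have "Comp C (ob k) (ob i) B (Comp C (ob i) A B g f) (mor k i u) = Comp C (ob k) A B g (Comp C (ob k) (ob i) A f (mor k i u))"
      by (rule CD(5)[symmetric]) (use k ij FD A B g in auto)
    also have "\<dots> = Comp C (ob k) (ob j) B (Comp C (ob j) A B g h) (mor k j v)"
      unfolding k(6) by (rule CD(5)) (use k ij FD A B g in auto)
    finally have "((i, Comp C (ob i) A B g f), (j, Comp C (ob j) A B g h)) \<in> germ_rel C X B"
      by (intro germ_relI[OF el[OF k(1)] el[OF k(2)] k(3,4,5)])
    then show ?thesis using germ_eq_iff[OF B el[OF k(1)] el[OF k(2)]] by simp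
  qed
  have "pro_push C X A B g (germ C X A i f) = (\<Union>x\<in>germ C X A i f. germ C X B i (Comp C (ob i) A B g f))"
    unfolding pro_push_def by (intro SUP_cong refl) (clarify, rule const)
  moreover have "germ C X A i f \<noteq> {}" using mem_germ[OF A f] by blast
  ultimately show ?thesis by (simp only: UN_constant if_False)
qed

lemma pro_push_closed:
  assumes "A \<in> Ob C" "B \<in> Ob C" "g \<in> Hom C A B" "c \<in> pro_colim C X A"
  shows "pro_push C X A B g c \<in> pro_colim C X B"
proof -
  obtain i f where f: "(i, f) \<in> elts A" "c = germ C X A i f" using pro_colimE[OF assms(4)] .
  have "(i, Comp C (ob i) A B g f) \<in> elts B"
    using f FD(1)[of i] CD(2)[of "ob i" A B f g] assms by auto
  then show ?thesis unfolding f(2) pro_push_germ[OF assms(1-3) f(1)] by (rule germ_in_pro_colim)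
qed

lemma pro_push_Id:
  assumes A: "A \<in> Ob C" and c: "c \<in> pro_colim C X A"
  shows "pro_push C X A A (Id C A) c = c"
proof -
  obtain i f where f: "(i, f) \<in> elts A" "c = germ C X A i f" using pro_colimE[OF c] .
  then show ?thesis
    unfolding f(2) pro_push_germ[OF A A CD(1)[OF A] f(1)]
    using CD(4)[of "ob i" A f] FD(1)[of i] A by auto
qed

end

section \<open>Constant pro-objects\<close>

lemma pro_const_simps [simp]:
  "Ob (index (pro_const C R)) = {undefined}" "on_ob (diag (pro_const C R)) j = R"
  by (simp_all add: pro_const_def)

lemma pro_const_Ob:
  assumes C: "is_category C" and R: "R \<in> Ob C"
  shows "pro_const C R \<in> Ob (pro_cat C)"
  using is_categoryD(1,3)[OF C R] is_categoryD(3)[OF C R R]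
  by (auto simp: pro_cat_def pro_const_def cofiltered_def is_category_def is_functor_def R)

text \<open>The only transition map is the identity, so no two different morphisms are
  identified.\<close>

lemma germ_pro_const:
  assumes C: "is_category C" and R: "R \<in> Ob C" and A: "A \<in> Ob C" and f: "f \<in> Hom C R A"
  shows "germ C (pro_const C R) A undefined f = {(undefined, f)}"
proof -
  have "Comp C R R A g (Id C R) = g" if "g \<in> Hom C R A" for g
    by (rule is_categoryD(3)[OF C R A that])
  then show ?thesis using f by (auto simp: germ_def germ_rel_def pro_const_def)
qed

lemma pro_const_mor_hom:
  assumes C: "is_category C" and R: "R \<in> Ob C" and R': "R' \<in> Ob C" and f: "f \<in> Hom C R R'"
  shows "pro_const_mor C R R' f \<in> Hom (pro_cat C) (pro_const C R) (pro_const C R')"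
proof -
  interpret pro_object C "pro_const C R"
    using C pro_const_Ob[OF C R] by unfold_locales
  have "(undefined, f) \<in> elts R'" using f by (simp add: pro_const_def)
  then have "germ C (pro_const C R) R' undefined f \<in> pro_colim C (pro_const C R) R'"
    by (rule germ_in_pro_colim)
  with pro_push_Id[OF R'] show ?thesis
    by (auto simp: pro_cat_def pro_hom_def pro_const_mor_def pro_const_def[of C R'])
qed

text \<open>The limit over a one-point index is a single factor; its compatibility condition
  concerns the identity only.\<close>

lemma pro_hom_const:
  assumes C: "is_category C" and X: "X \<in> Ob (pro_cat C)" and R: "R \<in> Ob C"
  shows "bij_betw (\<lambda>\<phi>. \<phi> undefined) (Hom (pro_cat C) X (pro_const C R)) (pro_colim C X R)"
proof -
  interpret pro_object C X using C X by unfold_locales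
  have H: "Hom (pro_cat C) X (pro_const C R) = ({undefined} \<rightarrow>\<^sub>E pro_colim C X R)"
    using pro_push_Id[OF R] by (auto simp: pro_cat_def pro_hom_def pro_const_def PiE_iff extensional_def)
  show ?thesis
  proof (rule bij_betw_byWitness[where f' = "\<lambda>c. \<lambda>j\<in>{undefined}. c"])
    show "\<forall>\<phi>\<in>Hom (pro_cat C) X (pro_const C R). (\<lambda>j\<in>{undefined}. \<phi> undefined) = \<phi>"
    proof
      fix \<phi> assume "\<phi> \<in> Hom (pro_cat C) X (pro_const C R)"
      then have "\<phi> \<in> extensional {undefined}" unfolding H by (simp add: PiE_iff)
      then show "(\<lambda>j\<in>{undefined}. \<phi> undefined) = \<phi>" by (intro extensionalityI[of _ "{undefined}"]) auto
    qed
  qed (auto simp: H)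
qed

section \<open>The categories of algebras and of formal groups\<close>

lemma is_category_alg_cat: "is_category (alg_cat K)"
proof -
  have 1: "compose (carrier X) g f \<in> alg_hom K X Z" if "f \<in> alg_hom K X Y" "g \<in> alg_hom K Y Z" "Z \<in> Ob (alg_cat K)" "X \<in> Ob (alg_cat K)"
    for X Y Z f g
  proof -
    interpret X: algebra K X using that by (simp add: alg_cat_def)
    have "ring X" by (rule X.ring_axioms)
    have "compose (carrier X) g f \<in> ring_hom X Z"
      using that unfolding alg_hom_def ring_hom_def compose_def by (auto simp: Pi_iff)
    then show ?thesis using that by (auto simp: alg_hom_def compose_def ring_hom_def Pi_iff)
  qed
  have 2: "(\<lambda>x\<in>carrier X. x) \<in> alg_hom K X X" if "X \<in> Ob (alg_cat K)" for X
  proof -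
    interpret X: algebra K X using that by (simp add: alg_cat_def)
    have "ring X" by (rule X.ring_axioms)
    then show ?thesis by (auto simp: alg_hom_def ring_hom_def ring.ring_simprules)
  qed
  show ?thesis
    unfolding is_category_def
  proof (intro conjI ballI)
    fix X Y Z f g assume "X \<in> Ob (alg_cat K)" "Y \<in> Ob (alg_cat K)" "Z \<in> Ob (alg_cat K)"
      "f \<in> Hom (alg_cat K) X Y" "g \<in> Hom (alg_cat K) Y Z"
    then show "Comp (alg_cat K) X Y Z g f \<in> Hom (alg_cat K) X Z"
      using 1[of f X Y g Z] by (simp add: alg_cat_def)
  next
    fix X assume "X \<in> Ob (alg_cat K)"
    then show "Id (alg_cat K) X \<in> Hom (alg_cat K) X X" using 2 by (simp add: alg_cat_def)
  qed (auto simp: alg_cat_def alg_hom_def ring_hom_def compose_def fun_eq_iff extensional_def Pi_iff)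
qed

lemma fgps_simps:
  "Y \<in> Ob (fgps K) \<longleftrightarrow> is_functor (alg_cat K) ab_cat Y \<and> ind_representable K Y"
  "Hom (fgps K) = nat_trans (alg_cat K) ab_cat"
  "Id (fgps K) Y = (\<lambda>X\<in>Ob (alg_cat K). \<lambda>x\<in>carrier (on_ob Y X). x)"
  "Comp (fgps K) F G H \<sigma> \<tau> = (\<lambda>X\<in>Ob (alg_cat K). compose (carrier (on_ob F X)) (\<sigma> X) (\<tau> X))"
  by (simp_all add: fgps_def full_subcat_def functor_cat_def ab_cat_def)

lemma nat_trans_abD:
  assumes "\<tau> \<in> nat_trans (alg_cat K) ab_cat G H" "X \<in> Ob (alg_cat K)"
  shows "\<tau> X \<in> hom (on_ob G X) (on_ob H X)" "\<tau> X \<in> extensional (carrier (on_ob G X))"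
    "x \<in> carrier (on_ob G X) \<Longrightarrow> \<tau> X x \<in> carrier (on_ob H X)"
  using assms by (auto simp: nat_trans_def ab_cat_def PiE_iff hom_def)

lemma nat_trans_ab_natural:
  assumes "\<tau> \<in> nat_trans (alg_cat K) ab_cat G H" "X \<in> Ob (alg_cat K)" "Y \<in> Ob (alg_cat K)"
    "f \<in> Hom (alg_cat K) X Y" "x \<in> carrier (on_ob G X)"
  shows "\<tau> Y (on_mor G X Y f x) = on_mor H X Y f (\<tau> X x)"
proof -
  have "compose (carrier (on_ob G X)) (\<tau> Y) (on_mor G X Y f) = compose (carrier (on_ob G X)) (on_mor H X Y f) (\<tau> X)"
    using assms(1-4) by (auto simp: nat_trans_def ab_cat_def)
  from fun_cong[OF this, of x] show ?thesis using assms(5) by (simp add: compose_def)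
qed

lemma represents_fg:
  assumes "Y \<in> Ob (fgps K)"
  shows "represents K Y (fg_pro K Y) (fg_iso K Y)"
proof -
  have "\<exists>P\<rho>. represents K Y (fst P\<rho>) (snd P\<rho>)"
    using assms by (auto simp: fgps_simps ind_representable_def)
  from someI_ex[OF this] show ?thesis unfolding fg_pro_def fg_iso_def fg_choice_def .
qed

section \<open>Points of a formal group as maps of pro-algebras\<close>

locale fg_yoneda =
  fixes K :: "'k ring" and Y :: "('k, 'a) ab_functor"
  assumes Y: "Y \<in> Ob (fgps K)"
begin

abbreviation "P \<equiv> fg_pro K Y"
abbreviation "\<rho> \<equiv> fg_iso K Y"

lemma P_Ob: "P \<in> Ob (pro_cat (alg_cat K))"
  and rho_bij: "A \<in> Ob (alg_cat K) \<Longrightarrow> bij_betw (\<rho> A) (pro_colim (alg_cat K) P A) (carrier (on_ob Y A))"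
  and rho_nat: "A \<in> Ob (alg_cat K) \<Longrightarrow> B \<in> Ob (alg_cat K) \<Longrightarrow> f \<in> Hom (alg_cat K) A B \<Longrightarrow>
    c \<in> pro_colim (alg_cat K) P A \<Longrightarrow> \<rho> B (pro_push (alg_cat K) P A B f c) = on_mor Y A B f (\<rho> A c)"
  using represents_fg[OF Y] by (auto simp: represents_def pro_alg_cat_def)

sublocale P: pro_object "alg_cat K" P
  by (rule pro_object.intro[OF is_category_alg_cat P_Ob])

lemma rho_mem: "A \<in> Ob (alg_cat K) \<Longrightarrow> c \<in> pro_colim (alg_cat K) P A \<Longrightarrow> \<rho> A c \<in> carrier (on_ob Y A)"
  by (rule bij_betw_apply[OF rho_bij])

text \<open>A morphism from the representing pro-algebra to the constant \<open>R\<close> is an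
  element of the colimit at \<open>R\<close>, hence a point of \<open>Y\<close> over
  \<open>R\<close>.\<close>

definition pt :: "('k, 'a) module \<Rightarrow> ('k, 'a) pro_alg_mor \<Rightarrow> (nat \<Rightarrow> 'a)" where
  "pt R \<phi> = \<rho> R (\<phi> undefined)"

lemma pt_bij:
  assumes "R \<in> Ob (alg_cat K)"
  shows "bij_betw (pt R) (Hom (pro_alg_cat K) P (pro_const (alg_cat K) R)) (carrier (on_ob Y R))"
proof -
  have "bij_betw (\<rho> R \<circ> (\<lambda>\<phi>. \<phi> undefined)) (Hom (pro_alg_cat K) P (pro_const (alg_cat K) R)) (carrier (on_ob Y R))"
    unfolding pro_alg_cat_def
    by (rule bij_betw_trans[OF pro_hom_const[OF is_category_alg_cat P_Ob assms] rho_bij[OF assms]])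
  then show ?thesis by (simp add: pt_def[abs_def] comp_def)
qed

lemma pro_colim_of_hom:
  assumes "R \<in> Ob (alg_cat K)" "\<phi> \<in> Hom (pro_alg_cat K) P (pro_const (alg_cat K) R)"
  shows "\<phi> undefined \<in> pro_colim (alg_cat K) P R"
  using bij_betw_apply[OF pro_hom_const[OF is_category_alg_cat P_Ob assms(1)], of \<phi>] assms(2)
  by (simp add: pro_alg_cat_def)

lemma pt_const_mor:
  assumes R: "R \<in> Ob (alg_cat K)" and R': "R' \<in> Ob (alg_cat K)" and f: "f \<in> Hom (alg_cat K) R R'"
    and \<phi>: "\<phi> \<in> Hom (pro_alg_cat K) P (pro_const (alg_cat K) R)"
  shows "pt R' (Comp (pro_alg_cat K) P (pro_const (alg_cat K) R) (pro_const (alg_cat K) R')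
      (pro_const_mor (alg_cat K) R R' f) \<phi>) = on_mor Y R R' f (pt R \<phi>)"
proof -
  have "Comp (pro_alg_cat K) P (pro_const (alg_cat K) R) (pro_const (alg_cat K) R')
      (pro_const_mor (alg_cat K) R R' f) \<phi> undefined = pro_push (alg_cat K) P R R' f (\<phi> undefined)"
    by (simp add: pro_alg_cat_def pro_cat_def pro_const_mor_def germ_pro_const[OF is_category_alg_cat R R' f])
  then show ?thesis
    unfolding pt_def by (simp add: rho_nat[OF R R' f pro_colim_of_hom[OF R \<phi>]])
qed

end

text \<open>The Yoneda description of \<open>fg_forget\<close> on morphisms at work: precomposition
  with it becomes application of \<open>g\<close> to points, by naturality of \<open>g\<close> and
  of both representing isomorphisms.\<close>

lemma pt_forget:
  fixes K :: "'k ring" and Y Z :: "('k, 'a) ab_functor"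
  assumes Y: "Y \<in> Ob (fgps K)" and Z: "Z \<in> Ob (fgps K)" and g: "g \<in> Hom (fgps K) Y Z"
    and R: "R \<in> Ob (alg_cat K)" and \<phi>: "\<phi> \<in> Hom (pro_alg_cat K) (fg_pro K Y) (pro_const (alg_cat K) R)"
  shows "fg_yoneda.pt K Z R (Comp (pro_alg_cat K) (fg_pro K Z) (fg_pro K Y) (pro_const (alg_cat K) R)
      \<phi> (on_mor (fg_forget K) Y Z g)) = g R (fg_yoneda.pt K Y R \<phi>)"
proof -
  interpret Y: fg_yoneda K Y by unfold_locales (rule Y)
  interpret Z: fg_yoneda K Z by unfold_locales (rule Z)
  let ?C = "alg_cat K :: (('k, 'a) module, 'a \<Rightarrow> 'a) cat"
  have g': "g \<in> nat_trans ?C ab_cat Y Z" using g by (simp add: fgps_simps)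
  define G where "G = on_mor (fg_forget K) Y Z g"
  define r where "r = g R (Y.pt R \<phi>)"
  have \<phi>u: "\<phi> undefined \<in> pro_colim ?C Y.P R" by (rule Y.pro_colim_of_hom[OF R \<phi>])
  have rZ: "r \<in> carrier (on_ob Z R)"
    unfolding r_def Y.pt_def by (intro nat_trans_abD(3)[OF g' R] Y.rho_mem R \<phi>u)
  have inv: "Z.\<rho> A (inv_into (pro_colim ?C Z.P A) (Z.\<rho> A) y) = y"
    "inv_into (pro_colim ?C Z.P A) (Z.\<rho> A) y \<in> pro_colim ?C Z.P A"
    if "A \<in> Ob ?C" "y \<in> carrier (on_ob Z A)" for A y
    using Z.rho_bij[OF that(1)] that(2) by (auto simp: bij_betw_def f_inv_into_f inv_into_into)
  \<comment> \<open>Composition of pro-morphisms is a union over the representatives of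
    \<open>\<phi> undefined\<close>; all of them contribute the class with value
    \<open>r\<close>.\<close>
  have main: "pro_push ?C Z.P (on_ob (diag Y.P) j) R f (G j) = inv_into (pro_colim ?C Z.P R) (Z.\<rho> R) r"
    if jf: "(j, f) \<in> \<phi> undefined" for j f
  proof -
    have el: "(j, f) \<in> Y.P.elts R" and ge: "\<phi> undefined = germ ?C Y.P R j f"
      using Y.P.pro_colim_mem[OF R \<phi>u jf] .
    let ?A = "on_ob (diag Y.P) j"
    have j: "j \<in> Ob (index Y.P)" and f: "f \<in> Hom ?C ?A R" using el by auto
    have A: "?A \<in> Ob ?C" using Y.P.FD(1)[OF j] .
    let ?id = "Id ?C ?A"
    have id: "(j, ?id) \<in> Y.P.elts ?A" using j Y.P.CD(1)[OF A] by auto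
    let ?c = "germ ?C Y.P ?A j ?id"
    have c: "?c \<in> pro_colim ?C Y.P ?A" by (rule Y.P.germ_in_pro_colim[OF id])
    have gc: "g ?A (Y.\<rho> ?A ?c) \<in> carrier (on_ob Z ?A)"
      by (intro nat_trans_abD(3)[OF g' A] Y.rho_mem A c)
    have Gj: "G j = inv_into (pro_colim ?C Z.P ?A) (Z.\<rho> ?A) (g ?A (Y.\<rho> ?A ?c))"
      unfolding G_def fg_forget_def using j by (simp add: Let_def)
    have "Z.\<rho> R (pro_push ?C Z.P ?A R f (G j)) = on_mor Z ?A R f (g ?A (Y.\<rho> ?A ?c))"
      unfolding Gj using Z.rho_nat[OF A R f inv(2)[OF A gc]] inv(1)[OF A gc] by simp
    also have "\<dots> = g R (on_mor Y ?A R f (Y.\<rho> ?A ?c))"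
      by (rule nat_trans_ab_natural[OF g' A R f Y.rho_mem[OF A c], symmetric])
    also have "on_mor Y ?A R f (Y.\<rho> ?A ?c) = Y.\<rho> R (pro_push ?C Y.P ?A R f ?c)"
      by (rule Y.rho_nat[OF A R f c, symmetric])
    also have "pro_push ?C Y.P ?A R f ?c = \<phi> undefined"
      unfolding Y.P.pro_push_germ[OF A R f id] Y.P.CD(3)[OF A R f] ge ..
    also have "g R (Y.\<rho> R (\<phi> undefined)) = r" by (simp add: r_def Y.pt_def)
    finally have "Z.\<rho> R (pro_push ?C Z.P ?A R f (G j)) = Z.\<rho> R (inv_into (pro_colim ?C Z.P R) (Z.\<rho> R) r)"
      using inv(1)[OF R rZ] by simp
    moreover have "pro_push ?C Z.P ?A R f (G j) \<in> pro_colim ?C Z.P R"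
      unfolding Gj by (intro Z.P.pro_push_closed A R f inv gc)
    ultimately show ?thesis
      using Z.rho_bij[OF R] inv(2)[OF R rZ] by (auto simp: bij_betw_def inj_on_def)
  qed
  obtain j f where "(j, f) \<in> \<phi> undefined"
    using Y.P.pro_colimE[OF \<phi>u] Y.P.mem_germ[OF R] by metis
  then have "Comp (pro_alg_cat K) Z.P Y.P (pro_const ?C R) \<phi> G undefined = inv_into (pro_colim ?C Z.P R) (Z.\<rho> R) r"
    using main by (auto simp: pro_alg_cat_def pro_cat_def)
  then show ?thesis
    using inv(1)[OF R rZ] by (simp add: Z.pt_def G_def r_def)
qed

text \<open>A single family \<open>u\<close> is chosen for all \<open>R\<close>; otherwise the last
  clause, naturality in \<open>R\<close>, could not relate the points over \<open>R\<close> and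
  \<open>R'\<close>.\<close>

lemma free_fg_yoneda:
  fixes K :: "'k ring"
    and Fr :: "(('k, 'a) pro_alg, ('k, 'a) pro_alg_mor, ('k, 'a) ab_functor, ('k, 'a) ab_functor_mor) cat_functor"
  assumes Fr: "is_free_fg_functor K Fr" and Y: "Y \<in> Ob (fgps K)"
  shows "\<exists>u. \<forall>R\<in>Ob (alg_cat K). free_fg K Fr R \<in> Ob (fgps K) \<and> u R \<in> carrier (on_ob (free_fg K Fr R) R) \<and>
      bij_betw (\<lambda>\<tau>. \<tau> R (u R)) (Hom (fgps K) (free_fg K Fr R) Y) (carrier (on_ob Y R)) \<and>
      (\<forall>R'\<in>Ob (alg_cat K). \<forall>f\<in>Hom (alg_cat K) R R'. \<forall>\<tau>\<in>Hom (fgps K) (free_fg K Fr R) Y.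
        Comp (fgps K) (free_fg K Fr R') (free_fg K Fr R) Y \<tau> (free_fg_map K Fr R R' f) R' (u R') =
        on_mor Y R R' f (\<tau> R (u R)))"
proof -
  let ?C = "alg_cat K :: (('k, 'a) module, 'a \<Rightarrow> 'a) cat"
  let ?P = "pro_alg_cat K :: (('k, 'a) pro_alg, ('k, 'a) pro_alg_mor) cat"
  let ?O = "op_cat ?P"
  let ?F = "fgps K :: (('k, 'a) ab_functor, ('k, 'a) ab_functor_mor) cat"
  let ?c = "pro_const ?C :: ('k, 'a) module \<Rightarrow> ('k, 'a) pro_alg"
  interpret Y: fg_yoneda K Y by unfold_locales (rule Y)
  from Fr obtain \<theta> where FrF: "is_functor ?O ?F Fr"
    and bij: "\<And>X Y. X \<in> Ob ?O \<Longrightarrow> Y \<in> Ob ?F \<Longrightarrow> bij_betw (\<theta> X Y) (Hom ?F (on_ob Fr X) Y) (Hom ?O X (on_ob (fg_forget K) Y))"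
    and nat: "\<And>X X' Y Y' f g h. X \<in> Ob ?O \<Longrightarrow> X' \<in> Ob ?O \<Longrightarrow> Y \<in> Ob ?F \<Longrightarrow> Y' \<in> Ob ?F \<Longrightarrow>
      f \<in> Hom ?O X' X \<Longrightarrow> g \<in> Hom ?F Y Y' \<Longrightarrow> h \<in> Hom ?F (on_ob Fr X) Y \<Longrightarrow>
      \<theta> X' Y' (Comp ?F (on_ob Fr X') Y Y' g (Comp ?F (on_ob Fr X') (on_ob Fr X) Y h (on_mor Fr X' X f))) =
      Comp ?O X' (on_ob (fg_forget K) Y) (on_ob (fg_forget K) Y') (on_mor (fg_forget K) Y Y' g)
        (Comp ?O X' X (on_ob (fg_forget K) Y) (\<theta> X Y h) f)"
    unfolding is_free_fg_functor_def left_adjoint_def by blast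
  have op: "Ob ?O = Ob ?P" "Hom ?O X X' = Hom ?P X' X" "Id ?O = Id ?P"
    "Comp ?O X X' X'' g f = Comp ?P X'' X' X f g" for X X' X'' f g
    by (simp_all add: op_cat_def)
  have forget: "on_ob (fg_forget K) Z = fg_pro K Z" for Z :: "('k, 'a) ab_functor"
    by (simp add: fg_forget_def)
  have cO: "?c R \<in> Ob ?P" if "R \<in> Ob ?C" for R
    unfolding pro_alg_cat_def by (rule pro_const_Ob[OF is_category_alg_cat that])
  have FrO: "free_fg K Fr R \<in> Ob ?F" if "R \<in> Ob ?C" for R
    unfolding free_fg_def using is_functorD(1)[OF FrF, of "?c R"] cO[OF that] by (simp add: op)
  \<comment> \<open>Naturality of the adjunction is given jointly in both variables. Identities are
    inserted to use one variable at a time, which requires the identity laws for formal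
    groups.\<close>
  have FId: "Id ?F Z \<in> Hom ?F Z Z" if "Z \<in> Ob ?F" for Z
  proof -
    have Z: "is_functor ?C ab_cat Z" using that by (simp add: fgps_simps)
    have 1: "(\<lambda>x\<in>carrier (on_ob Z X). x) \<in> hom (on_ob Z X) (on_ob Z X)" if "X \<in> Ob ?C" for X
    proof -
      have "comm_group (on_ob Z X)" using is_functorD(1)[OF Z that] by (simp add: ab_cat_def)
      then interpret comm_group "on_ob Z X" .
      show ?thesis by (auto simp: hom_def)
    qed
    have 2: "on_mor Z X X' f \<in> hom (on_ob Z X) (on_ob Z X')" if "X \<in> Ob ?C" "X' \<in> Ob ?C" "f \<in> Hom ?C X X'" for X X' f
      using is_functorD(2)[OF Z that] by (simp add: ab_cat_def)
    show ?thesis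
      unfolding fgps_simps nat_trans_def using 1 2
      by (auto simp: ab_cat_def compose_def hom_def Pi_iff fun_eq_iff)
  qed
  have idl: "Comp ?F G H H (Id ?F H) \<tau> = \<tau>" and idr: "Comp ?F G G H \<tau> (Id ?F G) = \<tau>" if "\<tau> \<in> Hom ?F G H" for \<tau> G H
  proof -
    have \<tau>: "\<tau> \<in> nat_trans ?C ab_cat G H" using that by (simp add: fgps_simps)
    then have ext: "\<tau> \<in> extensional (Ob ?C)" by (simp add: nat_trans_def PiE_iff)
    show "Comp ?F G H H (Id ?F H) \<tau> = \<tau>"
      unfolding fgps_simps
    proof (rule extensionalityI[OF _ ext])
      fix X assume X: "X \<in> Ob ?C"
      show "(\<lambda>X\<in>Ob ?C. compose (carrier (on_ob G X)) ((\<lambda>X\<in>Ob ?C. \<lambda>x\<in>carrier (on_ob H X). x) X) (\<tau> X)) X = \<tau> X"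
        using X nat_trans_abD[OF \<tau> X] by (auto simp: compose_def fun_eq_iff extensional_def)
    qed simp
    show "Comp ?F G G H \<tau> (Id ?F G) = \<tau>"
      unfolding fgps_simps
    proof (rule extensionalityI[OF _ ext])
      fix X assume X: "X \<in> Ob ?C"
      show "(\<lambda>X\<in>Ob ?C. compose (carrier (on_ob G X)) (\<tau> X) ((\<lambda>X\<in>Ob ?C. \<lambda>x\<in>carrier (on_ob G X). x) X)) X = \<tau> X"
        using X nat_trans_abD[OF \<tau> X] by (auto simp: compose_def fun_eq_iff extensional_def)
    qed simp
  qed
  have PId: "Id ?P (?c R) \<in> Hom ?P (?c R) (?c R)" "Id ?P (?c R) = pro_const_mor ?C R R (Id ?C R)" if "R \<in> Ob ?C" for R
  proof -
    show eq: "Id ?P (?c R) = pro_const_mor ?C R R (Id ?C R)"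
      by (auto simp: pro_alg_cat_def pro_cat_def pro_const_mor_def intro!: restrict_ext)
    show "Id ?P (?c R) \<in> Hom ?P (?c R) (?c R)"
      unfolding eq unfolding pro_alg_cat_def
      by (intro pro_const_mor_hom is_category_alg_cat that is_categoryD(1)[OF is_category_alg_cat])
  qed
  define pt where "pt = (\<lambda>Y R. fg_yoneda.pt K (Y :: ('k, 'a) ab_functor) R)"
  \<comment> \<open>The adjunction followed by \<open>pt\<close>: morphisms from
    \<open>Fr(R)\<close> to \<open>Y\<close> become points of \<open>Y\<close> over
    \<open>R\<close>.\<close>
  define E where "E Y R \<tau> = pt Y R (\<theta> (?c R) Y \<tau>)" for Y :: "('k, 'a) ab_functor" and R and \<tau>
  have hom: "\<theta> (?c R) Z \<tau> \<in> Hom ?P (fg_pro K Z) (?c R)"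
    if "R \<in> Ob ?C" "Z \<in> Ob ?F" "\<tau> \<in> Hom ?F (free_fg K Fr R) Z" for R Z \<tau>
    using bij_betw_apply[OF bij[of "?c R" Z], of \<tau>] that cO[of R] by (simp add: op forget free_fg_def)
  have E: "E Z' R' (Comp ?F (free_fg K Fr R') Z Z' g (Comp ?F (free_fg K Fr R') (free_fg K Fr R) Z \<tau> (free_fg_map K Fr R R' f)))
      = g R' (on_mor Z R R' f (E Z R \<tau>))"
    if "R \<in> Ob ?C" "R' \<in> Ob ?C" "f \<in> Hom ?C R R'" "Z \<in> Ob ?F" "Z' \<in> Ob ?F" "\<tau> \<in> Hom ?F (free_fg K Fr R) Z"
      "g \<in> Hom ?F Z Z'" for R R' f Z Z' \<tau> g
  proof -
    interpret Z: fg_yoneda K Z by unfold_locales (rule that)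
    have f: "pro_const_mor ?C R R' f \<in> Hom ?P (?c R) (?c R')"
      unfolding pro_alg_cat_def by (rule pro_const_mor_hom[OF is_category_alg_cat that(1,2,3)])
    let ?\<phi> = "\<theta> (?c R) Z \<tau>"
    have h: "?\<phi> \<in> Hom ?P (fg_pro K Z) (?c R)" by (rule hom[OF that(1,4,6)])
    have cf: "Comp ?P (fg_pro K Z) (?c R) (?c R') (pro_const_mor ?C R R' f) ?\<phi> \<in> Hom ?P (fg_pro K Z) (?c R')"
    proof -
      have "Comp ?P (fg_pro K Z) (?c R) (?c R') (pro_const_mor ?C R R' f) ?\<phi> =
          (\<lambda>k\<in>{undefined}. pro_push ?C (fg_pro K Z) R R' f (?\<phi> undefined))"
        by (simp add: pro_alg_cat_def pro_cat_def pro_const_mor_def fun_eq_iff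
            germ_pro_const[OF is_category_alg_cat that(1,2,3)])
      moreover have "pro_push ?C (fg_pro K Z) R R' f (?\<phi> undefined) \<in> pro_colim ?C (fg_pro K Z) R'"
        by (intro Z.P.pro_push_closed that Z.pro_colim_of_hom h)
      ultimately show ?thesis
        using Z.P.pro_push_Id[OF that(2)]
        by (simp add: pro_alg_cat_def pro_cat_def pro_hom_def pro_const_def[of ?C R'])
    qed
    have "\<theta> (?c R') Z' (Comp ?F (free_fg K Fr R') Z Z' g (Comp ?F (free_fg K Fr R') (free_fg K Fr R) Z \<tau> (free_fg_map K Fr R R' f)))
      = Comp ?P (fg_pro K Z') (fg_pro K Z) (?c R') (Comp ?P (fg_pro K Z) (?c R) (?c R') (pro_const_mor ?C R R' f) ?\<phi>)
          (on_mor (fg_forget K) Z Z' g)"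
      using nat[of "?c R" "?c R'" Z Z' "pro_const_mor ?C R R' f" g \<tau>] f that cO by (simp add: op forget free_fg_def free_fg_map_def)
    then have "E Z' R' (Comp ?F (free_fg K Fr R') Z Z' g (Comp ?F (free_fg K Fr R') (free_fg K Fr R) Z \<tau> (free_fg_map K Fr R R' f)))
      = g R' (pt Z R' (Comp ?P (fg_pro K Z) (?c R) (?c R') (pro_const_mor ?C R R' f) ?\<phi>))"
      unfolding E_def pt_def using pt_forget[OF that(4,5,7,2) cf] by simp
    then show ?thesis
      unfolding E_def pt_def using Z.pt_const_mor[OF that(1,2,3) h] by simp
  qed
  have FrId: "free_fg_map K Fr R R (Id ?C R) = Id ?F (free_fg K Fr R)" if "R \<in> Ob ?C" for R
    unfolding free_fg_map_def free_fg_def PId(2)[OF that, symmetric]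
    using is_functorD(3)[OF FrF, of "?c R"] cO[OF that] by (simp add: op)
  have CId: "Id ?C R \<in> Hom ?C R R" if "R \<in> Ob ?C" for R
    by (rule is_categoryD(1)[OF is_category_alg_cat that])
  define u where "u R = E (free_fg K Fr R) R (Id ?F (free_fg K Fr R))" for R
  have u: "u R \<in> carrier (on_ob (free_fg K Fr R) R)" if R: "R \<in> Ob ?C" for R
  proof -
    interpret Z: fg_yoneda K "free_fg K Fr R" by unfold_locales (rule FrO[OF R])
    show ?thesis
      unfolding u_def E_def pt_def by (rule bij_betw_apply[OF Z.pt_bij[OF R] hom[OF R FrO[OF R] FId[OF FrO[OF R]]]])
  qed
  \<comment> \<open>Naturality in the formal group along \<open>\<tau>\<close> itself, applied to
    the identity of \<open>Fr(R)\<close>.\<close>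
  have Eu: "E Y R \<tau> = \<tau> R (u R)" if R: "R \<in> Ob ?C" and \<tau>: "\<tau> \<in> Hom ?F (free_fg K Fr R) Y" for R \<tau>
  proof -
    let ?Z = "free_fg K Fr R"
    have Z: "?Z \<in> Ob ?F" by (rule FrO[OF R])
    have "E Y R (Comp ?F ?Z ?Z Y \<tau> (Comp ?F ?Z ?Z ?Z (Id ?F ?Z) (free_fg_map K Fr R R (Id ?C R))))
        = \<tau> R (on_mor ?Z R R (Id ?C R) (u R))"
      unfolding u_def by (rule E[OF R R CId[OF R] Z Y FId[OF Z] \<tau>])
    moreover have "on_mor ?Z R R (Id ?C R) (u R) = u R"
    proof -
      have "is_functor ?C ab_cat ?Z" using Z by (simp add: fgps_simps)
      then show ?thesis using is_functorD(3)[of ?C ab_cat ?Z R] R u[OF R] by (simp add: ab_cat_def)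
    qed
    ultimately show ?thesis by (simp add: FrId[OF R] idl[OF FId[OF Z]] idr[OF \<tau>])
  qed
  show ?thesis
  proof (intro exI[of _ u] ballI conjI)
    fix R assume R: "R \<in> Ob ?C"
    show "free_fg K Fr R \<in> Ob ?F" by (rule FrO[OF R])
    show "u R \<in> carrier (on_ob (free_fg K Fr R) R)" by (rule u[OF R])
    have "bij_betw (pt Y R \<circ> \<theta> (?c R) Y) (Hom ?F (free_fg K Fr R) Y) (carrier (on_ob Y R))"
    proof (rule bij_betw_trans)
      show "bij_betw (\<theta> (?c R) Y) (Hom ?F (free_fg K Fr R) Y) (Hom ?P (fg_pro K Y) (?c R))"
        using bij[of "?c R" Y] cO[OF R] Y by (simp add: op forget free_fg_def)
      show "bij_betw (pt Y R) (Hom ?P (fg_pro K Y) (?c R)) (carrier (on_ob Y R))"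
        unfolding pt_def by (rule Y.pt_bij[OF R])
    qed
    then have "bij_betw (E Y R) (Hom ?F (free_fg K Fr R) Y) (carrier (on_ob Y R))"
      by (simp add: E_def[abs_def] comp_def)
    then show "bij_betw (\<lambda>\<tau>. \<tau> R (u R)) (Hom ?F (free_fg K Fr R) Y) (carrier (on_ob Y R))"
      using bij_betw_cong[of "Hom ?F (free_fg K Fr R) Y" "E Y R" "\<lambda>\<tau>. \<tau> R (u R)"] Eu[OF R] by blast
    fix R' f \<tau> assume R': "R' \<in> Ob ?C" and f: "f \<in> Hom ?C R R'" and \<tau>: "\<tau> \<in> Hom ?F (free_fg K Fr R) Y"
    let ?\<sigma> = "Comp ?F (free_fg K Fr R') (free_fg K Fr R) Y \<tau> (free_fg_map K Fr R R' f)"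
    have fm: "free_fg_map K Fr R R' f \<in> Hom ?F (free_fg K Fr R') (free_fg K Fr R)"
    proof -
      have "pro_const_mor ?C R R' f \<in> Hom ?P (?c R) (?c R')"
        unfolding pro_alg_cat_def by (rule pro_const_mor_hom[OF is_category_alg_cat R R' f])
      then show ?thesis
        unfolding free_fg_map_def free_fg_def using is_functorD(2)[OF FrF, of "?c R'" "?c R"] cO[OF R] cO[OF R'] by (simp add: op)
    qed
    have fl: "on_mor Y R R' f (\<tau> R (u R)) \<in> carrier (on_ob Y R')"
    proof -
      have "is_functor ?C ab_cat Y" using Y by (simp add: fgps_simps)
      then have "on_mor Y R R' f \<in> hom (on_ob Y R) (on_ob Y R')"
        using is_functorD(2)[of ?C ab_cat Y R R' f] R R' f by (simp add: ab_cat_def)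
      moreover have "\<tau> R (u R) \<in> carrier (on_ob Y R)"
        using nat_trans_abD(3)[of \<tau> K "free_fg K Fr R" Y R] \<tau> R u[OF R] by (simp add: fgps_simps)
      ultimately show ?thesis by (auto simp: hom_def)
    qed
    have \<tau>': "\<tau> \<in> nat_trans ?C ab_cat (free_fg K Fr R) Y" and fm': "free_fg_map K Fr R R' f \<in> nat_trans ?C ab_cat (free_fg K Fr R') (free_fg K Fr R)"
      using \<tau> fm by (simp_all add: fgps_simps)
    have FrF': "is_functor ?C ab_cat (free_fg K Fr R')" "is_functor ?C ab_cat Y" "is_functor ?C ab_cat (free_fg K Fr R)"
      using FrO[OF R'] FrO[OF R] Y by (simp_all add: fgps_simps)
    have \<sigma>: "?\<sigma> \<in> Hom ?F (free_fg K Fr R') Y"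
      unfolding fgps_simps nat_trans_def
    proof (intro CollectI conjI PiE_I ballI)
      fix X assume X: "X \<in> Ob ?C"
      have "compose (carrier (on_ob (free_fg K Fr R') X)) (\<tau> X) (free_fg_map K Fr R R' f X) \<in> hom (on_ob (free_fg K Fr R') X) (on_ob Y X)"
      proof -
        have "comm_group (on_ob (free_fg K Fr R') X)" using is_functorD(1)[OF FrF'(1) X] by (simp add: ab_cat_def)
        then interpret comm_group "on_ob (free_fg K Fr R') X" .
        show ?thesis
          using nat_trans_abD(1)[OF \<tau>' X] nat_trans_abD(1)[OF fm' X] by (auto simp: hom_def compose_def Pi_iff)
      qed
      then show "(\<lambda>X\<in>Ob ?C. compose (carrier (on_ob (free_fg K Fr R') X)) (\<tau> X) (free_fg_map K Fr R R' f X)) X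
          \<in> Hom ab_cat (on_ob (free_fg K Fr R') X) (on_ob Y X)"
        using X by (simp add: ab_cat_def)
      fix X' g assume X': "X' \<in> Ob ?C" and g: "g \<in> Hom ?C X X'"
      have gm: "on_mor (free_fg K Fr R') X X' g x \<in> carrier (on_ob (free_fg K Fr R') X')" if "x \<in> carrier (on_ob (free_fg K Fr R') X)" for x
        using is_functorD(2)[OF FrF'(1) X X' g] that by (auto simp: ab_cat_def hom_def)
      show "Comp ab_cat (on_ob (free_fg K Fr R') X) (on_ob (free_fg K Fr R') X') (on_ob Y X')
          ((\<lambda>X\<in>Ob ?C. compose (carrier (on_ob (free_fg K Fr R') X)) (\<tau> X) (free_fg_map K Fr R R' f X)) X')
          (on_mor (free_fg K Fr R') X X' g) =
        Comp ab_cat (on_ob (free_fg K Fr R') X) (on_ob Y X) (on_ob Y X') (on_mor Y X X' g)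
          ((\<lambda>X\<in>Ob ?C. compose (carrier (on_ob (free_fg K Fr R') X)) (\<tau> X) (free_fg_map K Fr R R' f X)) X)"
        using X X' gm nat_trans_ab_natural[OF fm' X X' g] nat_trans_ab_natural[OF \<tau>' X X' g] nat_trans_abD(3)[OF fm' X]
        by (auto simp: ab_cat_def compose_def intro!: restrict_ext)
    qed simp
    \<comment> \<open>Now naturality in the algebra along \<open>f\<close>, with the identity of
      \<open>Y\<close> as morphism of formal groups.\<close>
    have "E Y R' (Comp ?F (free_fg K Fr R') Y Y (Id ?F Y) ?\<sigma>) = Id ?F Y R' (on_mor Y R R' f (E Y R \<tau>))"
      by (rule E[OF R R' f Y Y \<tau> FId[OF Y]])
    then have "E Y R' ?\<sigma> = on_mor Y R R' f (\<tau> R (u R))"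
      using idl[OF \<sigma>] fl R' by (simp add: Eu[OF R \<tau>] fgps_simps)
    then show "?\<sigma> R' (u R') = on_mor Y R R' f (\<tau> R (u R))"
      using Eu[OF R' \<sigma>] by simp
  qed
qed

section \<open>The nilradical of a finite-dimensional algebra\<close>

context charp_alg
begin

lemma kmod: "kmod K A"
  by (intro kmod.intro K.field_axioms A.module)

sublocale L: kmod K A by (rule kmod)

lemma smult_iota: "c \<in> carrier K \<Longrightarrow> x \<in> carrier A \<Longrightarrow> c \<odot>\<^bsub>A\<^esub> x = iota c \<otimes>\<^bsub>A\<^esub> x"
  by (simp add: iota_def A.smult_assoc2)

lemma nilset_submod: "submod K A (nilset A)"
proof -
  interpret N: ideal "nilset A" A by (rule A.ideal_nilset)
  show ?thesis
    unfolding submod_def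
  proof (intro conjI ballI)
    show "nilset A \<subseteq> carrier A" using N.Icarr by blast
    show "\<zero>\<^bsub>A\<^esub> \<in> nilset A" by (rule N.zero_closed)
    fix x assume x: "x \<in> nilset A"
    show "x \<oplus>\<^bsub>A\<^esub> y \<in> nilset A" if "y \<in> nilset A" for y using x that by (rule N.a_closed)
    fix c assume "c \<in> carrier K"
    then show "c \<odot>\<^bsub>A\<^esub> x \<in> nilset A"
      using x N.Icarr[OF x] by (simp add: smult_iota N.I_l_closed)
  qed
qed

text \<open>
  With generators \<open>b\<close> of the nilradical satisfying \<open>b ^ e b = 0\<close>, an element of its \<open>k\<close>-th power
  is killed by every monomial in the generators whose degree is more than \<open>sum e - k\<close>.
\<close>

lemma nilset_nilpotent:
  assumes "fin_dim K A"
  shows "\<exists>s. ideal_pow A (nilset A) s = {\<zero>\<^bsub>A\<^esub>}"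
proof -
  interpret N: ideal "nilset A" A by (rule A.ideal_nilset)
  obtain B where B: "finite B" "B \<subseteq> nilset A" "nilset A = lspan K A B"
    using L.submod_spanned[OF assms nilset_submod] by blast
  have "\<forall>b\<in>B. \<exists>n::nat. b [^]\<^bsub>A\<^esub> n = \<zero>\<^bsub>A\<^esub>" using B(2) unfolding nilset_def by blast
  from bchoice[OF this] obtain e :: "'a \<Rightarrow> nat" where e: "\<forall>b\<in>B. b [^]\<^bsub>A\<^esub> e b = \<zero>\<^bsub>A\<^esub>" ..
  have BA: "b \<in> carrier A" if "b \<in> B" for b using that B(2) N.Icarr by blast
  define mon where "mon c = (\<Otimes>\<^bsub>A\<^esub>b\<in>B. b [^]\<^bsub>A\<^esub> (c b :: nat))" for c
  have mon_closed: "mon c \<in> carrier A" for c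
    unfolding mon_def by (intro A.finprod_closed) (auto simp: BA)
  have split: "mon c = b [^]\<^bsub>A\<^esub> c b \<otimes>\<^bsub>A\<^esub> (\<Otimes>\<^bsub>A\<^esub>b\<in>B - {b}. b [^]\<^bsub>A\<^esub> c b)" if "b \<in> B" for b c
  proof -
    have "insert b (B - {b}) = B" using that by blast
    then have "mon c = (\<Otimes>\<^bsub>A\<^esub>b\<in>insert b (B - {b}). b [^]\<^bsub>A\<^esub> c b)" by (simp only: mon_def)
    also have "\<dots> = b [^]\<^bsub>A\<^esub> c b \<otimes>\<^bsub>A\<^esub> (\<Otimes>\<^bsub>A\<^esub>b\<in>B - {b}. b [^]\<^bsub>A\<^esub> c b)"
      by (rule A.finprod_insert) (use B(1) that BA in auto)
    finally show ?thesis .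
  qed
  have rest: "(\<Otimes>\<^bsub>A\<^esub>b\<in>B - {b}. b [^]\<^bsub>A\<^esub> c b) \<in> carrier A" for b and c :: "'a \<Rightarrow> nat"
    by (intro A.finprod_closed) (auto simp: BA)
  have mon_Suc: "mon (c(b := Suc (c b))) = b \<otimes>\<^bsub>A\<^esub> mon c" if "b \<in> B" for b c
  proof -
    have "(\<Otimes>\<^bsub>A\<^esub>v\<in>B - {b}. v [^]\<^bsub>A\<^esub> (c(b := Suc (c b))) v) = (\<Otimes>\<^bsub>A\<^esub>v\<in>B - {b}. v [^]\<^bsub>A\<^esub> c v)"
      by (intro A.finprod_cong') (auto simp: BA)
    then show ?thesis
      using split[OF that, of c] split[OF that, of "c(b := Suc (c b))"] BA[OF that] rest
      by (simp add: A.m_ac)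
  qed
  have mon_zero: "mon c = \<zero>\<^bsub>A\<^esub>" if "b \<in> B" "e b \<le> c b" for b c
  proof -
    have "b [^]\<^bsub>A\<^esub> c b = \<zero>\<^bsub>A\<^esub>"
      by (rule A.nat_pow_eq_zero_mono[OF BA[OF that(1)] _ that(2)]) (use e that in auto)
    then show ?thesis unfolding split[OF that(1)] using rest by simp
  qed
  have claim: "x \<otimes>\<^bsub>A\<^esub> mon c = \<zero>\<^bsub>A\<^esub>" if "x \<in> ideal_pow A (nilset A) k" "sum e B < k + sum c B" for x c k
    using that
  proof (induction k arbitrary: x c)
    case 0
    have "\<exists>b\<in>B. e b \<le> c b"
    proof (rule ccontr)
      assume "\<not> ?thesis"
      then have "sum c B \<le> sum e B" by (intro sum_mono) auto
      then show False using 0 by simp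
    qed
    then have "mon c = \<zero>\<^bsub>A\<^esub>" using mon_zero by blast
    then show ?case using 0 by simp
  next
    case (Suc k)
    interpret Nk: ideal "ideal_pow A (nilset A) k" A
      by (rule A.ideal_ideal_pow[OF A.ideal_nilset])
    have "x \<in> ideal_prod A (nilset A) (ideal_pow A (nilset A) k)" using Suc.prems(1) by simp
    then have "x \<in> carrier A \<and> x \<otimes>\<^bsub>A\<^esub> mon c = \<zero>\<^bsub>A\<^esub>"
    proof induction
      case (prod i z)
      have z: "z \<in> carrier A" using prod Nk.Icarr by blast
      \<comment> \<open>The annihilator of \<open>z * mon c\<close> is a submodule, so only the
        generators \<open>b\<close> matter. For these the factor \<open>b\<close> raises the degree
        of the monomial by one, while \<open>z\<close> lies in the \<open>k\<close>-th
        power.\<close>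
      define S where "S = {i \<in> carrier A. i \<otimes>\<^bsub>A\<^esub> (z \<otimes>\<^bsub>A\<^esub> mon c) = \<zero>\<^bsub>A\<^esub>}"
      have "submod K A S"
        unfolding submod_def S_def using z mon_closed[of c]
        by (auto simp: A.l_distr A.smult_assoc2 smult_iota A.m_assoc)
      moreover have "B \<subseteq> S"
      proof
        fix b assume b: "b \<in> B"
        have "b \<otimes>\<^bsub>A\<^esub> (z \<otimes>\<^bsub>A\<^esub> mon c) = z \<otimes>\<^bsub>A\<^esub> mon (c(b := Suc (c b)))"
          unfolding mon_Suc[OF b] using z BA[OF b] mon_closed[of c] by (simp add: A.m_ac)
        also have "\<dots> = \<zero>\<^bsub>A\<^esub>"
        proof (rule Suc.IH[OF prod(2)])
          have "sum (c(b := Suc (c b))) B = Suc (sum c B)"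
            using b B(1) by (simp add: sum.remove[of B b])
          then show "sum e B < k + sum (c(b := Suc (c b))) B" using Suc.prems(2) by simp
        qed
        finally show "b \<in> S" using BA[OF b] by (simp add: S_def)
      qed
      ultimately have "i \<in> S" using L.lspan_least[OF B(1)] prod(1) B(3) by blast
      then show ?case using z mon_closed[of c] by (auto simp: S_def A.m_assoc)
    next
      case (sum x y)
      then show ?case using mon_closed[of c] by (auto simp: A.l_distr)
    qed
    then show ?case by simp
  qed
  \<comment> \<open>For the empty monomial the condition of \<open>claim\<close> becomes
    \<open>sum e B < s\<close>.\<close>
  define s where "s = Suc (sum e B)"
  interpret Ns: ideal "ideal_pow A (nilset A) s" A
    by (rule A.ideal_ideal_pow[OF A.ideal_nilset])
  have "x = \<zero>\<^bsub>A\<^esub>" if x: "x \<in> ideal_pow A (nilset A) s" for x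
  proof -
    have "mon (\<lambda>_. 0) = \<one>\<^bsub>A\<^esub>" unfolding mon_def by (simp add: A.finprod_one_eqI)
    then show ?thesis using claim[OF x, of "\<lambda>_. 0"] Ns.Icarr[OF x] by (simp add: s_def)
  qed
  then have "ideal_pow A (nilset A) s = {\<zero>\<^bsub>A\<^esub>}" using Ns.zero_closed by blast
  then show ?thesis ..
qed

end

context perf_field
begin

abbreviation AC :: "(('k, 'a) module, 'a \<Rightarrow> 'a) cat" where
  "AC \<equiv> alg_cat K"

lemma AC_simps:
  "A \<in> Ob AC \<longleftrightarrow> algebra K A \<and> fin_dim K A" "Hom AC = alg_hom K"
  "Id AC A = (\<lambda>x\<in>carrier A. x)" "Comp AC A B D g f = compose (carrier A) g f"
  by (simp_all add: alg_cat_def)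

lemma charp_alg_Ob: "A \<in> Ob AC \<Longrightarrow> charp_alg p K A"
  by (intro charp_alg.intro perf_field_axioms charp_alg_axioms.intro) (simp add: AC_simps)

lemma cw_alg_Ob: "A \<in> Ob AC \<Longrightarrow> \<exists>s. cw_alg p K A s"
  using charp_alg_Ob[of A] charp_alg.nilset_nilpotent[OF charp_alg_Ob, of A]
  by (auto simp: AC_simps cw_alg_def cw_alg_axioms_def)

lemma CW_mem:
  "A \<in> Ob AC \<Longrightarrow> a \<in> carrier (CW p K A) \<longleftrightarrow> (\<forall>n. a n \<in> carrier A) \<and> (\<exists>r. \<forall>n\<ge>r. a n \<in> nilset A)"
  using cw_alg_Ob cw_alg.CW_carrier by metis

lemma cw_alg_hom_Ob:
  "A \<in> Ob AC \<Longrightarrow> B \<in> Ob AC \<Longrightarrow> f \<in> Hom AC A B \<Longrightarrow> \<exists>s s'. cw_alg_hom p K A B s s' f"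
  using cw_alg_Ob[of A] cw_alg_Ob[of B] by (auto simp: cw_alg_hom_def cw_alg_hom_axioms_def AC_simps)

end

section \<open>Subalgebras and products\<close>

definition subalg :: "'k ring \<Rightarrow> ('k, 'a) module \<Rightarrow> 'a set \<Rightarrow> bool" where
  "subalg K A S \<longleftrightarrow> S \<subseteq> carrier A \<and> \<one>\<^bsub>A\<^esub> \<in> S \<and> (\<forall>x\<in>S. \<forall>y\<in>S. x \<oplus>\<^bsub>A\<^esub> y \<in> S \<and> x \<otimes>\<^bsub>A\<^esub> y \<in> S) \<and>
     (\<forall>c\<in>carrier K. \<forall>x\<in>S. c \<odot>\<^bsub>A\<^esub> x \<in> S)"

lemma restrict_carrier_simps:
  "carrier (A\<lparr>carrier := S\<rparr>) = S" "mult (A\<lparr>carrier := S\<rparr>) = mult A" "one (A\<lparr>carrier := S\<rparr>) = one A"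
  "zero (A\<lparr>carrier := S\<rparr>) = zero A" "add (A\<lparr>carrier := S\<rparr>) = add A" "smult (A\<lparr>carrier := S\<rparr>) = smult A"
  by simp_all

text \<open>Finite dimension is the point: the subalgebra has finitely many generators as a
  subspace, and a subspace of the restricted algebra is one of \<open>A\<close>, so they still
  span.\<close>

lemma (in charp_alg) subalg_Ob:
  assumes fd: "fin_dim K A" and S: "subalg K A S"
  shows "A\<lparr>carrier := S\<rparr> \<in> Ob (alg_cat K)"
proof -
  have sub: "\<And>x. x \<in> S \<Longrightarrow> x \<in> carrier A" and one: "\<one>\<^bsub>A\<^esub> \<in> S"
    and add: "\<And>x y. x \<in> S \<Longrightarrow> y \<in> S \<Longrightarrow> x \<oplus>\<^bsub>A\<^esub> y \<in> S"
    and mult: "\<And>x y. x \<in> S \<Longrightarrow> y \<in> S \<Longrightarrow> x \<otimes>\<^bsub>A\<^esub> y \<in> S"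
    and smult: "\<And>c x. c \<in> carrier K \<Longrightarrow> x \<in> S \<Longrightarrow> c \<odot>\<^bsub>A\<^esub> x \<in> S"
    using S by (auto simp: subalg_def)
  have zero: "\<zero>\<^bsub>A\<^esub> \<in> S" using smult[OF K.zero_closed one] by simp
  have neg: "\<exists>y\<in>S. y \<oplus>\<^bsub>A\<^esub> x = \<zero>\<^bsub>A\<^esub>" if "x \<in> S" for x
  proof
    show "(\<ominus>\<^bsub>K\<^esub> \<one>\<^bsub>K\<^esub>) \<odot>\<^bsub>A\<^esub> x \<in> S" by (intro smult that) simp
    show "(\<ominus>\<^bsub>K\<^esub> \<one>\<^bsub>K\<^esub>) \<odot>\<^bsub>A\<^esub> x \<oplus>\<^bsub>A\<^esub> x = \<zero>\<^bsub>A\<^esub>"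
      using sub[OF that] by (simp add: A.smult_l_minus A.M.l_neg)
  qed
  have alg: "algebra K (A\<lparr>carrier := S\<rparr>)"
  proof (rule algebraI)
    show "cring K" by (rule K.is_cring)
    show "cring (A\<lparr>carrier := S\<rparr>)"
    proof (rule cringI)
      show "abelian_group (A\<lparr>carrier := S\<rparr>)"
        by (rule abelian_groupI) (use add zero sub neg in \<open>auto simp: A.M.a_ac\<close>)
      show "comm_monoid (A\<lparr>carrier := S\<rparr>)"
        by (rule comm_monoidI) (use mult one sub in \<open>auto simp: A.m_ac\<close>)
    qed (use sub in \<open>auto simp: A.l_distr\<close>)
  qed (use smult sub in \<open>auto simp: A.smult_l_distr A.smult_r_distr A.smult_assoc1 A.smult_assoc2\<close>)
  have "submod K A S" using sub zero add smult by (auto simp: submod_def)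
  then obtain B where B: "finite B" "B \<subseteq> S" "S = lspan K A B" using L.submod_spanned[OF fd] by blast
  interpret S: kmod K "A\<lparr>carrier := S\<rparr>"
    by (intro kmod.intro K.field_axioms algebra.module[OF alg])
  have "spanning K (A\<lparr>carrier := S\<rparr>) B"
    unfolding spanning_def
  proof (intro conjI allI impI)
    fix W assume W: "submod K (A\<lparr>carrier := S\<rparr>) W \<and> B \<subseteq> W"
    then have "submod K A W" using sub by (auto simp: submod_def)
    then show "carrier (A\<lparr>carrier := S\<rparr>) \<subseteq> W" using L.lspan_least[OF B(1)] B(3) W by auto
  qed (use B in simp)
  then have "fin_dim K (A\<lparr>carrier := S\<rparr>)"
    unfolding S.fin_dim_spanning by (intro exI[of _ B] conjI B(1))
  then show ?thesis using alg by (simp add: alg_cat_def)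
qed

definition genalg :: "'k ring \<Rightarrow> ('k, 'a) module \<Rightarrow> (nat \<Rightarrow> 'a) \<Rightarrow> 'a set" where
  "genalg K A a = \<Inter>{S. subalg K A S \<and> range a \<subseteq> S}"

context perf_field
begin

lemma subalg_carrier: "A \<in> Ob AC \<Longrightarrow> subalg K A (carrier A)"
proof -
  assume "A \<in> Ob AC"
  then interpret charp_alg p K A by (rule charp_alg_Ob)
  show ?thesis by (auto simp: subalg_def)
qed

lemma genalg:
  assumes "A \<in> Ob AC" "range a \<subseteq> carrier A"
  shows "subalg K A (genalg K A a)" "range a \<subseteq> genalg K A a"
proof -
  have "genalg K A a \<subseteq> carrier A" using subalg_carrier assms by (auto simp: genalg_def)
  then show "subalg K A (genalg K A a)" by (auto simp: subalg_def genalg_def)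
  show "range a \<subseteq> genalg K A a" by (auto simp: genalg_def)
qed

lemma genalg_restrict:
  assumes S: "subalg K A S" and a: "range a \<subseteq> S"
  shows "genalg K A a \<subseteq> genalg K (A\<lparr>carrier := S\<rparr>) a"
proof -
  have "subalg K A T" if "subalg K (A\<lparr>carrier := S\<rparr>) T" for T
    using that S unfolding subalg_def restrict_carrier_simps by blast
  then show ?thesis unfolding genalg_def by blast
qed

text \<open>The equaliser is a subalgebra. This rigidity makes the index category of
  \<open>cw_rep\<close> a preorder.\<close>

lemma alg_hom_eqI:
  assumes A: "A \<in> Ob AC" and B: "B \<in> Ob AC" and f: "f \<in> Hom AC A B" and g: "g \<in> Hom AC A B"
    and a: "range a \<subseteq> carrier A" "carrier A \<subseteq> genalg K A a" and eq: "\<And>n. f (a n) = g (a n)"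
  shows "f = g"
proof -
  interpret A: charp_alg p K A by (rule charp_alg_Ob[OF A])
  have "subalg K A {x \<in> carrier A. f x = g x}"
    using f g by (auto simp: subalg_def AC_simps alg_hom_def ring_hom_def)
  moreover have "range a \<subseteq> {x \<in> carrier A. f x = g x}" using a(1) eq by auto
  ultimately have "genalg K A a \<subseteq> {x \<in> carrier A. f x = g x}" unfolding genalg_def by blast
  then have "\<And>x. x \<in> carrier A \<Longrightarrow> f x = g x" using a(2) by blast
  then show ?thesis
    using f g by (intro extensionalityI[of f "carrier A" g]) (auto simp: AC_simps alg_hom_def)
qed

lemma nilset_restrict: "S \<subseteq> carrier A \<Longrightarrow> nilset (A\<lparr>carrier := S\<rparr>) = nilset A \<inter> S"
  by (auto simp: nilset_def nat_pow_def)

lemma ex_generated: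
  assumes A: "A \<in> Ob AC" and a: "a \<in> carrier (CW p K A)"
  shows "\<exists>S. A\<lparr>carrier := S\<rparr> \<in> Ob AC \<and> a \<in> carrier (CW p K (A\<lparr>carrier := S\<rparr>)) \<and>
    S \<subseteq> genalg K (A\<lparr>carrier := S\<rparr>) a \<and> (\<lambda>x\<in>S. x) \<in> Hom AC (A\<lparr>carrier := S\<rparr>) A"
proof -
  interpret A: charp_alg p K A by (rule charp_alg_Ob[OF A])
  have ra: "range a \<subseteq> carrier A" using a by (auto simp: CW_mem[OF A])
  define S where "S = genalg K A a"
  have S: "subalg K A S" "range a \<subseteq> S" using genalg[OF A ra] by (simp_all add: S_def)
  then have sub: "S \<subseteq> carrier A" by (simp add: subalg_def)
  have Ob: "A\<lparr>carrier := S\<rparr> \<in> Ob AC"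
    using A by (intro A.subalg_Ob S) (simp add: AC_simps)
  moreover have "a \<in> carrier (CW p K (A\<lparr>carrier := S\<rparr>))"
    using a S(2) unfolding CW_mem[OF Ob] CW_mem[OF A] nilset_restrict[OF sub] by auto
  moreover have "S \<subseteq> genalg K (A\<lparr>carrier := S\<rparr>) a"
    using genalg_restrict[OF S] by (simp add: S_def)
  moreover have "(\<lambda>x\<in>S. x) \<in> Hom AC (A\<lparr>carrier := S\<rparr>) A"
    using S sub by (auto simp: AC_simps alg_hom_def ring_hom_def subalg_def subset_iff)
  ultimately show ?thesis by blast
qed

end

text \<open>Carriers have to be subsets of \<open>'a\<close>, so pairs are encoded by an injection
  \<open>e\<close>.\<close>

definition prod_alg :: "('a \<times> 'a \<Rightarrow> 'a) \<Rightarrow> ('k, 'a) module \<Rightarrow> ('k, 'a) module \<Rightarrow> ('k, 'a) module" where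
  "prod_alg e A B = (let d = inv_into UNIV e in
     \<lparr>carrier = e ` (carrier A \<times> carrier B),
      mult = (\<lambda>u v. e (fst (d u) \<otimes>\<^bsub>A\<^esub> fst (d v), snd (d u) \<otimes>\<^bsub>B\<^esub> snd (d v))),
      one = e (\<one>\<^bsub>A\<^esub>, \<one>\<^bsub>B\<^esub>),
      zero = e (\<zero>\<^bsub>A\<^esub>, \<zero>\<^bsub>B\<^esub>),
      add = (\<lambda>u v. e (fst (d u) \<oplus>\<^bsub>A\<^esub> fst (d v), snd (d u) \<oplus>\<^bsub>B\<^esub> snd (d v))),
      smult = (\<lambda>c u. e (c \<odot>\<^bsub>A\<^esub> fst (d u), c \<odot>\<^bsub>B\<^esub> snd (d u)))\<rparr>)"

lemma prod_alg_simps: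
  assumes "inj e"
  shows "carrier (prod_alg e A B) = e ` (carrier A \<times> carrier B)"
    "e (x, y) \<otimes>\<^bsub>prod_alg e A B\<^esub> e (x', y') = e (x \<otimes>\<^bsub>A\<^esub> x', y \<otimes>\<^bsub>B\<^esub> y')"
    "\<one>\<^bsub>prod_alg e A B\<^esub> = e (\<one>\<^bsub>A\<^esub>, \<one>\<^bsub>B\<^esub>)" "\<zero>\<^bsub>prod_alg e A B\<^esub> = e (\<zero>\<^bsub>A\<^esub>, \<zero>\<^bsub>B\<^esub>)"
    "e (x, y) \<oplus>\<^bsub>prod_alg e A B\<^esub> e (x', y') = e (x \<oplus>\<^bsub>A\<^esub> x', y \<oplus>\<^bsub>B\<^esub> y')"
    "c \<odot>\<^bsub>prod_alg e A B\<^esub> e (x, y) = e (c \<odot>\<^bsub>A\<^esub> x, c \<odot>\<^bsub>B\<^esub> y)"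
  using assms by (simp_all add: prod_alg_def Let_def inv_f_f)

context perf_field
begin

lemma prod_alg_Ob:
  assumes ie: "inj e" and A: "A \<in> Ob AC" and B: "B \<in> Ob AC"
  shows "prod_alg e A B \<in> Ob AC"
proof -
  interpret A: charp_alg p K A by (rule charp_alg_Ob[OF A])
  interpret B: charp_alg p K B by (rule charp_alg_Ob[OF B])
  note ps = prod_alg_simps[OF ie]
  let ?P = "prod_alg e A B"
  have P: "\<exists>x\<in>carrier A. \<exists>y\<in>carrier B. u = e (x, y)" if "u \<in> carrier ?P" for u
    using that by (auto simp: ps)
  have c: "e (x, y) \<in> carrier ?P \<longleftrightarrow> x \<in> carrier A \<and> y \<in> carrier B" for x y
    by (simp add: ps inj_image_mem_iff[OF ie])
  have alg: "algebra K ?P"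
  proof (rule algebraI)
    show "cring K" by (rule K.is_cring)
    show "cring ?P"
    proof (rule cringI)
      show "abelian_group ?P"
      proof (rule abelian_groupI)
        fix u assume "u \<in> carrier ?P"
        then obtain x y where xy: "x \<in> carrier A" "y \<in> carrier B" "u = e (x, y)" using P by blast
        then show "\<exists>v\<in>carrier ?P. v \<oplus>\<^bsub>?P\<^esub> u = \<zero>\<^bsub>?P\<^esub>"
          by (intro bexI[of _ "e (\<ominus>\<^bsub>A\<^esub> x, \<ominus>\<^bsub>B\<^esub> y)"]) (auto simp: c ps(2-) A.A.M.l_neg B.A.M.l_neg)
      qed (auto dest!: P simp: c ps(2-) A.A.M.a_ac B.A.M.a_ac)
      show "comm_monoid ?P"
        by (rule comm_monoidI) (auto dest!: P simp: c ps(2-) A.A.m_ac B.A.m_ac)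
    qed (auto dest!: P simp: c ps(2-) A.A.l_distr B.A.l_distr)
  qed (auto dest!: P simp: c ps(2-) A.A.smult_l_distr A.A.smult_r_distr A.A.smult_assoc1 A.A.smult_assoc2
      B.A.smult_l_distr B.A.smult_r_distr B.A.smult_assoc1 B.A.smult_assoc2)
  interpret P: kmod K ?P
    by (intro kmod.intro K.field_axioms algebra.module[OF alg])
  obtain S where S: "finite S" "spanning K A S" using A A.L.fin_dim_spanning by (auto simp: AC_simps)
  obtain T where T: "finite T" "spanning K B T" using B B.L.fin_dim_spanning by (auto simp: AC_simps)
  let ?G = "(\<lambda>x. e (x, \<zero>\<^bsub>B\<^esub>)) ` S \<union> (\<lambda>y. e (\<zero>\<^bsub>A\<^esub>, y)) ` T"
  have "spanning K ?P ?G"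
    unfolding spanning_def
  proof (intro conjI allI impI)
    show "?G \<subseteq> carrier ?P" using S(2) T(2) by (auto simp: spanning_def c)
    fix W assume W: "submod K ?P W \<and> ?G \<subseteq> W"
    then have D: "submod K ?P W" ..
    note D = P.submodD[OF D]
    have "submod K A {x \<in> carrier A. e (x, \<zero>\<^bsub>B\<^esub>) \<in> W}"
    proof -
      have "e (x \<oplus>\<^bsub>A\<^esub> y, \<zero>\<^bsub>B\<^esub>) \<in> W" if "e (x, \<zero>\<^bsub>B\<^esub>) \<in> W" "e (y, \<zero>\<^bsub>B\<^esub>) \<in> W" for x y
        using D(3)[OF that] by (simp add: ps)
      moreover have "e (k \<odot>\<^bsub>A\<^esub> x, \<zero>\<^bsub>B\<^esub>) \<in> W" if "k \<in> carrier K" "e (x, \<zero>\<^bsub>B\<^esub>) \<in> W" for k x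
        using D(4)[OF that] that(1) by (simp add: ps)
      ultimately show ?thesis using D(2) unfolding submod_def by (auto simp: ps)
    qed
    then have 1: "e (x, \<zero>\<^bsub>B\<^esub>) \<in> W" if "x \<in> carrier A" for x
      using S(2) W that unfolding spanning_def by blast
    have "submod K B {y \<in> carrier B. e (\<zero>\<^bsub>A\<^esub>, y) \<in> W}"
    proof -
      have "e (\<zero>\<^bsub>A\<^esub>, x \<oplus>\<^bsub>B\<^esub> y) \<in> W" if "e (\<zero>\<^bsub>A\<^esub>, x) \<in> W" "e (\<zero>\<^bsub>A\<^esub>, y) \<in> W" for x y
        using D(3)[OF that] by (simp add: ps)
      moreover have "e (\<zero>\<^bsub>A\<^esub>, k \<odot>\<^bsub>B\<^esub> x) \<in> W" if "k \<in> carrier K" "e (\<zero>\<^bsub>A\<^esub>, x) \<in> W" for k x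
        using D(4)[OF that] that(1) by (simp add: ps)
      ultimately show ?thesis using D(2) unfolding submod_def by (auto simp: ps)
    qed
    then have 2: "e (\<zero>\<^bsub>A\<^esub>, y) \<in> W" if "y \<in> carrier B" for y
      using T(2) W that unfolding spanning_def by blast
    show "carrier ?P \<subseteq> W"
    proof
      fix u assume "u \<in> carrier ?P"
      then obtain x y where xy: "x \<in> carrier A" "y \<in> carrier B" "u = e (x, y)" using P by blast
      then have "u = e (x, \<zero>\<^bsub>B\<^esub>) \<oplus>\<^bsub>?P\<^esub> e (\<zero>\<^bsub>A\<^esub>, y)" by (simp add: ps)
      then show "u \<in> W" using D(3) 1 2 xy by auto
    qed
  qed
  moreover have "finite ?G" using S(1) T(1) by simp
  ultimately have "fin_dim K ?P" unfolding P.fin_dim_spanning by (intro exI[of _ ?G] conjI)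
  then show ?thesis using alg by (simp add: AC_simps)
qed

text \<open>Two elements of \<open>CW\<close> have a common source, the covector of pairs on the
  product algebra; this is what cofilteredness needs.\<close>

lemma ex_product:
  fixes e :: "'a \<times> 'a \<Rightarrow> 'a" and A B :: "('k, 'a) module"
  assumes ie: "inj e" and A: "A \<in> Ob AC" and B: "B \<in> Ob AC"
    and a: "a \<in> carrier (CW p K A)" and b: "b \<in> carrier (CW p K B)"
  shows "\<exists>P\<in>Ob AC. \<exists>c\<in>carrier (CW p K P). \<exists>f\<in>Hom AC P A. \<exists>g\<in>Hom AC P B.
    (\<forall>n. f (c n) = a n) \<and> (\<forall>n. g (c n) = b n)"
proof -
  interpret A: charp_alg p K A by (rule charp_alg_Ob[OF A])
  interpret B: charp_alg p K B by (rule charp_alg_Ob[OF B])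
  note ps = prod_alg_simps[OF ie]
  let ?P = "prod_alg e A B"
  have Ob: "?P \<in> Ob AC" by (rule prod_alg_Ob[OF ie A B])
  interpret P: charp_alg p K ?P by (rule charp_alg_Ob[OF Ob])
  have d: "inv_into UNIV e (e u) = u" for u using ie by (simp add: inv_f_f)
  have pw: "e (x, y) [^]\<^bsub>?P\<^esub> n = e (x [^]\<^bsub>A\<^esub> n, y [^]\<^bsub>B\<^esub> n)" for x y and n :: nat
    by (induction n) (simp_all add: ps)
  have nil: "e (x, y) \<in> nilset ?P" if xy: "x \<in> nilset A" "y \<in> nilset B" for x y
  proof -
    obtain n m :: nat where n: "x \<in> carrier A" "y \<in> carrier B" "x [^]\<^bsub>A\<^esub> n = \<zero>\<^bsub>A\<^esub>" "y [^]\<^bsub>B\<^esub> m = \<zero>\<^bsub>B\<^esub>"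
      using xy by (auto simp: nilset_def)
    have "e (x, y) [^]\<^bsub>?P\<^esub> (n + m) = \<zero>\<^bsub>?P\<^esub>"
      unfolding pw ps(4) using A.A.nat_pow_eq_zero_mono[OF n(1,3), of "n + m"] B.A.nat_pow_eq_zero_mono[OF n(2,4), of "n + m"] by simp
    moreover have "e (x, y) \<in> carrier ?P" using n by (simp add: ps)
    ultimately show ?thesis unfolding nilset_def by blast
  qed
  define c where "c n = e (a n, b n)" for n
  from a obtain r where r: "\<forall>n. a n \<in> carrier A" "\<forall>n\<ge>r. a n \<in> nilset A" by (auto simp: CW_mem[OF A])
  from b obtain s where s: "\<forall>n. b n \<in> carrier B" "\<forall>n\<ge>s. b n \<in> nilset B" by (auto simp: CW_mem[OF B])
  have "c n \<in> carrier ?P" for n using r s by (simp add: c_def ps)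
  moreover have "c n \<in> nilset ?P" if "n \<ge> max r s" for n
    unfolding c_def using r(2) s(2) that by (intro nil) auto
  ultimately have c: "c \<in> carrier (CW p K ?P)" unfolding CW_mem[OF Ob] by blast
  define f where "f = (\<lambda>u\<in>carrier ?P. fst (inv_into UNIV e u))"
  define g where "g = (\<lambda>u\<in>carrier ?P. snd (inv_into UNIV e u))"
  have pair: "e (x, y) \<in> e ` (carrier A \<times> carrier B) \<longleftrightarrow> x \<in> carrier A \<and> y \<in> carrier B" for x y
    by (simp add: inj_image_mem_iff[OF ie])
  have f: "f \<in> Hom AC ?P A" and g: "g \<in> Hom AC ?P B"
    by (auto simp: AC_simps alg_hom_def ring_hom_def f_def g_def ps d pair inj_eq[OF ie])
  have "f (c n) = a n" "g (c n) = b n" for n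
    using r s by (simp_all add: f_def g_def c_def ps d)
  then show ?thesis using Ob c f g by blast
qed

end

section \<open>The covector functor is ind-representable\<close>

definition chosen_basis :: "'k ring \<Rightarrow> ('k, 'a) module \<Rightarrow> nat \<times> (nat \<Rightarrow> 'a)" where
  "chosen_basis K A = (SOME nb. kmod.basis K A (fst nb) (snd nb))"

text \<open>
  Structure constants of \<open>A\<close> with respect to a chosen basis, and coordinates of the \<open>a i\<close>;
  the case \<open>q = 0\<close> records the dimension.
\<close>

definition structure_table :: "'k ring \<Rightarrow> ('k, 'a) module \<Rightarrow> (nat \<Rightarrow> 'a) \<Rightarrow> nat \<times> nat \<times> nat \<times> nat \<Rightarrow> 'k" where
  "structure_table K A a = (\<lambda>(q, i, k, l). case chosen_basis K A of (n, b) \<Rightarrow>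
     if q = 0 then (if l < n then \<one>\<^bsub>K\<^esub> else \<zero>\<^bsub>K\<^esub>)
     else if q = 1 then (if i < n \<and> k < n \<and> l < n then kmod.coord K A n b (b i \<otimes>\<^bsub>A\<^esub> b k) l else \<zero>\<^bsub>K\<^esub>)
     else if q = 2 then (if l < n then kmod.coord K A n b \<one>\<^bsub>A\<^esub> l else \<zero>\<^bsub>K\<^esub>)
     else (if l < n then kmod.coord K A n b (a i) l else \<zero>\<^bsub>K\<^esub>))"

context perf_field
begin

lemma chosen_basis: "A \<in> Ob AC \<Longrightarrow> kmod.basis K A (fst (chosen_basis K A)) (snd (chosen_basis K A))"
proof -
  assume A: "A \<in> Ob AC"
  then interpret charp_alg p K A by (rule charp_alg_Ob)
  have "\<exists>nb. kmod.basis K A (fst nb) (snd nb)" using L.ex_basis A by (auto simp: AC_simps)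
  from someI_ex[OF this] show ?thesis by (simp add: chosen_basis_def)
qed

lemma structure_table_closed:
  assumes A: "A \<in> Ob AC" and a: "range a \<subseteq> carrier A"
  shows "structure_table K A a t \<in> carrier K"
proof -
  interpret charp_alg p K A by (rule charp_alg_Ob[OF A])
  obtain n b where nb: "chosen_basis K A = (n, b)" by (cases "chosen_basis K A")
  have B: "L.basis n b" using chosen_basis[OF A] by (simp add: nb)
  have b: "b i \<in> carrier A" if "i < n" for i using B that by (auto simp: L.basis_def)
  have "L.coord n b x l \<in> carrier K" if "x \<in> carrier A" "l < n" for x l
    using L.coord(1)[OF B that(1)] that(2) by auto
  moreover have "a i \<in> carrier A" for i using a by auto
  ultimately show ?thesis using b by (auto simp: structure_table_def nb split: prod.splits)
qed

text \<open>Equal tables mean that matching the two chosen bases respects products, the unit and the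
  entries of the covectors; linear extension gives the homomorphism.\<close>

lemma structure_table_eq_imp_hom:
  assumes A: "A \<in> Ob AC" and B: "B \<in> Ob AC" and a: "range a \<subseteq> carrier A" and a': "range a' \<subseteq> carrier B"
    and eq: "structure_table K A a = structure_table K B a'"
  shows "\<exists>h\<in>Hom AC A B. \<forall>i. h (a i) = a' i"
proof -
  interpret A: charp_alg p K A by (rule charp_alg_Ob[OF A])
  interpret B: charp_alg p K B by (rule charp_alg_Ob[OF B])
  obtain n b where nb: "chosen_basis K A = (n, b)" by (cases "chosen_basis K A")
  obtain n' b' where nb': "chosen_basis K B = (n', b')" by (cases "chosen_basis K B")
  have "l < n \<longleftrightarrow> l < n'" for l
    using fun_cong[OF eq, of "(0, 0, 0, l)"] by (auto simp: structure_table_def nb nb' split: if_splits)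
  then have n': "n' = n" by (metis linorder_neqE_nat less_irrefl)
  have bA: "A.L.basis n b" and bB: "B.L.basis n b'" using chosen_basis[OF A] chosen_basis[OF B] by (simp_all add: nb nb' n')
  define cA where "cA = A.L.coord n b"
  define cB where "cB = B.L.coord n b'"
  have b: "b i \<in> carrier A" "b' i \<in> carrier B" if "i < n" for i
    using bA bB that by (auto simp: A.L.basis_def B.L.basis_def)
  have bi: "b ` {..<n} \<subseteq> carrier A" "b' ` {..<n} \<subseteq> carrier B" using b by auto
  have c: "cA x \<in> {..<n} \<rightarrow> carrier K" "A.L.lc n b (cA x) = x" if "x \<in> carrier A" for x
    using A.L.coord[OF bA that] by (simp_all add: cA_def)
  have c': "cB x \<in> {..<n} \<rightarrow> carrier K" "B.L.lc n b' (cB x) = x" if "x \<in> carrier B" for x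
    using B.L.coord[OF bB that] by (simp_all add: cB_def)
  define h where "h = (\<lambda>x\<in>carrier A. B.L.lc n b' (cA x))"
  have h_closed: "h x \<in> carrier B" if "x \<in> carrier A" for x
    using that c B.L.lc_closed[OF bi(2)] by (simp add: h_def)
  have hI: "h x = y" if "x \<in> carrier A" "y \<in> carrier B" "\<And>l. l < n \<Longrightarrow> cA x l = cB y l" for x y
    using that c'[OF that(2)] B.L.lc_cong[OF bi(2) c'(1)[OF that(2)], of "cA x"] by (simp add: h_def)
  have hb: "h (b i) = b' i" if i: "i < n" for i
  proof (rule hI)
    let ?d = "\<lambda>j. if j = i then \<one>\<^bsub>K\<^esub> else \<zero>\<^bsub>K\<^esub>"
    fix l assume l: "l < n"
    have "cA (b i) l = ?d l"
      unfolding cA_def by (rule A.L.coord_eqI[OF bA _ A.L.lc_delta[OF bi(1) i] l]) auto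
    moreover have "cB (b' i) l = ?d l"
      unfolding cB_def by (rule B.L.coord_eqI[OF bB _ B.L.lc_delta[OF bi(2) i] l]) auto
    ultimately show "cA (b i) l = cB (b' i) l" by simp
  qed (use b i in auto)
  have hmb: "h (b i \<otimes>\<^bsub>A\<^esub> b k) = b' i \<otimes>\<^bsub>B\<^esub> b' k" if ik: "i < n" "k < n" for i k
  proof (rule hI)
    fix l assume "l < n"
    then show "cA (b i \<otimes>\<^bsub>A\<^esub> b k) l = cB (b' i \<otimes>\<^bsub>B\<^esub> b' k) l"
      using fun_cong[OF eq, of "(1, i, k, l)"] ik by (simp add: structure_table_def nb nb' n' cA_def cB_def)
  qed (use b ik in auto)
  have h1: "h \<one>\<^bsub>A\<^esub> = \<one>\<^bsub>B\<^esub>"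
  proof (rule hI)
    fix l assume "l < n"
    then show "cA \<one>\<^bsub>A\<^esub> l = cB \<one>\<^bsub>B\<^esub> l"
      using fun_cong[OF eq, of "(2, 0, 0, l)"] by (simp add: structure_table_def nb nb' n' cA_def cB_def)
  qed auto
  have ha: "h (a i) = a' i" for i
  proof (rule hI)
    fix l assume "l < n"
    then show "cA (a i) l = cB (a' i) l"
      using fun_cong[OF eq, of "(3, i, 0, l)"] by (simp add: structure_table_def nb nb' n' cA_def cB_def)
  qed (use a a' in auto)
  have hadd: "h (x \<oplus>\<^bsub>A\<^esub> y) = h x \<oplus>\<^bsub>B\<^esub> h y" if xy: "x \<in> carrier A" "y \<in> carrier A" for x y
  proof -
    let ?c = "\<lambda>l. cA x l \<oplus>\<^bsub>K\<^esub> cA y l"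
    have cl: "?c \<in> {..<n} \<rightarrow> carrier K" using c(1)[OF xy(1)] c(1)[OF xy(2)] by auto
    have e: "A.L.lc n b ?c = x \<oplus>\<^bsub>A\<^esub> y"
      using A.L.lc_add[OF bi(1) c(1)[OF xy(1)] c(1)[OF xy(2)]] c(2)[OF xy(1)] c(2)[OF xy(2)] by simp
    have "B.L.lc n b' (cA (x \<oplus>\<^bsub>A\<^esub> y)) = B.L.lc n b' ?c"
      unfolding cA_def using A.L.coord_eqI[OF bA cl e] by (intro B.L.lc_cong[OF bi(2)] cl[unfolded cA_def]) (simp add: cA_def)
    then show ?thesis
      using xy B.L.lc_add[OF bi(2) c(1)[OF xy(1)] c(1)[OF xy(2)]] by (simp add: h_def)
  qed
  have hsm: "h (d \<odot>\<^bsub>A\<^esub> x) = d \<odot>\<^bsub>B\<^esub> h x" if d: "d \<in> carrier K" and x: "x \<in> carrier A" for d x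
  proof -
    let ?c = "\<lambda>l. d \<otimes>\<^bsub>K\<^esub> cA x l"
    have cl: "?c \<in> {..<n} \<rightarrow> carrier K" using c(1)[OF x] d by auto
    have e: "A.L.lc n b ?c = d \<odot>\<^bsub>A\<^esub> x"
      using A.L.lc_smult[OF bi(1) c(1)[OF x] d] c(2)[OF x] by simp
    have "B.L.lc n b' (cA (d \<odot>\<^bsub>A\<^esub> x)) = B.L.lc n b' ?c"
      unfolding cA_def using A.L.coord_eqI[OF bA cl e] by (intro B.L.lc_cong[OF bi(2)] cl[unfolded cA_def]) (simp add: cA_def)
    then show ?thesis
      using x d B.L.lc_smult[OF bi(2) c(1)[OF x] d] by (simp add: h_def)
  qed
  have span: "x \<in> W" if "submod K A W" "\<And>i. i < n \<Longrightarrow> b i \<in> W" "x \<in> carrier A" for W x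
    using A.L.basis_spanning[OF bA] that unfolding spanning_def by blast
  have h0: "h \<zero>\<^bsub>A\<^esub> = \<zero>\<^bsub>B\<^esub>"
    using hsm[OF K.zero_closed A.A.one_closed] h1 by simp
  \<comment> \<open>Multiplicativity is known for pairs of basis vectors; it is extended first in
    the left argument and afterwards, in \<open>hm\<close>, in the right one.\<close>
  have hm1: "h (x \<otimes>\<^bsub>A\<^esub> b k) = h x \<otimes>\<^bsub>B\<^esub> b' k" if x: "x \<in> carrier A" and k: "k < n" for x k
  proof -
    have "x \<in> {x \<in> carrier A. h (x \<otimes>\<^bsub>A\<^esub> b k) = h x \<otimes>\<^bsub>B\<^esub> b' k}"
    proof (rule span[OF _ _ x])
      show "submod K A {x \<in> carrier A. h (x \<otimes>\<^bsub>A\<^esub> b k) = h x \<otimes>\<^bsub>B\<^esub> b' k}"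
        unfolding submod_def using b[OF k] h0
        by (auto simp: A.A.l_distr B.A.l_distr hadd h_closed hsm A.A.smult_assoc2 B.A.smult_assoc2)
      show "b i \<in> {x \<in> carrier A. h (x \<otimes>\<^bsub>A\<^esub> b k) = h x \<otimes>\<^bsub>B\<^esub> b' k}" if "i < n" for i
        using b(1)[OF that] hmb[OF that k] hb[OF that] by simp
    qed
    then show ?thesis by simp
  qed
  have hm: "h (x \<otimes>\<^bsub>A\<^esub> y) = h x \<otimes>\<^bsub>B\<^esub> h y" if x: "x \<in> carrier A" and y: "y \<in> carrier A" for x y
  proof -
    have "y \<in> {y \<in> carrier A. h (x \<otimes>\<^bsub>A\<^esub> y) = h x \<otimes>\<^bsub>B\<^esub> h y}"
    proof (rule span[OF _ _ y])
      have "h (x \<otimes>\<^bsub>A\<^esub> (d \<odot>\<^bsub>A\<^esub> z)) = h x \<otimes>\<^bsub>B\<^esub> h (d \<odot>\<^bsub>A\<^esub> z)"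
        if "d \<in> carrier K" "z \<in> carrier A" "h (x \<otimes>\<^bsub>A\<^esub> z) = h x \<otimes>\<^bsub>B\<^esub> h z" for d z
      proof -
        have "x \<otimes>\<^bsub>A\<^esub> (d \<odot>\<^bsub>A\<^esub> z) = d \<odot>\<^bsub>A\<^esub> (x \<otimes>\<^bsub>A\<^esub> z)"
          using x that by (simp add: A.smult_iota A.A.m_ac)
        moreover have "h x \<otimes>\<^bsub>B\<^esub> (d \<odot>\<^bsub>B\<^esub> h z) = d \<odot>\<^bsub>B\<^esub> (h x \<otimes>\<^bsub>B\<^esub> h z)"
          using h_closed[OF x] h_closed[OF that(2)] that(1) by (simp add: B.smult_iota B.A.m_ac)
        ultimately show ?thesis using that x by (simp add: hsm)
      qed
      then show "submod K A {y \<in> carrier A. h (x \<otimes>\<^bsub>A\<^esub> y) = h x \<otimes>\<^bsub>B\<^esub> h y}"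
        unfolding submod_def using x h0 by (auto simp: A.A.r_distr B.A.r_distr hadd h_closed)
      show "b i \<in> {y \<in> carrier A. h (x \<otimes>\<^bsub>A\<^esub> y) = h x \<otimes>\<^bsub>B\<^esub> h y}" if "i < n" for i
        using b(1)[OF that] hm1[OF x that] hb[OF that] by simp
    qed
    then show ?thesis by simp
  qed
  have "h \<in> Hom AC A B"
    using h_closed hadd hm h1 hsm by (auto simp: AC_simps alg_hom_def ring_hom_def h_def)
  then show ?thesis using ha by blast
qed

text \<open>The zero algebra; it guarantees that the index category is nonempty.\<close>

lemma trivial_Ob: "\<exists>A\<in>Ob AC. \<exists>a. a \<in> carrier (CW p K A)"
proof -
  define A :: "('k, 'a) module" where
    "A = \<lparr>carrier = {undefined}, mult = (\<lambda>_ _. undefined), one = undefined, zero = undefined,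
          add = (\<lambda>_ _. undefined), smult = (\<lambda>_ _. undefined)\<rparr>"
  have alg: "algebra K A"
  proof (rule algebraI)
    show "cring K" by (rule K.is_cring)
    show "cring A"
      by (intro cringI abelian_groupI comm_monoidI) (auto simp: A_def)
  qed (auto simp: A_def)
  interpret A: kmod K A by (intro kmod.intro K.field_axioms algebra.module[OF alg])
  have "spanning K A {}" by (auto simp: spanning_def submod_def A_def)
  then have "fin_dim K A" using A.fin_dim_spanning by blast
  then have A: "A \<in> Ob AC" using alg by (simp add: AC_simps)
  then obtain s where "cw_alg p K A s" using cw_alg_Ob by blast
  then have "\<zero>\<^bsub>CW p K A\<^esub> \<in> carrier (CW p K A)" by (rule cw_alg.CW_zero_closed)
  then show ?thesis using A by blast
qed

end

text \<open>
  The index category is the preorder of (codes of) pairs of an algebra and a covector whose entries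
  generate it; it is a cofinal part of the category of elements of \<open>CW\<close>.
\<close>

locale cw_rep = perf_field p K for p :: nat and K :: "'k ring" +
  fixes e :: "'a \<times> 'a \<Rightarrow> 'a" and j :: "'k \<Rightarrow> 'a"
  assumes e: "inj e" and j: "inj_on j (carrier K)"
begin

type_synonym ('c, 'b) pointed = "('c, 'b) module \<times> (nat \<Rightarrow> 'b)"

definition E :: "('k, 'a) pointed set" where
  "E = {(A, a). A \<in> Ob AC \<and> a \<in> carrier (CW p K A) \<and> carrier A \<subseteq> genalg K A a}"

definition arr :: "('k, 'a) pointed \<Rightarrow> ('k, 'a) pointed \<Rightarrow> ('a \<Rightarrow> 'a) \<Rightarrow> bool" where
  "arr P Q h \<longleftrightarrow> h \<in> Hom AC (fst P) (fst Q) \<and> (\<forall>n. h (snd P n) = snd Q n)"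

text \<open>An index has type \<open>nat \<Rightarrow> 'a\<close>, so the table is enumerated by
  \<open>from_nat\<close> and its entries are moved to \<open>'a\<close> along \<open>j\<close>.
  Pairs with the same code have arrows both ways by \<open>code_eq_arr\<close>.\<close>

definition code :: "('k, 'a) pointed \<Rightarrow> nat \<Rightarrow> 'a" where
  "code P = (\<lambda>t. j (structure_table K (fst P) (snd P) (from_nat t)))"

definition dec :: "(nat \<Rightarrow> 'a) \<Rightarrow> ('k, 'a) pointed" where
  "dec = inv_into E code"

text \<open>Arrows are unique by \<open>arr_unique\<close>, so only their existence is recorded,
  with \<open>undefined\<close> as the one possible morphism.\<close>

definition cw_index :: "(nat \<Rightarrow> 'a, nat \<Rightarrow> 'a) cat" where
  "cw_index = \<lparr>Ob = code ` E, Hom = (\<lambda>i k. {u. u = undefined \<and> (\<exists>h. arr (dec i) (dec k) h)}),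
         Id = (\<lambda>_. undefined), Comp = (\<lambda>_ _ _ _ _. undefined)\<rparr>"

definition cw_pro :: "('k, 'a) pro_alg" where
  "cw_pro = \<lparr>index = cw_index, diag = \<lparr>on_ob = (\<lambda>i. fst (dec i)), on_mor = (\<lambda>i k u. SOME h. arr (dec i) (dec k) h)\<rparr>\<rparr>"

lemma ED:
  assumes "P \<in> E"
  shows "fst P \<in> Ob AC" "snd P \<in> carrier (CW p K (fst P))" "carrier (fst P) \<subseteq> genalg K (fst P) (snd P)"
    "range (snd P) \<subseteq> carrier (fst P)"
proof -
  show 1: "fst P \<in> Ob AC" "snd P \<in> carrier (CW p K (fst P))" "carrier (fst P) \<subseteq> genalg K (fst P) (snd P)"
    using assms by (auto simp: E_def)
  show "range (snd P) \<subseteq> carrier (fst P)" using 1(2) CW_mem[OF 1(1)] by auto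
qed

lemma dec: "i \<in> code ` E \<Longrightarrow> dec i \<in> E" "i \<in> code ` E \<Longrightarrow> code (dec i) = i"
  unfolding dec_def by (auto intro: inv_into_into f_inv_into_f)

lemma arr_unique:
  assumes "P \<in> E" "fst Q \<in> Ob AC" "arr P Q h" "arr P Q g"
  shows "h = g"
  using ED[OF assms(1)] assms by (intro alg_hom_eqI[of "fst P" "fst Q" h g "snd P"]) (auto simp: arr_def)

lemma arr_comp:
  assumes "P \<in> E" "fst Q \<in> Ob AC" "fst S \<in> Ob AC" "arr P Q h" "arr Q S g"
  shows "arr P S (Comp AC (fst P) (fst Q) (fst S) g h)"
proof -
  have "Comp AC (fst P) (fst Q) (fst S) g h \<in> Hom AC (fst P) (fst S)"
    using is_categoryD(2)[OF is_category_alg_cat, of "fst P" K "fst Q" "fst S" h g] ED[OF assms(1)] assms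
    by (simp add: arr_def)
  moreover have "Comp AC (fst P) (fst Q) (fst S) g h (snd P n) = snd S n" for n
    using ED(4)[OF assms(1)] assms(4,5) by (auto simp: arr_def AC_simps compose_def)
  ultimately show ?thesis by (simp add: arr_def)
qed

lemma arr_Id: "P \<in> E \<Longrightarrow> arr P P (Id AC (fst P))"
  using is_categoryD(1)[OF is_category_alg_cat, of "fst P" K] ED[of P]
  by (auto simp: arr_def AC_simps)

lemma code_eq_arr:
  assumes "P \<in> E" "Q \<in> E" "code P = code Q"
  shows "\<exists>h. arr P Q h"
proof -
  have "structure_table K (fst P) (snd P) t = structure_table K (fst Q) (snd Q) t" for t
  proof -
    have "j (structure_table K (fst P) (snd P) t) = j (structure_table K (fst Q) (snd Q) t)"
      using fun_cong[OF assms(3), of "to_nat t"] by (simp add: code_def)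
    then show ?thesis
      by (rule inj_onD[OF j]) (intro structure_table_closed ED assms)+
  qed
  then have "structure_table K (fst P) (snd P) = structure_table K (fst Q) (snd Q)" by (rule ext)
  from structure_table_eq_imp_hom[OF ED(1)[OF assms(1)] ED(1)[OF assms(2)] ED(4)[OF assms(1)] ED(4)[OF assms(2)] this]
  show ?thesis by (auto simp: arr_def)
qed

text \<open>The pair is restricted to the subalgebra generated by the entries of \<open>a\<close>
  and then included into \<open>A\<close>. Since \<open>dec\<close> may return another pair with the
  same code, an arrow from \<open>code_eq_arr\<close> comes first.\<close>

lemma E_cover:
  assumes A: "A \<in> Ob AC" and a: "a \<in> carrier (CW p K A)"
  shows "\<exists>k\<in>code ` E. \<exists>h. arr (dec k) (A, a) h"
proof -
  obtain S where S: "A\<lparr>carrier := S\<rparr> \<in> Ob AC" "a \<in> carrier (CW p K (A\<lparr>carrier := S\<rparr>))"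
    "S \<subseteq> genalg K (A\<lparr>carrier := S\<rparr>) a" "(\<lambda>x\<in>S. x) \<in> Hom AC (A\<lparr>carrier := S\<rparr>) A"
    using ex_generated[OF A a] by blast
  let ?P = "(A\<lparr>carrier := S\<rparr>, a)"
  have P: "?P \<in> E" using S by (simp add: E_def)
  then have k: "code ?P \<in> code ` E" by simp
  obtain h where h: "arr (dec (code ?P)) ?P h"
    using code_eq_arr[OF dec(1)[OF k] P dec(2)[OF k]] by blast
  have "arr ?P (A, a) (\<lambda>x\<in>S. x)" using S(4) ED(4)[OF P] by (auto simp: arr_def)
  from arr_comp[OF dec(1)[OF k] _ _ h this] have "\<exists>h. arr (dec (code ?P)) (A, a) h"
    using A S(1) by auto
  then show ?thesis using k by (rule bexI)
qed

lemma the_arr: "arr P Q h \<Longrightarrow> arr P Q (SOME h. arr P Q h)"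
  by (rule someI[of "arr P Q"])

text \<open>Uniqueness of arrows gives the functor laws for the arrows chosen by
  \<open>SOME\<close>, and parallel morphisms coincide. Lower bounds come from
  \<open>ex_product\<close>, turned into an index by \<open>E_cover\<close>.\<close>

lemma cw_pro_Ob: "cw_pro \<in> Ob (pro_cat AC)"
proof -
  have D: "dec i \<in> E" "fst (dec i) \<in> Ob AC" if "i \<in> Ob cw_index" for i
    using that dec ED by (auto simp: cw_index_def)
  have refl: "undefined \<in> Hom cw_index i i" if "i \<in> Ob cw_index" for i
    using arr_Id[OF D(1)[OF that]] by (auto simp: cw_index_def)
  have cat: "is_category cw_index"
    unfolding is_category_def
  proof (intro conjI ballI)
    fix i assume "i \<in> Ob cw_index"
    then show "Id cw_index i \<in> Hom cw_index i i" using refl by (simp add: cw_index_def)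
  next
    fix i k l u v assume ikl: "i \<in> Ob cw_index" "k \<in> Ob cw_index" "l \<in> Ob cw_index" "u \<in> Hom cw_index i k" "v \<in> Hom cw_index k l"
    then obtain h g where "arr (dec i) (dec k) h" "arr (dec k) (dec l) g" by (auto simp: cw_index_def)
    from arr_comp[OF D(1)[OF ikl(1)] D(2)[OF ikl(2)] D(2)[OF ikl(3)] this]
    show "Comp cw_index i k l v u \<in> Hom cw_index i l" by (auto simp: cw_index_def)
  qed (auto simp: cw_index_def)
  have "cofiltered cw_index"
    unfolding cofiltered_def
  proof (intro conjI ballI)
    show "is_category cw_index" by (rule cat)
    obtain A a where "A \<in> Ob AC" "a \<in> carrier (CW p K (A :: ('k, 'a) module))" using trivial_Ob by blast
    then show "Ob cw_index \<noteq> {}" using E_cover by (fastforce simp: cw_index_def)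
  next
    fix i k assume ik: "i \<in> Ob cw_index" "k \<in> Ob cw_index"
    obtain A a B b where ab: "dec i = (A, a)" "dec k = (B, b)" by (cases "dec i", cases "dec k")
    have AB: "A \<in> Ob AC" "B \<in> Ob AC" "a \<in> carrier (CW p K A)" "b \<in> carrier (CW p K B)"
      using ED[OF D(1)[OF ik(1)]] ED[OF D(1)[OF ik(2)]] by (auto simp: ab)
    obtain P c f g where P: "P \<in> Ob AC" "c \<in> carrier (CW p K P)" "f \<in> Hom AC P A" "g \<in> Hom AC P B"
      "\<forall>n. f (c n) = a n" "\<forall>n. g (c n) = b n"
      using ex_product[OF e AB] by blast
    obtain l h where l: "l \<in> code ` E" "arr (dec l) (P, c) h" using E_cover[OF P(1,2)] by blast
    have f: "arr (P, c) (dec i) f" and g: "arr (P, c) (dec k) g" using P by (auto simp: arr_def ab)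
    have "\<exists>f. arr (dec l) (dec i) f"
      using arr_comp[OF dec(1)[OF l(1)] _ D(2)[OF ik(1)] l(2) f] P(1) by auto
    moreover have "\<exists>g. arr (dec l) (dec k) g"
      using arr_comp[OF dec(1)[OF l(1)] _ D(2)[OF ik(2)] l(2) g] P(1) by auto
    ultimately show "\<exists>l\<in>Ob cw_index. Hom cw_index l i \<noteq> {} \<and> Hom cw_index l k \<noteq> {}"
      using l(1) by (intro bexI[of _ l]) (auto simp: cw_index_def)
  next
    fix i k u v assume "i \<in> Ob cw_index"
    then show "\<exists>l\<in>Ob cw_index. \<exists>w\<in>Hom cw_index l i. Comp cw_index l i k u w = Comp cw_index l i k v w"
      using refl by (intro bexI[of _ i] bexI[of _ undefined]) (auto simp: cw_index_def)
  qed
  moreover have "is_functor cw_index AC (diag cw_pro)"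
  proof -
    have mor: "arr (dec i) (dec k) (on_mor (diag cw_pro) i k u)" if "u \<in> Hom cw_index i k" for i k u
      using that by (auto simp: cw_index_def cw_pro_def intro: the_arr)
    have ob: "on_ob (diag cw_pro) i = fst (dec i)" for i by (simp add: cw_pro_def)
    show ?thesis
      unfolding is_functor_def ob
    proof (intro conjI ballI)
      fix i assume i: "i \<in> Ob cw_index"
      show "fst (dec i) \<in> Ob AC" by (rule D(2)[OF i])
      have "Id cw_index i \<in> Hom cw_index i i" by (rule is_categoryD(1)[OF cat i])
      then show "on_mor (diag cw_pro) i i (Id cw_index i) = Id AC (fst (dec i))"
        by (intro arr_unique[OF D(1)[OF i] D(2)[OF i] mor arr_Id[OF D(1)[OF i]]])
      fix k u assume k: "k \<in> Ob cw_index" "u \<in> Hom cw_index i k"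
      show "on_mor (diag cw_pro) i k u \<in> Hom AC (fst (dec i)) (fst (dec k))"
        using mor[OF k(2)] by (simp add: arr_def)
      fix l v assume l: "l \<in> Ob cw_index" "v \<in> Hom cw_index k l"
      show "on_mor (diag cw_pro) i l (Comp cw_index i k l v u) =
          Comp AC (fst (dec i)) (fst (dec k)) (fst (dec l)) (on_mor (diag cw_pro) k l v) (on_mor (diag cw_pro) i k u)"
        by (rule arr_unique[OF D(1)[OF i] D(2)[OF l(1)] mor[OF is_categoryD(2)[OF cat i k(1) l(1) k(2) l(2)]]
              arr_comp[OF D(1)[OF i] D(2)[OF k(1)] D(2)[OF l(1)] mor[OF k(2)] mor[OF l(2)]]])
    qed
  qed
  ultimately show ?thesis by (simp add: pro_cat_def cw_pro_def)
qed

section \<open>The isomorphism from the colimit to covectors\<close>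

sublocale cw_pro: pro_object AC cw_pro
  by (rule pro_object.intro[OF is_category_alg_cat cw_pro_Ob])

text \<open>The covector represented by \<open>(i, f)\<close>: the image under \<open>f\<close> of
  the covector belonging to the index \<open>i\<close>.\<close>

definition val :: "(nat \<Rightarrow> 'a) \<times> ('a \<Rightarrow> 'a) \<Rightarrow> nat \<Rightarrow> 'a" where
  "val x = (\<lambda>n. snd x (snd (dec (fst x)) n))"

lemma cw_pro_D: "i \<in> Ob (index cw_pro) \<Longrightarrow> dec i \<in> E" "on_ob (diag cw_pro) i = fst (dec i)"
  using dec by (auto simp: cw_pro_def cw_index_def)

lemma cw_pro_mor: "u \<in> Hom (index cw_pro) i k \<Longrightarrow> arr (dec i) (dec k) (on_mor (diag cw_pro) i k u)"
  by (auto simp: cw_index_def cw_pro_def intro: the_arr)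

text \<open>Transition maps respect the given covectors, so equivalent elements have equal values.
  Conversely, over a common lower bound both composites send the generating covector to the same one
  and hence are equal.\<close>

lemma germ_rel_iff:
  assumes A: "A \<in> Ob AC" and x: "x \<in> cw_pro.elts A" and y: "y \<in> cw_pro.elts A"
  shows "(x, y) \<in> germ_rel AC cw_pro A \<longleftrightarrow> val x = val y"
proof -
  obtain i f k g where ik: "x = (i, f)" "y = (k, g)" by (cases x, cases y)
  have i: "i \<in> Ob (index cw_pro)" "f \<in> Hom AC (fst (dec i)) A" and k: "k \<in> Ob (index cw_pro)" "g \<in> Hom AC (fst (dec k)) A"
    using x y by (auto simp: ik cw_pro_D)
  have ai: "arr (dec i) (A, val x) f" and ak: "arr (dec k) (A, val y) g"
    using i k by (simp_all add: arr_def val_def ik)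
  have comp: "arr (dec l) (A, val z) (Comp AC (fst (dec l)) (fst (dec m)) A h (on_mor (diag cw_pro) l m u))"
    if "arr (dec m) (A, val z) h" "u \<in> Hom (index cw_pro) l m" "l \<in> Ob (index cw_pro)" "m \<in> Ob (index cw_pro)" for l m u h z
    using arr_comp[OF cw_pro_D(1)[OF that(3)] _ _ cw_pro_mor[OF that(2)] that(1)] ED(1)[OF cw_pro_D(1)[OF that(4)]] A by simp
  show ?thesis
  proof
    assume "(x, y) \<in> germ_rel AC cw_pro A"
    then obtain l u v where l: "l \<in> Ob (index cw_pro)" "u \<in> Hom (index cw_pro) l i" "v \<in> Hom (index cw_pro) l k"
      "Comp AC (on_ob (diag cw_pro) l) (on_ob (diag cw_pro) i) A f (on_mor (diag cw_pro) l i u) =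
       Comp AC (on_ob (diag cw_pro) l) (on_ob (diag cw_pro) k) A g (on_mor (diag cw_pro) l k v)"
      unfolding ik by (rule cw_pro.germ_relE)
    have "arr (dec l) (A, val x) (Comp AC (fst (dec l)) (fst (dec i)) A f (on_mor (diag cw_pro) l i u))"
      by (rule comp[OF ai l(2,1) i(1)])
    moreover have "arr (dec l) (A, val y) (Comp AC (fst (dec l)) (fst (dec k)) A g (on_mor (diag cw_pro) l k v))"
      by (rule comp[OF ak l(3,1) k(1)])
    ultimately show "val x = val y" using l(4) by (auto simp: arr_def cw_pro_D fun_eq_iff)
  next
    assume eq: "val x = val y"
    obtain l u v where l: "l \<in> Ob (index cw_pro)" "u \<in> Hom (index cw_pro) l i" "v \<in> Hom (index cw_pro) l k"
      using cw_pro.cofiltered i(1) k(1) unfolding cofiltered_def by blast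
    have "Comp AC (fst (dec l)) (fst (dec i)) A f (on_mor (diag cw_pro) l i u) =
       Comp AC (fst (dec l)) (fst (dec k)) A g (on_mor (diag cw_pro) l k v)"
      by (rule arr_unique[OF cw_pro_D(1)[OF l(1)] _ comp[OF ai l(2,1) i(1)] comp[OF ak l(3,1) k(1), folded eq]])
        (simp add: A)
    then show "(x, y) \<in> germ_rel AC cw_pro A"
      using x y unfolding ik by (intro cw_pro.germ_relI[OF _ _ l]) (auto simp: cw_pro_D)
  qed
qed

definition rho :: "('k, 'a) module \<Rightarrow> ((nat \<Rightarrow> 'a) \<times> ('a \<Rightarrow> 'a)) set \<Rightarrow> nat \<Rightarrow> 'a" where
  "rho A c = val (SOME x. x \<in> c)"

lemma rho_germ:
  assumes A: "A \<in> Ob AC" and x: "(i, f) \<in> cw_pro.elts A"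
  shows "rho A (germ AC cw_pro A i f) = val (i, f)"
proof -
  have "(i, f) \<in> germ AC cw_pro A i f" by (rule cw_pro.mem_germ[OF A x])
  then have "(SOME x. x \<in> germ AC cw_pro A i f) \<in> germ AC cw_pro A i f" by (rule someI)
  then have r: "((i, f), SOME x. x \<in> germ AC cw_pro A i f) \<in> germ_rel AC cw_pro A" by (simp add: germ_def)
  then have "(SOME x. x \<in> germ AC cw_pro A i f) \<in> cw_pro.elts A" by (auto simp: germ_rel_def)
  from germ_rel_iff[OF A x this] r show ?thesis by (simp add: rho_def)
qed

lemma val_CW:
  assumes A: "A \<in> Ob AC" and x: "(i, f) \<in> cw_pro.elts A"
  shows "val (i, f) \<in> carrier (CW p K A)"
proof -
  have i: "dec i \<in> E" "f \<in> Hom AC (fst (dec i)) A" using x cw_pro_D by auto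
  obtain s s' where "cw_alg_hom p K (fst (dec i)) A s s' f" using cw_alg_hom_Ob[OF ED(1)[OF i(1)] A i(2)] by blast
  from cw_alg_hom.map_closed[OF this ED(2)[OF i(1)]] show ?thesis by (simp add: val_def comp_def)
qed

text \<open>Injectivity is \<open>germ_rel_iff\<close> and surjectivity is
  \<open>E_cover\<close>.\<close>

lemma represents_CW: "represents K (CW_functor p K) cw_pro rho"
  unfolding represents_def pro_alg_cat_def
proof (intro conjI ballI)
  show "cw_pro \<in> Ob (pro_cat AC)" by (rule cw_pro_Ob)
  fix A :: "('k, 'a) module" assume A: "A \<in> Ob AC"
  show "bij_betw (rho A) (pro_colim AC cw_pro A) (carrier (on_ob (CW_functor p K) A))"
    unfolding bij_betw_def
  proof
    show "inj_on (rho A) (pro_colim AC cw_pro A)"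
    proof (rule inj_onI)
      fix c d assume c: "c \<in> pro_colim AC cw_pro A" and d: "d \<in> pro_colim AC cw_pro A" and eq: "rho A c = rho A d"
      obtain i f where f: "(i, f) \<in> cw_pro.elts A" "c = germ AC cw_pro A i f" using cw_pro.pro_colimE[OF c] .
      obtain k g where g: "(k, g) \<in> cw_pro.elts A" "d = germ AC cw_pro A k g" using cw_pro.pro_colimE[OF d] .
      have "val (i, f) = val (k, g)" using eq rho_germ[OF A f(1)] rho_germ[OF A g(1)] f(2) g(2) by simp
      then show "c = d" using cw_pro.germ_eq_iff[OF A f(1) g(1)] germ_rel_iff[OF A f(1) g(1)] f(2) g(2) by simp
    qed
    show "rho A ` pro_colim AC cw_pro A = carrier (on_ob (CW_functor p K) A)"
    proof
      show "rho A ` pro_colim AC cw_pro A \<subseteq> carrier (on_ob (CW_functor p K) A)"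
      proof
        fix a assume "a \<in> rho A ` pro_colim AC cw_pro A"
        then obtain c where c: "c \<in> pro_colim AC cw_pro A" "a = rho A c" by blast
        obtain i f where f: "(i, f) \<in> cw_pro.elts A" "c = germ AC cw_pro A i f" using cw_pro.pro_colimE[OF c(1)] .
        show "a \<in> carrier (on_ob (CW_functor p K) A)"
          using val_CW[OF A f(1)] rho_germ[OF A f(1)] c f by (simp add: CW_functor_def)
      qed
      show "carrier (on_ob (CW_functor p K) A) \<subseteq> rho A ` pro_colim AC cw_pro A"
      proof
        fix a assume "a \<in> carrier (on_ob (CW_functor p K) A)"
        then have "a \<in> carrier (CW p K A)" by (simp add: CW_functor_def)
        then obtain k h where k: "k \<in> code ` E" "arr (dec k) (A, a) h" using E_cover[OF A] by blast
        then have x: "(k, h) \<in> cw_pro.elts A" by (simp add: arr_def cw_pro_def cw_index_def)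
        have "val (k, h) = a" using k(2) by (simp add: arr_def val_def)
        then show "a \<in> rho A ` pro_colim AC cw_pro A"
          using rho_germ[OF A x] cw_pro.germ_in_pro_colim[OF x] by force
      qed
    qed
  qed
  fix B f c assume B: "B \<in> Ob AC" and f: "f \<in> Hom AC A B" and c: "c \<in> pro_colim AC cw_pro A"
  obtain i g where g: "(i, g) \<in> cw_pro.elts A" "c = germ AC cw_pro A i g" using cw_pro.pro_colimE[OF c] .
  have i: "i \<in> Ob (index cw_pro)" "dec i \<in> E" "g \<in> Hom AC (fst (dec i)) A" using g cw_pro_D by auto
  have fg: "(i, Comp AC (on_ob (diag cw_pro) i) A B f g) \<in> cw_pro.elts B"
    using i is_categoryD(2)[OF is_category_alg_cat ED(1)[OF i(2)] A B i(3) f] by (simp add: cw_pro_D)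
  have "rho B (pro_push AC cw_pro A B f c) = val (i, Comp AC (on_ob (diag cw_pro) i) A B f g)"
    unfolding g(2) cw_pro.pro_push_germ[OF A B f g(1)] by (rule rho_germ[OF B fg])
  also have "\<dots> = f \<circ> val (i, g)"
    using ED(4)[OF i(2)] by (auto simp: val_def AC_simps compose_def cw_pro_D fun_eq_iff)
  also have "\<dots> = on_mor (CW_functor p K) A B f (rho A c)"
    unfolding g(2) rho_germ[OF A g(1)] using val_CW[OF A g(1)] by (simp add: CW_functor_def CW_map_def)
  finally show "rho B (pro_push AC cw_pro A B f c) = on_mor (CW_functor p K) A B f (rho A c)" .
qed

end

section \<open>The Dieudonne module of a formal group\<close>

context perf_field
begin

lemma CW_dieudonne_Ob: "A \<in> Ob AC \<Longrightarrow> dieudonne_module p K (CW p K A)"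
  using cw_alg_Ob cw_alg.CW_dieudonne by blast

lemma CW_module_Ob: "A \<in> Ob AC \<Longrightarrow> module (WR p K) (CW p K A)"
  using CW_dieudonne_Ob by (auto simp: dieudonne_module_def witt_WR)

lemma CW_map_closed:
  assumes "A \<in> Ob AC" "B \<in> Ob AC" "f \<in> Hom AC A B" "a \<in> carrier (CW p K A)"
  shows "CW_map p K A B f a \<in> carrier (CW p K B)"
proof -
  obtain s s' where "cw_alg_hom p K A B s s' f" using cw_alg_hom_Ob[OF assms(1-3)] by blast
  then show ?thesis using cw_alg_hom.map_closed assms(4) by (simp add: CW_map_def)
qed

lemma CW_map_ops:
  assumes "A \<in> Ob AC" "B \<in> Ob AC" "f \<in> Hom AC A B" "a \<in> carrier (CW p K A)"
  shows "b \<in> carrier (CW p K A) \<Longrightarrow>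
      CW_map p K A B f (a \<oplus>\<^bsub>CW p K A\<^esub> b) = CW_map p K A B f a \<oplus>\<^bsub>CW p K B\<^esub> CW_map p K A B f b"
    "x \<in> carrier (WR p K) \<Longrightarrow> CW_map p K A B f (x \<odot>\<^bsub>CW p K A\<^esub> a) = x \<odot>\<^bsub>CW p K B\<^esub> CW_map p K A B f a"
    "CW_map p K A B f (Fop (CW p K A) a) = Fop (CW p K B) (CW_map p K A B f a)"
    "CW_map p K A B f (Vop (CW p K A) a) = Vop (CW p K B) (CW_map p K A B f a)"
    "CW_map p K A B f \<zero>\<^bsub>CW p K A\<^esub> = \<zero>\<^bsub>CW p K B\<^esub>"
proof -
  obtain s s' where "cw_alg_hom p K A B s s' f" using cw_alg_hom_Ob[OF assms(1-3)] by blast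
  then interpret cw_alg_hom p K A B s s' f .
  note closed = A.CW_add_closed A.CW_smult_closed A.CW_F_closed A.CW_V_closed A.CW_zero_closed
  show "b \<in> carrier (CW p K A) \<Longrightarrow>
      CW_map p K A B f (a \<oplus>\<^bsub>CW p K A\<^esub> b) = CW_map p K A B f a \<oplus>\<^bsub>CW p K B\<^esub> CW_map p K A B f b"
    "x \<in> carrier (WR p K) \<Longrightarrow> CW_map p K A B f (x \<odot>\<^bsub>CW p K A\<^esub> a) = x \<odot>\<^bsub>CW p K B\<^esub> CW_map p K A B f a"
    "CW_map p K A B f (Fop (CW p K A) a) = Fop (CW p K B) (CW_map p K A B f a)"
    "CW_map p K A B f (Vop (CW p K A) a) = Vop (CW p K B) (CW_map p K A B f a)"
    "CW_map p K A B f \<zero>\<^bsub>CW p K A\<^esub> = \<zero>\<^bsub>CW p K B\<^esub>"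
    using assms(4) closed by (simp_all add: CW_map_def map_add map_smult map_F map_V map_zero)
qed

section \<open>Covectors as a functor to abelian groups\<close>

lemma CW_functor_simps:
  "carrier (on_ob (CW_functor p K) A) = carrier (CW p K A)"
  "mult (on_ob (CW_functor p K) A) = add (CW p K A)" "one (on_ob (CW_functor p K) A) = zero (CW p K A)"
  "on_mor (CW_functor p K) = CW_map p K"
  by (simp_all add: CW_functor_def)

lemma is_functor_CW: "is_functor AC ab_cat (CW_functor p K)"
  unfolding is_functor_def
proof (intro conjI ballI)
  fix A :: "('k, 'a) module" assume A: "A \<in> Ob AC"
  interpret CA: module "WR p K" "CW p K A" by (rule CW_module_Ob[OF A])
  have "comm_group (on_ob (CW_functor p K) A)"
  proof (rule comm_groupI)
    fix a assume "a \<in> carrier (on_ob (CW_functor p K) A)"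
    then show "\<exists>b\<in>carrier (on_ob (CW_functor p K) A). b \<otimes>\<^bsub>on_ob (CW_functor p K) A\<^esub> a = \<one>\<^bsub>on_ob (CW_functor p K) A\<^esub>"
      by (intro bexI[of _ "\<ominus>\<^bsub>CW p K A\<^esub> a"]) (simp_all add: CW_functor_simps CA.M.l_neg)
  qed (simp_all add: CW_functor_simps CA.M.a_ac)
  then show "on_ob (CW_functor p K) A \<in> Ob ab_cat" by (simp add: ab_cat_def)
  have fA: "a n \<in> carrier A" if "a \<in> carrier (CW p K A)" for a n
    using that by (simp add: CW_mem[OF A])
  show "on_mor (CW_functor p K) A A (Id AC A) = Id ab_cat (on_ob (CW_functor p K) A)"
    unfolding CW_map_def using fA
    by (auto simp: CW_functor_simps CW_map_def ab_cat_def AC_simps fun_eq_iff intro!: restrict_ext)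
  fix B :: "('k, 'a) module" and f assume B: "B \<in> Ob AC" and f: "f \<in> Hom AC A B"
  show "on_mor (CW_functor p K) A B f \<in> Hom ab_cat (on_ob (CW_functor p K) A) (on_ob (CW_functor p K) B)"
    using CW_map_closed[OF A B f] CW_map_ops(1)[OF A B f] by (auto simp: CW_functor_simps ab_cat_def hom_def CW_map_def)
  fix D :: "('k, 'a) module" and g assume D: "D \<in> Ob AC" and g: "g \<in> Hom AC B D"
  have "f \<circ> a \<in> carrier (CW p K B)" if "a \<in> carrier (CW p K A)" for a
    using CW_map_closed[OF A B f that] that by (simp add: CW_map_def)
  then show "on_mor (CW_functor p K) A D (Comp AC A B D g f) =
      Comp ab_cat (on_ob (CW_functor p K) A) (on_ob (CW_functor p K) B) (on_ob (CW_functor p K) D)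
        (on_mor (CW_functor p K) B D g) (on_mor (CW_functor p K) A B f)"
    unfolding CW_map_def using fA
    by (auto simp: CW_functor_simps CW_map_def ab_cat_def AC_simps compose_def fun_eq_iff intro!: restrict_ext)
qed

end

lemma (in cw_rep) CW_fgps: "(CW_functor p K :: ('k, 'a) ab_functor) \<in> Ob (fgps K)"
  using is_functor_CW represents_CW by (auto simp: fgps_simps ind_representable_def)

context perf_field
begin

section \<open>Pointwise operations on maps to covectors\<close>

context
  fixes G :: "('k, 'a) ab_functor"
  assumes G: "is_functor AC ab_cat G"
begin

abbreviation "NT \<equiv> nat_trans AC ab_cat G (CW_functor p K)"

lemma G_group: "A \<in> Ob AC \<Longrightarrow> comm_group (on_ob G A)"
  using is_functorD(1)[OF G] by (simp add: ab_cat_def)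

lemma G_mor: "A \<in> Ob AC \<Longrightarrow> B \<in> Ob AC \<Longrightarrow> f \<in> Hom AC A B \<Longrightarrow> g \<in> carrier (on_ob G A) \<Longrightarrow>
    on_mor G A B f g \<in> carrier (on_ob G B)"
  using is_functorD(2)[OF G, of A B f] by (auto simp: ab_cat_def hom_def)

lemma G_mult: "A \<in> Ob AC \<Longrightarrow> g \<in> carrier (on_ob G A) \<Longrightarrow> h \<in> carrier (on_ob G A) \<Longrightarrow>
    g \<otimes>\<^bsub>on_ob G A\<^esub> h \<in> carrier (on_ob G A)"
proof -
  assume "A \<in> Ob AC" "g \<in> carrier (on_ob G A)" "h \<in> carrier (on_ob G A)"
  then interpret comm_group "on_ob G A" by (intro G_group)
  show ?thesis by (rule m_closed) fact+
qed

lemma NT_I: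
  assumes "\<And>A g. A \<in> Ob AC \<Longrightarrow> g \<in> carrier (on_ob G A) \<Longrightarrow> t A g \<in> carrier (CW p K A)"
    and "\<And>A g h. A \<in> Ob AC \<Longrightarrow> g \<in> carrier (on_ob G A) \<Longrightarrow> h \<in> carrier (on_ob G A) \<Longrightarrow>
      t A (g \<otimes>\<^bsub>on_ob G A\<^esub> h) = t A g \<oplus>\<^bsub>CW p K A\<^esub> t A h"
    and "\<And>A B f g. A \<in> Ob AC \<Longrightarrow> B \<in> Ob AC \<Longrightarrow> f \<in> Hom AC A B \<Longrightarrow> g \<in> carrier (on_ob G A) \<Longrightarrow>
      t B (on_mor G A B f g) = CW_map p K A B f (t A g)"
  shows "(\<lambda>A\<in>Ob AC. \<lambda>g\<in>carrier (on_ob G A). t A g) \<in> NT"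
proof -
  let ?t = "\<lambda>A\<in>Ob AC. \<lambda>g\<in>carrier (on_ob G A). t A g"
  have "?t \<in> (\<Pi>\<^sub>E A\<in>Ob AC. Hom ab_cat (on_ob G A) (on_ob (CW_functor p K) A))"
    using assms(1,2) G_mult by (auto simp: ab_cat_def CW_functor_simps hom_def)
  moreover have "Comp ab_cat (on_ob G A) (on_ob G B) (on_ob (CW_functor p K) B) (?t B) (on_mor G A B f) =
      Comp ab_cat (on_ob G A) (on_ob (CW_functor p K) A) (on_ob (CW_functor p K) B) (on_mor (CW_functor p K) A B f) (?t A)"
    if "A \<in> Ob AC" "B \<in> Ob AC" "f \<in> Hom AC A B" for A B f
    using that assms(3)[OF that] G_mor[OF that]
    by (auto simp: ab_cat_def CW_functor_simps compose_def intro!: restrict_ext)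
  ultimately show ?thesis by (auto simp: nat_trans_def)
qed

lemma NT_D:
  assumes "\<tau> \<in> NT" "A \<in> Ob AC" "g \<in> carrier (on_ob G A)"
  shows "\<tau> A g \<in> carrier (CW p K A)"
    "h \<in> carrier (on_ob G A) \<Longrightarrow> \<tau> A (g \<otimes>\<^bsub>on_ob G A\<^esub> h) = \<tau> A g \<oplus>\<^bsub>CW p K A\<^esub> \<tau> A h"
    "B \<in> Ob AC \<Longrightarrow> f \<in> Hom AC A B \<Longrightarrow> \<tau> B (on_mor G A B f g) = CW_map p K A B f (\<tau> A g)"
  using nat_trans_abD[OF assms(1,2)] nat_trans_ab_natural[OF assms(1,2)] assms(3)
  by (auto simp: CW_functor_simps hom_def)

lemma NT_eqI:
  assumes "\<sigma> \<in> NT" "\<tau> \<in> NT" "\<And>A g. A \<in> Ob AC \<Longrightarrow> g \<in> carrier (on_ob G A) \<Longrightarrow> \<sigma> A g = \<tau> A g"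
  shows "\<sigma> = \<tau>"
proof (rule extensionalityI[where A = "Ob AC"])
  show "\<sigma> \<in> extensional (Ob AC)" "\<tau> \<in> extensional (Ob AC)"
    using assms(1,2) by (auto simp: nat_trans_def PiE_iff)
  fix A :: "('k, 'a) module" assume A: "A \<in> Ob AC"
  show "\<sigma> A = \<tau> A"
    by (rule extensionalityI[OF nat_trans_abD(2)[OF assms(1) A] nat_trans_abD(2)[OF assms(2) A] assms(3)[OF A]])
qed

lemma D_f_simps:
  "carrier (D_f p K G) = NT"
  "\<zero>\<^bsub>D_f p K G\<^esub> = (\<lambda>A\<in>Ob AC. \<lambda>g\<in>carrier (on_ob G A). \<zero>\<^bsub>CW p K A\<^esub>)"
  "\<sigma> \<oplus>\<^bsub>D_f p K G\<^esub> \<tau> = (\<lambda>A\<in>Ob AC. \<lambda>g\<in>carrier (on_ob G A). \<sigma> A g \<oplus>\<^bsub>CW p K A\<^esub> \<tau> A g)"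
  "x \<odot>\<^bsub>D_f p K G\<^esub> \<tau> = (\<lambda>A\<in>Ob AC. \<lambda>g\<in>carrier (on_ob G A). x \<odot>\<^bsub>CW p K A\<^esub> \<tau> A g)"
  "Fop (D_f p K G) \<tau> = (\<lambda>A\<in>Ob AC. \<lambda>g\<in>carrier (on_ob G A). Fop (CW p K A) (\<tau> A g))"
  "Vop (D_f p K G) \<tau> = (\<lambda>A\<in>Ob AC. \<lambda>g\<in>carrier (on_ob G A). Vop (CW p K A) (\<tau> A g))"
  by (simp_all add: D_f_def fgps_simps)

text \<open>The axioms hold pointwise because they hold in \<open>CW(A)\<close>. The pointwise
  operations stay among the morphisms of formal groups because they are additive on
  \<open>CW(A)\<close> and natural in \<open>A\<close>.\<close>

lemma D_f_dieudonne: "dieudonne_module p K (D_f p K G)"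
proof -
  let ?D = "D_f p K G"
  have mod: "module (WR p K) (CW p K A)" if "A \<in> Ob AC" for A :: "('k, 'a) module"
    by (rule CW_module_Ob[OF that])
  have FV: "Fop (CW p K A) a \<in> carrier (CW p K A)" "Vop (CW p K A) a \<in> carrier (CW p K A)"
    "b \<in> carrier (CW p K A) \<Longrightarrow> Fop (CW p K A) (a \<oplus>\<^bsub>CW p K A\<^esub> b) = Fop (CW p K A) a \<oplus>\<^bsub>CW p K A\<^esub> Fop (CW p K A) b"
    "b \<in> carrier (CW p K A) \<Longrightarrow> Vop (CW p K A) (a \<oplus>\<^bsub>CW p K A\<^esub> b) = Vop (CW p K A) a \<oplus>\<^bsub>CW p K A\<^esub> Vop (CW p K A) b"
    "Fop (CW p K A) (Vop (CW p K A) a) = [p] \<cdot>\<^bsub>CW p K A\<^esub> a" "Vop (CW p K A) (Fop (CW p K A) a) = [p] \<cdot>\<^bsub>CW p K A\<^esub> a"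
    "x \<in> carrier (WR p K) \<Longrightarrow> Fop (CW p K A) (x \<odot>\<^bsub>CW p K A\<^esub> a) = witt_frob p K x \<odot>\<^bsub>CW p K A\<^esub> Fop (CW p K A) a"
    "x \<in> carrier (WR p K) \<Longrightarrow> x \<odot>\<^bsub>CW p K A\<^esub> Vop (CW p K A) a = Vop (CW p K A) (witt_frob p K x \<odot>\<^bsub>CW p K A\<^esub> a)"
    if "A \<in> Ob AC" "a \<in> carrier (CW p K A)" for A :: "('k, 'a) module" and a b x
    using CW_dieudonne_Ob[OF that(1)] that(2) unfolding dieudonne_module_def witt_WR hom_def by auto
  have zero_closed: "\<zero>\<^bsub>?D\<^esub> \<in> carrier ?D"
    unfolding D_f_simps
  proof (rule NT_I)
    fix A :: "('k, 'a) module" assume A: "A \<in> Ob AC"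
    interpret M: module "WR p K" "CW p K A" by (rule mod[OF A])
    show "\<zero>\<^bsub>CW p K A\<^esub> \<in> carrier (CW p K A)" "\<zero>\<^bsub>CW p K A\<^esub> = \<zero>\<^bsub>CW p K A\<^esub> \<oplus>\<^bsub>CW p K A\<^esub> \<zero>\<^bsub>CW p K A\<^esub>" by simp_all
    fix B f assume "B \<in> Ob AC" "f \<in> Hom AC A B"
    then show "\<zero>\<^bsub>CW p K B\<^esub> = CW_map p K A B f \<zero>\<^bsub>CW p K A\<^esub>" using CW_map_ops(5)[OF A, of B f "\<zero>\<^bsub>CW p K A\<^esub>"] by simp
  qed
  have add_closed: "\<sigma> \<oplus>\<^bsub>?D\<^esub> \<tau> \<in> carrier ?D" if "\<sigma> \<in> carrier ?D" "\<tau> \<in> carrier ?D" for \<sigma> \<tau>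
    unfolding D_f_simps
  proof (rule NT_I)
    fix A :: "('k, 'a) module" and g assume A: "A \<in> Ob AC" and g: "g \<in> carrier (on_ob G A)"
    interpret M: module "WR p K" "CW p K A" by (rule mod[OF A])
    note s = NT_D[OF that(1)[unfolded D_f_simps] A] and t = NT_D[OF that(2)[unfolded D_f_simps] A]
    show "\<sigma> A g \<oplus>\<^bsub>CW p K A\<^esub> \<tau> A g \<in> carrier (CW p K A)" using s(1)[OF g] t(1)[OF g] by simp
    show "\<sigma> A (g \<otimes>\<^bsub>on_ob G A\<^esub> h) \<oplus>\<^bsub>CW p K A\<^esub> \<tau> A (g \<otimes>\<^bsub>on_ob G A\<^esub> h) =
        \<sigma> A g \<oplus>\<^bsub>CW p K A\<^esub> \<tau> A g \<oplus>\<^bsub>CW p K A\<^esub> (\<sigma> A h \<oplus>\<^bsub>CW p K A\<^esub> \<tau> A h)" if h: "h \<in> carrier (on_ob G A)" for h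
      using s(1)[OF g] t(1)[OF g] s(1)[OF h] t(1)[OF h] by (simp add: s(2)[OF g h] t(2)[OF g h] M.M.a_ac)
    fix B f assume B: "B \<in> Ob AC" and f: "f \<in> Hom AC A B"
    show "\<sigma> B (on_mor G A B f g) \<oplus>\<^bsub>CW p K B\<^esub> \<tau> B (on_mor G A B f g) = CW_map p K A B f (\<sigma> A g \<oplus>\<^bsub>CW p K A\<^esub> \<tau> A g)"
      using CW_map_ops(1)[OF A B f s(1)[OF g] t(1)[OF g]] by (simp add: s(3)[OF g B f] t(3)[OF g B f])
  qed
  \<comment> \<open>One criterion for scalars, \<open>F\<close> and \<open>V\<close>: any natural
    additive operation on \<open>CW\<close> acts by composition.\<close>
  have op_closed: "(\<lambda>A\<in>Ob AC. \<lambda>g\<in>carrier (on_ob G A). op A (\<tau> A g)) \<in> carrier ?D"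
    if \<tau>: "\<tau> \<in> carrier ?D" and op: "\<And>A a. A \<in> Ob AC \<Longrightarrow> a \<in> carrier (CW p K A) \<Longrightarrow> op A a \<in> carrier (CW p K A)"
      "\<And>A a b. A \<in> Ob AC \<Longrightarrow> a \<in> carrier (CW p K A) \<Longrightarrow> b \<in> carrier (CW p K A) \<Longrightarrow>
        op A (a \<oplus>\<^bsub>CW p K A\<^esub> b) = op A a \<oplus>\<^bsub>CW p K A\<^esub> op A b"
      "\<And>A B f a. A \<in> Ob AC \<Longrightarrow> B \<in> Ob AC \<Longrightarrow> f \<in> Hom AC A B \<Longrightarrow> a \<in> carrier (CW p K A) \<Longrightarrow>
        op B (CW_map p K A B f a) = CW_map p K A B f (op A a)" for \<tau> and op :: "('k, 'a) module \<Rightarrow> (nat \<Rightarrow> 'a) \<Rightarrow> (nat \<Rightarrow> 'a)"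
    unfolding D_f_simps
  proof (rule NT_I)
    fix A :: "('k, 'a) module" and g assume A: "A \<in> Ob AC" and g: "g \<in> carrier (on_ob G A)"
    note t = NT_D[OF \<tau>[unfolded D_f_simps] A]
    show "op A (\<tau> A g) \<in> carrier (CW p K A)" by (intro op A t(1) g)
    show "op A (\<tau> A (g \<otimes>\<^bsub>on_ob G A\<^esub> h)) = op A (\<tau> A g) \<oplus>\<^bsub>CW p K A\<^esub> op A (\<tau> A h)" if h: "h \<in> carrier (on_ob G A)" for h
      unfolding t(2)[OF g h] by (intro op A t(1) g h)
    fix B f assume B: "B \<in> Ob AC" and f: "f \<in> Hom AC A B"
    show "op B (\<tau> B (on_mor G A B f g)) = CW_map p K A B f (op A (\<tau> A g))"
      unfolding t(3)[OF g B f] by (intro op A B f t(1) g)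
  qed
  have smult_closed: "x \<odot>\<^bsub>?D\<^esub> \<tau> \<in> carrier ?D" if x: "x \<in> carrier (WR p K)" and \<tau>: "\<tau> \<in> carrier ?D" for x \<tau>
    unfolding D_f_simps(4)
  proof (rule op_closed[OF \<tau>])
    fix A :: "('k, 'a) module" and a assume A: "A \<in> Ob AC" and a: "a \<in> carrier (CW p K A)"
    interpret M: module "WR p K" "CW p K A" by (rule mod[OF A])
    show "x \<odot>\<^bsub>CW p K A\<^esub> a \<in> carrier (CW p K A)" using x a by simp
    show "x \<odot>\<^bsub>CW p K A\<^esub> (a \<oplus>\<^bsub>CW p K A\<^esub> b) = x \<odot>\<^bsub>CW p K A\<^esub> a \<oplus>\<^bsub>CW p K A\<^esub> x \<odot>\<^bsub>CW p K A\<^esub> b"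
      if "b \<in> carrier (CW p K A)" for b using x a that by (rule M.smult_r_distr)
    show "x \<odot>\<^bsub>CW p K B\<^esub> CW_map p K A B f a = CW_map p K A B f (x \<odot>\<^bsub>CW p K A\<^esub> a)"
      if "B \<in> Ob AC" "f \<in> Hom AC A B" for B f using CW_map_ops(2)[OF A that a x] by simp
  qed
  have F_closed: "Fop ?D \<tau> \<in> carrier ?D" if \<tau>: "\<tau> \<in> carrier ?D" for \<tau>
    unfolding D_f_simps(5) by (rule op_closed[OF \<tau>]) (simp_all add: FV CW_map_ops)
  have V_closed: "Vop ?D \<tau> \<in> carrier ?D" if \<tau>: "\<tau> \<in> carrier ?D" for \<tau>
    unfolding D_f_simps(6) by (rule op_closed[OF \<tau>]) (simp_all add: FV CW_map_ops)
  \<comment> \<open>The module structure of \<open>CW(A)\<close> is handed over as a premise, so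
    that the module laws are at hand at every point.\<close>
  have eqI: "\<sigma> = \<tau>" if "\<sigma> \<in> carrier ?D" "\<tau> \<in> carrier ?D"
    "\<And>(A :: ('k, 'a) module) g. A \<in> Ob AC \<Longrightarrow> g \<in> carrier (on_ob G A) \<Longrightarrow> module (WR p K) (CW p K A) \<Longrightarrow> \<sigma> A g = \<tau> A g"
    for \<sigma> \<tau> :: "('k, 'a) ab_functor_mor"
    using NT_eqI[of \<sigma> \<tau>] that mod unfolding D_f_simps by blast
  have mem: "\<tau> A g \<in> carrier (CW p K A)" if "\<tau> \<in> carrier ?D" "A \<in> Ob AC" "g \<in> carrier (on_ob G A)" for \<tau> A g
    using NT_D(1)[of \<tau> A g] that unfolding D_f_simps by blast
  have abg: "abelian_group ?D"
  proof (rule abelian_groupI)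
    fix \<sigma> \<tau> assume st: "\<sigma> \<in> carrier ?D" "\<tau> \<in> carrier ?D"
    show "\<sigma> \<oplus>\<^bsub>?D\<^esub> \<tau> \<in> carrier ?D" by (rule add_closed[OF st])
    show "\<sigma> \<oplus>\<^bsub>?D\<^esub> \<tau> = \<tau> \<oplus>\<^bsub>?D\<^esub> \<sigma>"
    proof (rule eqI)
      fix A :: "('k, 'a) module" and g assume A: "A \<in> Ob AC" and g: "g \<in> carrier (on_ob G A)" and "module (WR p K) (CW p K A)"
      then interpret M: module "WR p K" "CW p K A" by simp
      show "(\<sigma> \<oplus>\<^bsub>?D\<^esub> \<tau>) A g = (\<tau> \<oplus>\<^bsub>?D\<^esub> \<sigma>) A g"
        using A g mem[OF st(1) A g] mem[OF st(2) A g] by (simp add: D_f_simps M.M.a_comm)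
    qed (intro add_closed st)+
    fix \<rho> assume r: "\<rho> \<in> carrier ?D"
    show "\<sigma> \<oplus>\<^bsub>?D\<^esub> \<tau> \<oplus>\<^bsub>?D\<^esub> \<rho> = \<sigma> \<oplus>\<^bsub>?D\<^esub> (\<tau> \<oplus>\<^bsub>?D\<^esub> \<rho>)"
    proof (rule eqI)
      fix A :: "('k, 'a) module" and g assume A: "A \<in> Ob AC" and g: "g \<in> carrier (on_ob G A)" and "module (WR p K) (CW p K A)"
      then interpret M: module "WR p K" "CW p K A" by simp
      show "(\<sigma> \<oplus>\<^bsub>?D\<^esub> \<tau> \<oplus>\<^bsub>?D\<^esub> \<rho>) A g = (\<sigma> \<oplus>\<^bsub>?D\<^esub> (\<tau> \<oplus>\<^bsub>?D\<^esub> \<rho>)) A g"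
        using A g mem[OF st(1) A g] mem[OF st(2) A g] mem[OF r A g] by (simp add: D_f_simps M.M.a_assoc)
    qed (intro add_closed st r)+
  next
    fix \<tau> assume t: "\<tau> \<in> carrier ?D"
    show "\<zero>\<^bsub>?D\<^esub> \<oplus>\<^bsub>?D\<^esub> \<tau> = \<tau>"
    proof (rule eqI)
      fix A :: "('k, 'a) module" and g assume A: "A \<in> Ob AC" and g: "g \<in> carrier (on_ob G A)" and "module (WR p K) (CW p K A)"
      then interpret M: module "WR p K" "CW p K A" by simp
      show "(\<zero>\<^bsub>?D\<^esub> \<oplus>\<^bsub>?D\<^esub> \<tau>) A g = \<tau> A g"
        using A g mem[OF t A g] by (simp add: D_f_simps)
    qed (intro add_closed zero_closed t)+
    \<comment> \<open>As for covectors, the inverse is the action of \<open>-1\<close>; that it is a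
      morphism is already contained in \<open>smult_closed\<close>.\<close>
    let ?m = "\<ominus>\<^bsub>WR p K\<^esub> \<one>\<^bsub>WR p K\<^esub>"
    have m: "?m \<in> carrier (WR p K)" by simp
    have "?m \<odot>\<^bsub>?D\<^esub> \<tau> \<oplus>\<^bsub>?D\<^esub> \<tau> = \<zero>\<^bsub>?D\<^esub>"
    proof (rule eqI)
      fix A :: "('k, 'a) module" and g assume A: "A \<in> Ob AC" and g: "g \<in> carrier (on_ob G A)" and "module (WR p K) (CW p K A)"
      then interpret M: module "WR p K" "CW p K A" by simp
      show "(?m \<odot>\<^bsub>?D\<^esub> \<tau> \<oplus>\<^bsub>?D\<^esub> \<tau>) A g = \<zero>\<^bsub>?D\<^esub> A g"
        using A g mem[OF t A g] by (simp add: D_f_simps M.smult_l_minus M.M.l_neg)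
    qed (intro add_closed smult_closed zero_closed m t)+
    then show "\<exists>\<sigma>\<in>carrier ?D. \<sigma> \<oplus>\<^bsub>?D\<^esub> \<tau> = \<zero>\<^bsub>?D\<^esub>" using smult_closed[OF m t] by blast
  qed (rule zero_closed)
  interpret D: abelian_group ?D by (rule abg)
  have pow: "([k] \<cdot>\<^bsub>?D\<^esub> \<tau>) A g = [k] \<cdot>\<^bsub>CW p K A\<^esub> \<tau> A g" if "\<tau> \<in> carrier ?D" "A \<in> Ob AC" "g \<in> carrier (on_ob G A)" for k :: nat and \<tau> A g
  proof -
    interpret M: module "WR p K" "CW p K A" by (rule mod[OF that(2)])
    show ?thesis
      by (induction k) (use that in \<open>simp_all add: D_f_simps(2,3)\<close>)
  qed
  have smult_ap: "(x \<odot>\<^bsub>?D\<^esub> \<tau>) A g = x \<odot>\<^bsub>CW p K A\<^esub> \<tau> A g" "(\<sigma> \<oplus>\<^bsub>?D\<^esub> \<tau>) A g = \<sigma> A g \<oplus>\<^bsub>CW p K A\<^esub> \<tau> A g"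
    "Fop ?D \<tau> A g = Fop (CW p K A) (\<tau> A g)" "Vop ?D \<tau> A g = Vop (CW p K A) (\<tau> A g)"
    if "A \<in> Ob AC" "g \<in> carrier (on_ob G A)" for x \<sigma> \<tau> A g
    using that by (simp_all add: D_f_simps)
  have "module (WR p K) ?D"
  proof (rule moduleI)
    show "cring (WR p K)" "abelian_group ?D" by (rule K.W.is_cring) (rule abg)
    fix x y \<tau> assume x: "x \<in> carrier (WR p K)" and y: "y \<in> carrier (WR p K)" and t: "\<tau> \<in> carrier ?D"
    show "(x \<oplus>\<^bsub>WR p K\<^esub> y) \<odot>\<^bsub>?D\<^esub> \<tau> = x \<odot>\<^bsub>?D\<^esub> \<tau> \<oplus>\<^bsub>?D\<^esub> y \<odot>\<^bsub>?D\<^esub> \<tau>"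
      by (rule eqI) (use x y t in \<open>auto intro!: smult_closed add_closed module.smult_l_distr simp: smult_ap mem\<close>)
    show "(x \<otimes>\<^bsub>WR p K\<^esub> y) \<odot>\<^bsub>?D\<^esub> \<tau> = x \<odot>\<^bsub>?D\<^esub> (y \<odot>\<^bsub>?D\<^esub> \<tau>)"
      by (rule eqI) (use x y t in \<open>auto intro!: smult_closed add_closed module.smult_assoc1 simp: smult_ap mem\<close>)
  next
    fix x \<sigma> \<tau> assume x: "x \<in> carrier (WR p K)" and s: "\<sigma> \<in> carrier ?D" and t: "\<tau> \<in> carrier ?D"
    show "x \<odot>\<^bsub>?D\<^esub> (\<sigma> \<oplus>\<^bsub>?D\<^esub> \<tau>) = x \<odot>\<^bsub>?D\<^esub> \<sigma> \<oplus>\<^bsub>?D\<^esub> x \<odot>\<^bsub>?D\<^esub> \<tau>"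
      by (rule eqI) (use x s t in \<open>auto intro!: smult_closed add_closed module.smult_r_distr simp: smult_ap mem\<close>)
  next
    fix \<tau> assume t: "\<tau> \<in> carrier ?D"
    show "\<one>\<^bsub>WR p K\<^esub> \<odot>\<^bsub>?D\<^esub> \<tau> = \<tau>"
      by (rule eqI) (use t in \<open>auto intro!: smult_closed module.smult_one simp: smult_ap mem\<close>)
  qed (rule smult_closed)
  moreover have "Fop ?D \<in> hom (add_monoid ?D) (add_monoid ?D)" "Vop ?D \<in> hom (add_monoid ?D) (add_monoid ?D)"
  proof -
    have "Fop ?D (\<sigma> \<oplus>\<^bsub>?D\<^esub> \<tau>) = Fop ?D \<sigma> \<oplus>\<^bsub>?D\<^esub> Fop ?D \<tau>" "Vop ?D (\<sigma> \<oplus>\<^bsub>?D\<^esub> \<tau>) = Vop ?D \<sigma> \<oplus>\<^bsub>?D\<^esub> Vop ?D \<tau>"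
      if "\<sigma> \<in> carrier ?D" "\<tau> \<in> carrier ?D" for \<sigma> \<tau>
      by (rule eqI; use that in \<open>auto intro!: F_closed V_closed add_closed FV(3,4) simp: smult_ap mem\<close>)+
    then show "Fop ?D \<in> hom (add_monoid ?D) (add_monoid ?D)" "Vop ?D \<in> hom (add_monoid ?D) (add_monoid ?D)"
      using F_closed V_closed by (auto simp: hom_def)
  qed
  moreover have "Fop ?D (Vop ?D \<tau>) = [p] \<cdot>\<^bsub>?D\<^esub> \<tau>" "Vop ?D (Fop ?D \<tau>) = [p] \<cdot>\<^bsub>?D\<^esub> \<tau>" if t: "\<tau> \<in> carrier ?D" for \<tau>
  proof -
    have c: "[p] \<cdot>\<^bsub>?D\<^esub> \<tau> \<in> carrier ?D" using t by simp
    show "Fop ?D (Vop ?D \<tau>) = [p] \<cdot>\<^bsub>?D\<^esub> \<tau>" "Vop ?D (Fop ?D \<tau>) = [p] \<cdot>\<^bsub>?D\<^esub> \<tau>"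
      by (rule eqI; use t c in \<open>auto intro!: F_closed V_closed FV(5,6) simp: smult_ap mem pow\<close>)+
  qed
  moreover have "Fop ?D (x \<odot>\<^bsub>?D\<^esub> \<tau>) = witt_frob p K x \<odot>\<^bsub>?D\<^esub> Fop ?D \<tau>"
      "x \<odot>\<^bsub>?D\<^esub> Vop ?D \<tau> = Vop ?D (witt_frob p K x \<odot>\<^bsub>?D\<^esub> \<tau>)"
    if x: "x \<in> carrier (WR p K)" and t: "\<tau> \<in> carrier ?D" for x \<tau>
  proof -
    have fx: "witt_frob p K x \<in> carrier (WR p K)" using x by (auto simp: witt_frob_def WR_sel)
    show "Fop ?D (x \<odot>\<^bsub>?D\<^esub> \<tau>) = witt_frob p K x \<odot>\<^bsub>?D\<^esub> Fop ?D \<tau>"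
      "x \<odot>\<^bsub>?D\<^esub> Vop ?D \<tau> = Vop ?D (witt_frob p K x \<odot>\<^bsub>?D\<^esub> \<tau>)"
      by (rule eqI; use x fx t in \<open>auto intro!: F_closed V_closed smult_closed FV(7,8) simp: smult_ap mem\<close>)+
  qed
  ultimately show ?thesis unfolding dieudonne_module_def witt_WR by blast
qed

end

end

theorem theorem1:
  fixes p :: nat and K :: "'k ring"
    and Fr :: "(('k, 'a) pro_alg, ('k, 'a) pro_alg_mor,
                ('k, 'a) ab_functor, ('k, 'a) ab_functor_mor) cat_functor"
  assumes "perfect_field_char p K"
    and "infinite (UNIV :: 'a set)" and "carrier K \<lesssim> (UNIV :: 'a set)"
    and "is_free_fg_functor K Fr"
  shows "\<exists>\<Phi>.
    (\<forall>R\<in>Ob (alg_cat K). \<Phi> R \<in> dieudonne_iso p K (D_f p K (free_fg K Fr R)) (CW p K R)) \<and>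
    (\<forall>R\<in>Ob (alg_cat K). \<forall>R'\<in>Ob (alg_cat K). \<forall>f\<in>Hom (alg_cat K) R R'.
       \<forall>\<tau>\<in>carrier (D_f p K (free_fg K Fr R)).
         \<Phi> R' (D_f_map p K (free_fg K Fr R') (free_fg K Fr R) (free_fg_map K Fr R R' f) \<tau>) =
         CW_map p K R R' f (\<Phi> R \<tau>))"
proof -
  \<comment> \<open>The bound on the size of \<open>K\<close> enters through \<open>j\<close>, which
    lets structure constants serve as indices.\<close>
  obtain j :: "'k \<Rightarrow> 'a" where j: "inj_on j (carrier K)"
    using assms(3) by (auto simp: lepoll_def)
  \<comment> \<open>An infinite type is equipotent to its square, so products of algebras on
    \<open>'a\<close> fit on \<open>'a\<close> again.\<close>
  have "\<exists>e :: 'a \<times> 'a \<Rightarrow> 'a. bij_betw e (UNIV \<times> UNIV) UNIV"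
    using card_of_Times_same_infinite[OF assms(2)] card_of_ordIso by blast
  then obtain e :: "'a \<times> 'a \<Rightarrow> 'a" where "bij_betw e UNIV UNIV" by auto
  then have e: "inj e" by (simp add: bij_betw_def)
  interpret cw_rep p K e j
    by unfold_locales (rule assms(1), rule e, rule j)
  let ?C = "CW_functor p K :: ('k, 'a) ab_functor"
  let ?Fr = "free_fg K Fr :: ('k, 'a) module \<Rightarrow> ('k, 'a) ab_functor"
  obtain u where u: "\<And>R. R \<in> Ob AC \<Longrightarrow> ?Fr R \<in> Ob (fgps K)"
    "\<And>R. R \<in> Ob AC \<Longrightarrow> u R \<in> carrier (on_ob (?Fr R) R)"
    "\<And>R. R \<in> Ob AC \<Longrightarrow> bij_betw (\<lambda>\<tau>. \<tau> R (u R)) (Hom (fgps K) (?Fr R) ?C) (carrier (on_ob ?C R))"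
    "\<And>R R' f \<tau>. R \<in> Ob AC \<Longrightarrow> R' \<in> Ob AC \<Longrightarrow> f \<in> Hom AC R R' \<Longrightarrow> \<tau> \<in> Hom (fgps K) (?Fr R) ?C \<Longrightarrow>
      Comp (fgps K) (?Fr R') (?Fr R) ?C \<tau> (free_fg_map K Fr R R' f) R' (u R') = on_mor ?C R R' f (\<tau> R (u R))"
    using free_fg_yoneda[OF assms(4) CW_fgps] by blast
  define \<Phi> where "\<Phi> R \<tau> = (\<tau> R (u R) :: nat \<Rightarrow> 'a)" for R :: "('k, 'a) module" and \<tau> :: "('k, 'a) ab_functor_mor"
  show ?thesis
  proof (intro exI[of _ \<Phi>] conjI ballI)
    fix R :: "('k, 'a) module" assume R: "R \<in> Ob AC"
    have F: "is_functor AC ab_cat (?Fr R)" using u(1)[OF R] by (simp add: fgps_simps)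
    have "bij_betw (\<Phi> R) (carrier (D_f p K (?Fr R))) (carrier (CW p K R))"
      using u(3)[OF R] by (simp add: \<Phi>_def[abs_def] D_f_def CW_functor_simps)
    then show "\<Phi> R \<in> dieudonne_iso p K (D_f p K (?Fr R)) (CW p K R)"
      unfolding dieudonne_iso_def using D_f_dieudonne[OF F] CW_dieudonne_Ob[OF R] R u(2)[OF R]
      by (simp add: \<Phi>_def D_f_simps[OF F])
    fix R' f \<tau> assume "R' \<in> Ob AC" "f \<in> Hom AC R R'" "\<tau> \<in> carrier (D_f p K (?Fr R))"
    then show "\<Phi> R' (D_f_map p K (?Fr R') (?Fr R) (free_fg_map K Fr R R' f) \<tau>) = CW_map p K R R' f (\<Phi> R \<tau>)"
      using u(4)[OF R] by (simp add: \<Phi>_def D_f_map_def D_f_def CW_functor_simps)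
  qed
qed

end
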